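(* Let $\mathcal{S}$ be a finite thick generalized octagon of order $(s,t)$, let $\mathcal{G}$ be a thin generalized octagon of order $(s',1)$, and let $\Phi$ be an epimorphism from $\mathcal{S}$ onto $\mathcal{G}$. Then $s'=1$ (so $\mathcal{G}$ is an ordinary octagon), and exactly two classes of epimorphisms $\Phi$ occur, namely the classes (a) and (b) below (that is, each epimorphism belongs to (a) or (b), and both classes occur), up to a suitable permutation of the points of $\mathcal{G}$ (i.e. for a suitable labelling of the points of $\mathcal{G}$ as below). (a) The points of $\mathcal{G}$ are $\overline{a},\overline{b},\overline{c},\overline{d},\overline{e},\overline{f},\overline{g},\overline{h}$ with $\overline{a}\sim\overline{b}\sim\overline{c}\sim\overline{d}\sim\overline{e}\sim\overline{f}\sim\overline{g}\sim\overline{h}\sim\overline{a}$; write $\widetilde{X}=\Phi^{-1}(\overline{x})$ for $\overline{x}\in\{\overline{a},\dots,\overline{h}\}$ (so $\widetilde{A}=\Phi^{-1}(\overline a)$, etc.). There is a line $L$ of $\mathcal{S}$ such that: - $(\widetilde{C},\widetilde{B})$ is a partition of the set of all points incident with $L$, with $1\le|\widetilde{C}|\le s$ and $1\le|\widetilde{B}|\le s$; - $\widetilde{D}$ consists of the points not incident with $L$ but collinear with a point of $\widetilde{C}$; - $\widetilde{A}$ consists of the points not incident with $L$ but collinear with a point of $\widetilde{B}$; - $\widetilde{E}$ consists of the points not in $\widetilde{C}\cup\widetilde{D}$ but collinear with a point of $\widetilde{D}$; - $\widetilde{H}$ consists of the points not in $\widetilde{A}\cup\widetilde{B}$ but collinear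 with a point of $\widetilde{A}$; - $\widetilde{F}$ consists of the points not in $\widetilde{D}\cup\widetilde{E}$ but collinear with a point of $\widetilde{E}$; - $\widetilde{G}$ consists of the points not in $\widetilde{A}\cup\widetilde{H}$ but collinear with a point of $\widetilde{H}$; - $\Phi^{-1}(\overline{c}\,\overline{b})=\{L\}$; - $\Phi^{-1}(\overline{c}\,\overline{d})$ is the set of all lines distinct from $L$ but incident with a point of $\widetilde{C}$; - $\Phi^{-1}(\overline{a}\,\overline{b})$ is the set of all lines distinct from $L$ but incident with a point of $\widetilde{B}$; - $\Phi^{-1}(\overline{d}\,\overline{e})$ is the set of all lines not in $\Phi^{-1}(\overline{d}\,\overline{c})$ but incident with a point of $\widetilde{D}$; - $\Phi^{-1}(\overline{a}\,\overline{h})$ is the set of all lines not in $\Phi^{-1}(\overline{a}\,\overline{b})$ but incident with a point of $\widetilde{A}$; - $\Phi^{-1}(\overline{e}\,\overline{f})$ is the set of all lines not in $\Phi^{-1}(\overline{d}\,\overline{e})$ but incident with a point of $\widetilde{E}$; - $\Phi^{-1}(\overline{g}\,\overline{h})$ is the set of all lines not in $\Phi^{-1}(\overline{a}\,\overline{h})$ but incident with a point of $\widetilde{H}$; - $\Phi^{-1}(\overline{g}\,\overline{f})$ is the set of all lines not in $\Phi^{-1}(\overline{h}\,\overline{g})$ but incident with a point of $\widetilde{G}$ (that is, the set of all lines not in $\Phi^{-1}(\overline{e}\,\overline{f})$ but incident with a point of $\widetilde{F}$). (b) The dual of (a): $\Phi$, regarded as an epimorphism from the point-line dual of $\mathcal{S}$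 (a thick generalized octagon of order $(t,s)$) onto the point-line dual of $\mathcal{G}$ (again an ordinary octagon), is of the form described in (a).
   Context: A point-line geometry $\Gamma=(\mathcal{P},\mathcal{L},\mathbf{I})$ consists of disjoint sets $\mathcal P$ (points) and $\mathcal L$ (lines) with a symmetric incidence relation $\mathbf{I}$ between points and lines. An ordinary $k$-gon is the geometry of $k$ points and $k$ lines whose incidence graph is a cycle of length $2k$ (for $k=2$: two points and two lines, all incident). For $m\ge 3$, $\Gamma$ is a weak generalized $m$-gon if any two elements of $\mathcal{P}\cup\mathcal{L}$ are contained in at least one ordinary sub $m$-gon (as a subgeometry of $\Gamma$), and $\Gamma$ contains no ordinary sub $k$-gons with $2\le k<m$. It is thick (and is then called a thick generalized $m$-gon) if every point is incident with at least three lines and every line with at least three points; otherwise it is thin. It has order $(u,v)$ if each line is incident with exactly $u+1$ points and each point is incident with exactly $v+1$ lines; a thin generalized $m$-gon of order $(u,1)$ is a weak generalized $m$-gon having order $(u,1)$, $u\geq 1$. Octagon means $8$-gon. A polygon is finite if it has finitely many points and lines. A morphism between weak generalized polygons is a map sending points to points and lines to lines and preserving incidence; an epimorphism is a morphism that is surjective on the point set and on the line set. Two distinct points $x,y$ are collinear, $x\sim y$, if they are incident with a common line, denoted $xy$. The point-line dual of a geometry is obtained by interchanging the roles of points and lines. *)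

theory Defs
  imports Main
begin

section \<open>Point-line geometries\<close>

text \<open>Points and lines live in different types, so the two sets are automatically disjoint, and the
  symmetric incidence relation is recorded once, as a set of (point, line) pairs.\<close>

record ('p, 'l) geometry =
  points :: "'p set"
  lines :: "'l set"
  inc :: "('p \<times> 'l) set"

definition is_geometry :: "('p, 'l) geometry \<Rightarrow> bool" where
  "is_geometry \<Gamma> \<longleftrightarrow> inc \<Gamma> \<subseteq> points \<Gamma> \<times> lines \<Gamma>"

definition finite_geometry :: "('p, 'l) geometry \<Rightarrow> bool" where
  "finite_geometry \<Gamma> \<longleftrightarrow> finite (points \<Gamma>) \<and> finite (lines \<Gamma>)"

definition dual :: "('p, 'l) geometry \<Rightarrow> ('l, 'p) geometry" where
  "dual \<Gamma> = \<lparr>points = lines \<Gamma>, lines = points \<Gamma>, inc = converse (inc \<Gamma>)\<rparr>"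

definition points_on :: "('p, 'l) geometry \<Rightarrow> 'l \<Rightarrow> 'p set" where
  "points_on \<Gamma> L = {x \<in> points \<Gamma>. (x, L) \<in> inc \<Gamma>}"

definition lines_through :: "('p, 'l) geometry \<Rightarrow> 'p \<Rightarrow> 'l set" where
  "lines_through \<Gamma> x = {L \<in> lines \<Gamma>. (x, L) \<in> inc \<Gamma>}"

definition subgeometry :: "('p, 'l) geometry \<Rightarrow> ('p, 'l) geometry \<Rightarrow> bool" where
  "subgeometry \<Delta> \<Gamma> \<longleftrightarrow>
     points \<Delta> \<subseteq> points \<Gamma> \<and> lines \<Delta> \<subseteq> lines \<Gamma> \<and>
     inc \<Delta> = inc \<Gamma> \<inter> (points \<Delta> \<times> lines \<Delta>)"

text \<open>The incidence graph is the cycle \<open>p 0, l 0, p 1, l 1, \<dots>, p (k - 1), l (k - 1), p 0\<close>.\<close>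

definition ordinary_polygon :: "nat \<Rightarrow> ('p, 'l) geometry \<Rightarrow> bool" where
  "ordinary_polygon k \<Gamma> \<longleftrightarrow> 2 \<le> k \<and>
     (\<exists>p l. bij_betw p {..<k} (points \<Gamma>) \<and> bij_betw l {..<k} (lines \<Gamma>) \<and>
        inc \<Gamma> = {(p i, l i) |i. i < k} \<union> {(p (Suc i mod k), l i) |i. i < k})"

section \<open>Generalized polygons\<close>

text \<open>Elements of \<open>\<P> \<union> \<L>\<close> are represented in the disjoint sum of the two types. The empty geometry,
  which satisfies the remaining conditions vacuously, is excluded explicitly.\<close>

definition weak_generalized_polygon :: "nat \<Rightarrow> ('p, 'l) geometry \<Rightarrow> bool" where
  "weak_generalized_polygon m \<Gamma> \<longleftrightarrow> 3 \<le> m \<and> is_geometry \<Gamma> \<and>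
     points \<Gamma> <+> lines \<Gamma> \<noteq> {} \<and>
     (\<forall>x \<in> points \<Gamma> <+> lines \<Gamma>. \<forall>y \<in> points \<Gamma> <+> lines \<Gamma>.
        \<exists>\<Delta>. subgeometry \<Delta> \<Gamma> \<and> ordinary_polygon m \<Delta> \<and>
            x \<in> points \<Delta> <+> lines \<Delta> \<and> y \<in> points \<Delta> <+> lines \<Delta>) \<and>
     (\<forall>k. 2 \<le> k \<and> k < m \<longrightarrow> (\<nexists>\<Delta>. subgeometry \<Delta> \<Gamma> \<and> ordinary_polygon k \<Delta>))"

text \<open>The disjunct \<open>infinite\<close> is needed because \<open>card\<close> is 0 on infinite sets.\<close>

definition thick :: "('p, 'l) geometry \<Rightarrow> bool" where
  "thick \<Gamma> \<longleftrightarrow>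
     (\<forall>x \<in> points \<Gamma>. infinite (lines_through \<Gamma> x) \<or> 3 \<le> card (lines_through \<Gamma> x)) \<and>
     (\<forall>L \<in> lines \<Gamma>. infinite (points_on \<Gamma> L) \<or> 3 \<le> card (points_on \<Gamma> L))"

definition has_order :: "('p, 'l) geometry \<Rightarrow> nat \<Rightarrow> nat \<Rightarrow> bool" where
  "has_order \<Gamma> u v \<longleftrightarrow>
     (\<forall>L \<in> lines \<Gamma>. card (points_on \<Gamma> L) = u + 1) \<and>
     (\<forall>x \<in> points \<Gamma>. card (lines_through \<Gamma> x) = v + 1)"

definition thick_generalized_polygon :: "nat \<Rightarrow> ('p, 'l) geometry \<Rightarrow> bool" where
  "thick_generalized_polygon m \<Gamma> \<longleftrightarrow> weak_generalized_polygon m \<Gamma> \<and> thick \<Gamma>"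

text \<open>A thin generalized \<open>m\<close>-gon of order \<open>(u, 1)\<close>.\<close>

definition thin_generalized_polygon :: "nat \<Rightarrow> nat \<Rightarrow> ('p, 'l) geometry \<Rightarrow> bool" where
  "thin_generalized_polygon m u \<Gamma> \<longleftrightarrow>
     weak_generalized_polygon m \<Gamma> \<and> has_order \<Gamma> u 1 \<and> 1 \<le> u"

definition collinear :: "('p, 'l) geometry \<Rightarrow> 'p \<Rightarrow> 'p \<Rightarrow> bool" where
  "collinear \<Gamma> x y \<longleftrightarrow> x \<in> points \<Gamma> \<and> y \<in> points \<Gamma> \<and> x \<noteq> y \<and>
     (\<exists>L \<in> lines \<Gamma>. (x, L) \<in> inc \<Gamma> \<and> (y, L) \<in> inc \<Gamma>)"

text \<open>The line \<open>xy\<close>; meaningful for collinear points \<open>x\<close>, \<open>y\<close> of a weak generalized polygon, where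
  the absence of ordinary 2-gons makes the line unique.\<close>

definition joining_line :: "('p, 'l) geometry \<Rightarrow> 'p \<Rightarrow> 'p \<Rightarrow> 'l" where
  "joining_line \<Gamma> x y = (THE L. L \<in> lines \<Gamma> \<and> (x, L) \<in> inc \<Gamma> \<and> (y, L) \<in> inc \<Gamma>)"

section \<open>Epimorphisms\<close>

text \<open>A map between geometries is a pair of a point map and a line map; only the values on the points
  and lines of the source matter.\<close>

definition morphism ::
  "('p, 'l) geometry \<Rightarrow> ('q, 'm) geometry \<Rightarrow> ('p \<Rightarrow> 'q) \<times> ('l \<Rightarrow> 'm) \<Rightarrow> bool" where
  "morphism \<Gamma> \<Delta> \<Phi> \<longleftrightarrow>
     fst \<Phi> ` points \<Gamma> \<subseteq> points \<Delta> \<and> snd \<Phi> ` lines \<Gamma> \<subseteq> lines \<Delta> \<and>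
     (\<forall>x L. (x, L) \<in> inc \<Gamma> \<longrightarrow> (fst \<Phi> x, snd \<Phi> L) \<in> inc \<Delta>)"

definition epimorphism ::
  "('p, 'l) geometry \<Rightarrow> ('q, 'm) geometry \<Rightarrow> ('p \<Rightarrow> 'q) \<times> ('l \<Rightarrow> 'm) \<Rightarrow> bool" where
  "epimorphism \<Gamma> \<Delta> \<Phi> \<longleftrightarrow> morphism \<Gamma> \<Delta> \<Phi> \<and>
     fst \<Phi> ` points \<Gamma> = points \<Delta> \<and> snd \<Phi> ` lines \<Gamma> = lines \<Delta>"

definition point_fibre ::
  "('p, 'l) geometry \<Rightarrow> ('p \<Rightarrow> 'q) \<times> ('l \<Rightarrow> 'm) \<Rightarrow> 'q \<Rightarrow> 'p set" where
  "point_fibre \<Gamma> \<Phi> x = {y \<in> points \<Gamma>. fst \<Phi> y = x}"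

definition line_fibre ::
  "('p, 'l) geometry \<Rightarrow> ('p \<Rightarrow> 'q) \<times> ('l \<Rightarrow> 'm) \<Rightarrow> 'm \<Rightarrow> 'l set" where
  "line_fibre \<Gamma> \<Phi> M = {L \<in> lines \<Gamma>. snd \<Phi> L = M}"

section \<open>The two classes of epimorphisms\<close>

text \<open>The set of points of \<open>\<Gamma>\<close> collinear with some point of \<open>X\<close>, and the set of lines of \<open>\<Gamma>\<close>
  incident with some point of \<open>X\<close>.\<close>

definition collinear_with_some :: "('p, 'l) geometry \<Rightarrow> 'p set \<Rightarrow> 'p set" where
  "collinear_with_some \<Gamma> X = {y \<in> points \<Gamma>. \<exists>x \<in> X. collinear \<Gamma> y x}"

definition lines_meeting :: "('p, 'l) geometry \<Rightarrow> 'p set \<Rightarrow> 'l set" where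
  "lines_meeting \<Gamma> X = {M \<in> lines \<Gamma>. \<exists>x \<in> X. (x, M) \<in> inc \<Gamma>}"

text \<open>Class (a), for a source \<open>S\<close> whose lines have \<open>s + 1\<close> points. The existential quantifier over
  \<open>a, \<dots>, h\<close> is the choice of a suitable labelling of the points of \<open>G\<close>.\<close>

definition class_a ::
  "('p, 'l) geometry \<Rightarrow> nat \<Rightarrow> ('q, 'm) geometry \<Rightarrow> ('p \<Rightarrow> 'q) \<times> ('l \<Rightarrow> 'm) \<Rightarrow> bool" where
  "class_a S s G \<Phi> \<longleftrightarrow>
     (\<exists>a b c d e f g h.
        distinct [a, b, c, d, e, f, g, h] \<and> points G = {a, b, c, d, e, f, g, h} \<and>
        collinear G a b \<and> collinear G b c \<and> collinear G c d \<and> collinear G d e \<and>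
        collinear G e f \<and> collinear G f g \<and> collinear G g h \<and> collinear G h a \<and>
        (let A = point_fibre S \<Phi> a; B = point_fibre S \<Phi> b;
             C = point_fibre S \<Phi> c; D = point_fibre S \<Phi> d;
             E = point_fibre S \<Phi> e; F = point_fibre S \<Phi> f;
             G' = point_fibre S \<Phi> g; H = point_fibre S \<Phi> h;
             fib = (\<lambda>x y. line_fibre S \<Phi> (joining_line G x y))
         in \<exists>L \<in> lines S.
              C \<union> B = points_on S L \<and> C \<inter> B = {} \<and>
              1 \<le> card C \<and> card C \<le> s \<and> 1 \<le> card B \<and> card B \<le> s \<and>
              D = collinear_with_some S C - points_on S L \<and>
              A = collinear_with_some S B - points_on S L \<and>
              E = collinear_with_some S D - (C \<union> D) \<and>
              H = collinear_with_some S A - (A \<union> B) \<and>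
              F = collinear_with_some S E - (D \<union> E) \<and>
              G' = collinear_with_some S H - (A \<union> H) \<and>
              fib c b = {L} \<and>
              fib c d = lines_meeting S C - {L} \<and>
              fib a b = lines_meeting S B - {L} \<and>
              fib d e = lines_meeting S D - fib d c \<and>
              fib a h = lines_meeting S A - fib a b \<and>
              fib e f = lines_meeting S E - fib d e \<and>
              fib g h = lines_meeting S H - fib a h \<and>
              fib g f = lines_meeting S G' - fib h g \<and>
              fib g f = lines_meeting S F - fib e f))"

text \<open>Class (b), for a source \<open>S\<close> whose points are on \<open>t + 1\<close> lines: the dual of class (a).\<close>

definition class_b ::
  "('p, 'l) geometry \<Rightarrow> nat \<Rightarrow> ('q, 'm) geometry \<Rightarrow> ('p \<Rightarrow> 'q) \<times> ('l \<Rightarrow> 'm) \<Rightarrow> bool" where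
  "class_b S t G \<Phi> \<longleftrightarrow> class_a (dual S) t (dual G) (prod.swap \<Phi>)"

end

theory Submission
  imports Defs Complex_Main
begin

text \<open>We view a generalized octagon as its incidence graph: the diameter is 8, and a vertex \<open>y\<close> at distance
  less than 8 from \<open>x\<close> has only one neighbour closer to \<open>x\<close>. Let \<open>\<phi>\<close> be an epimorphism. If \<open>x\<close>, \<open>y\<close> are
  opposite in the image, then elements over \<open>x\<close> and over \<open>y\<close> are opposite, and comparing their neighbours
  along a path \<open>x, a, \<dots>, b, y\<close> shows that the number \<open>w x a\<close> of neighbours over \<open>a\<close> of an element over \<open>x\<close>
  depends only on \<open>x\<close> and \<open>a\<close>, and that \<open>w x a = w y b\<close>. Counting a fibre from base points at distance 7
  and at distance 5 gives a quadratic identity between the weights.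

  If the lines of the image have at least three points, projectivities force the weights to be constant on lines
  and on points, and the identity becomes \<open>(s - 1) (f - 1) = 0\<close> with \<open>2 f = t + 1\<close>. Otherwise the image is a
  16-cycle with weights \<open>p i = w (c i) (c (i + 1))\<close>, and after normalising \<open>p i\<close> to \<open>\<alpha> i \<in> [0, 1]\<close> with
  \<open>\<alpha> (i + 8) = 1 - \<alpha> i\<close> the identity says that independent random bits with expectations \<open>\<alpha> i\<close> change on
  average once along 8 consecutive steps. As the number of changes is odd, it is never 3, which leaves
  seven consecutive weights equal to 1, that is, a fibre with a single element. Such a fibre determines
  everything else; it is a line in class (a) and a point in class (b).\<close>

section \<open>Octagons as graphs\<close>

text \<open>Products of weights count a fibre only where its distances from a base element are
  known. Under \<open>\<phi>\<close> distances do not grow and keep their parity, and 8 bounds them: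
  over vertices at distance 7 elements are at distance 7, over vertices at distance 5 they are at
  distance 5 or 7. The two base points lie two steps apart on one walk, so both counts share five
  weights, and after cancellation only products of two weights survive. The excess at distance 7 in
  the second count comes from walks with one detour; the care lies in detours along an edge of the
  walk, which both of its ends see.

  In the cyclic case bit i + 8 is the complement of bit i, so eight steps lead from a bit to its
  complement, whence the odd number of changes. To exclude three changes it suffices to compare four
  bits, at i < j < k and at i + 8, and this makes products of three factors vanish. A weight 1 has
  \<open>\<alpha>\<close> equal to 0, and the size of a fibre is the product of the seven weights
  along a walk that ends there, so seven zeros in a row are what is wanted.\<close>

locale bip_graph =
  fixes V :: "'v set" and adj :: "'v \<Rightarrow> 'v \<Rightarrow> bool" and col :: "'v \<Rightarrow> bool"
  assumes adj_sym: "adj x y \<Longrightarrow> adj y x"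
    and adj_V: "adj x y \<Longrightarrow> x \<in> V"
    and adj_col: "adj x y \<Longrightarrow> col x \<noteq> col y"
    and diam: "x \<in> V \<Longrightarrow> y \<in> V \<Longrightarrow> \<exists>k\<le>8. (adj ^^ k) x y"
begin

section \<open>Distance, parity and geodesics\<close>

definition d :: "'v \<Rightarrow> 'v \<Rightarrow> nat" where
  "d x y = (LEAST k. (adj ^^ k) x y)"

lemma adj_V2: "adj x y \<Longrightarrow> y \<in> V"
  using adj_V adj_sym by blast

lemma adj_commute: "adj x y \<longleftrightarrow> adj y x"
  using adj_sym by blast

lemma d_le: "(adj ^^ k) x y \<Longrightarrow> d x y \<le> k"
  unfolding d_def by (rule Least_le)

lemma walk_d: "x \<in> V \<Longrightarrow> y \<in> V \<Longrightarrow> (adj ^^ d x y) x y"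
  unfolding d_def using diam by (metis (mono_tags, lifting) LeastI)

lemma d_le_8: "x \<in> V \<Longrightarrow> y \<in> V \<Longrightarrow> d x y \<le> 8"
  using diam d_le le_trans by blast

lemma d_self [simp]: "d x x = 0"
  using d_le[of 0 x x] by simp

lemma d_eq_0_iff: "x \<in> V \<Longrightarrow> y \<in> V \<Longrightarrow> d x y = 0 \<longleftrightarrow> x = y"
  using walk_d[of x y] by auto

lemma walk_sym: "(adj ^^ k) x y \<Longrightarrow> (adj ^^ k) y x"
proof (induction k arbitrary: y)
  case (Suc k)
  then obtain z where "(adj ^^ k) x z" "adj z y"
    by auto
  then show ?case
    using Suc.IH relpowp_Suc_I2[of adj y z k x] adj_sym by blast
qed auto

lemma d_sym: "d x y = d y x"
  unfolding d_def using walk_sym by (metis (no_types, lifting))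

lemma walk_parity: "(adj ^^ k) x y \<Longrightarrow> (col x = col y) \<longleftrightarrow> even k"
proof (induction k arbitrary: y)
  case (Suc k)
  then obtain z where "(adj ^^ k) x z" "adj z y"
    by auto
  then show ?case
    using Suc.IH[of z] adj_col[of z y] by auto
qed auto

lemma d_parity: "x \<in> V \<Longrightarrow> y \<in> V \<Longrightarrow> (col x = col y) \<longleftrightarrow> even (d x y)"
  using walk_parity walk_d by blast

lemma d_adj_le: "x \<in> V \<Longrightarrow> adj y z \<Longrightarrow> d x z \<le> Suc (d x y)"
  using walk_d[of x y] adj_V d_le relpowp_Suc_I by metis

text \<open>The ends of an edge have different colours, and colour determines the parity of the
  distance from \<open>x\<close>; so the two distances cannot be equal.\<close>

lemma d_adj:
  assumes "x \<in> V" "adj y z"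
  shows "d x z = Suc (d x y) \<or> d x y = Suc (d x z)"
proof -
  have "d x z \<le> Suc (d x y)" "d x y \<le> Suc (d x z)"
    using d_adj_le assms adj_sym by blast+
  moreover have "d x y \<noteq> d x z"
    using d_parity[of x y] d_parity[of x z] adj_col[of y z] assms adj_V adj_V2 by metis
  ultimately show ?thesis
    by linarith
qed

lemma d_pred:
  assumes "x \<in> V" "y \<in> V" "d x y = Suc k"
  shows "\<exists>z. adj y z \<and> d x z = k"
proof -
  obtain z where z: "(adj ^^ k) x z" "adj z y"
    using walk_d[OF assms(1,2)] assms(3) by auto
  have "d x z \<le> k"
    using d_le z by blast
  moreover have "Suc k \<le> Suc (d x z)"
    using d_adj_le[OF assms(1) z(2)] assms(3) by simp
  ultimately show ?thesis
    using z adj_sym by auto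
qed

lemma d_triangle:
  assumes "x \<in> V" "y \<in> V" "z \<in> V"
  shows "d x z \<le> d x y + d y z"
proof (rule d_le)
  show "(adj ^^ (d x y + d y z)) x z"
    using walk_d assms by (metis relpowp_add relcompp.relcompI)
qed

lemma d_adj_1: "adj x y \<Longrightarrow> d x y = 1"
  using d_adj[of x x y] adj_V by fastforce

lemma d_from_adj:
  assumes "adj x y" "z \<in> V"
  shows "d x z = Suc (d y z) \<or> d y z = Suc (d x z)"
  using d_adj[OF assms(2) assms(1)] by (auto simp: d_sym)

lemma ex_geodesic:
  assumes "x \<in> V" "y \<in> V"
  shows "\<exists>g. g 0 = y \<and> g (d x y) = x \<and> (\<forall>i\<le>d x y. d x (g i) = d x y - i) \<and>
    (\<forall>i<d x y. adj (g i) (g (Suc i)))"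
  using assms(2)
proof (induction "d x y" arbitrary: y)
  case 0
  then have "x = y"
    using d_eq_0_iff assms(1) by metis
  then show ?case
    by (intro exI[of _ "\<lambda>_. x"]) auto
next
  case (Suc k)
  obtain z where z: "adj y z" "d x z = k"
    using d_pred[OF assms(1) Suc.prems] Suc.hyps(2) by metis
  obtain g where g: "g 0 = z" "g k = x" "\<forall>i\<le>k. d x (g i) = k - i" "\<forall>i<k. adj (g i) (g (Suc i))"
    using Suc.hyps(1)[of z] z adj_V2 by metis
  show ?case
    unfolding Suc.hyps(2)[symmetric]
    using g z Suc.hyps(2)
    by (intro exI[of _ "case_nat y g"]) (auto split: nat.split simp: le_Suc_eq less_Suc_eq_0_disj)
qed

text \<open>Non-backtracking walks stand in for geodesics and apartments: the condition is local and
  therefore survives shifting, truncation and reversal. Values of \<open>c\<close> beyond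
  \<open>n\<close> are arbitrary.\<close>

definition nb_walk :: "(nat \<Rightarrow> 'v) \<Rightarrow> nat \<Rightarrow> bool" where
  "nb_walk c n \<longleftrightarrow> (\<forall>i<n. adj (c i) (c (Suc i))) \<and> (\<forall>i. Suc i < n \<longrightarrow> c i \<noteq> c (Suc (Suc i)))"

lemma nb_walk_adj:
  assumes "nb_walk c n" "i < n"
  shows "adj (c i) (c (Suc i))" "adj (c (Suc i)) (c i)"
  using assms adj_sym unfolding nb_walk_def by blast+

lemma nb_walk_shift: "nb_walk c (n + k) \<Longrightarrow> nb_walk (\<lambda>i. c (i + k)) n"
  unfolding nb_walk_def by auto

lemma nb_walk_mono: "nb_walk c n \<Longrightarrow> k \<le> n \<Longrightarrow> nb_walk c k"
  unfolding nb_walk_def by auto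

lemma nb_walk_rev:
  assumes "nb_walk c n"
  shows "nb_walk (\<lambda>i. c (n - i)) n"
  unfolding nb_walk_def
proof (intro conjI allI impI)
  fix i assume "i < n"
  then show "adj (c (n - i)) (c (n - Suc i))"
    using assms unfolding nb_walk_def
    by (metis Suc_diff_Suc adj_sym diff_less_Suc diff_Suc_less less_zeroE not_gr_zero)
next
  fix i assume i: "Suc i < n"
  then have "n - i = Suc (Suc (n - Suc (Suc i)))" "Suc (n - Suc (Suc i)) < n"
    by linarith+
  then show "c (n - i) \<noteq> c (n - Suc (Suc i))"
    using assms unfolding nb_walk_def by metis
qed

lemma nb_walk_V: "nb_walk c n \<Longrightarrow> 0 < n \<Longrightarrow> i \<le> n \<Longrightarrow> c i \<in> V"
  unfolding nb_walk_def using adj_V adj_V2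
  by (metis Suc_pred le_neq_implies_less lessI)

end

text \<open>\<open>unique_pred\<close> is the absence of ordinary \<open>k\<close>-gons for
  \<open>k < 8\<close> in local form: below distance 8 the step towards \<open>x\<close> is unique.
  \<open>another_nbr\<close> lets every walk continue without turning back.\<close>

locale octagon = bip_graph +
  assumes unique_pred: "x \<in> V \<Longrightarrow> d x y < 8 \<Longrightarrow> adj y a \<Longrightarrow> adj y b \<Longrightarrow>
      d x y = Suc (d x a) \<Longrightarrow> d x y = Suc (d x b) \<Longrightarrow> a = b"
    and another_nbr: "x \<in> V \<Longrightarrow> \<exists>z. adj x z \<and> z \<noteq> y"
begin

text \<open>Below distance 8 the only neighbour of \<open>c m\<close> nearer to \<open>c 0\<close>
  is the vertex just left, and a non-backtracking walk avoids it; so each step leads one further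
  away until distance 8 is reached.\<close>

lemma d_nb_walk:
  assumes "nb_walk c n" "n \<le> 8"
  shows "d (c 0) (c n) = n"
  using assms
proof (induction n rule: less_induct)
  case (less n)
  show ?case
  proof (cases n)
    case (Suc m)
    have V0: "c 0 \<in> V" and a: "adj (c m) (c n)"
      using less.prems nb_walk_V[of c n 0] Suc unfolding nb_walk_def by auto
    have m: "d (c 0) (c m) = m"
      using less nb_walk_mono[of c n m] Suc by auto
    show ?thesis
    proof (cases m)
      case 0
      then show ?thesis using a d_adj_1 Suc by auto
    next
      case (Suc k)
      have k: "d (c 0) (c k) = k"
        using less nb_walk_mono[of c n k] Suc \<open>n = Suc m\<close> by auto
      have "adj (c m) (c k)" "c k \<noteq> c n"
        using less.prems adj_sym Suc \<open>n = Suc m\<close> unfolding nb_walk_def by auto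
      then have "d (c 0) (c m) \<noteq> Suc (d (c 0) (c n))"
        using unique_pred[OF V0 _ a, of "c k"] m k Suc less.prems \<open>n = Suc m\<close> by auto
      then show ?thesis
        using d_adj[OF V0 a] m \<open>n = Suc m\<close> by auto
    qed
  qed simp
qed

lemma unique_descent:
  assumes "x \<in> V" "adj y a" "adj y b" "d x y = Suc (d x a)" "d x y = Suc (d x b)" "d x y \<noteq> 8"
  shows "a = b"
  using unique_pred[of x y a b] assms d_le_8[of x y] adj_V[of y a] by force

text \<open>The recursion carries a vertex together with its successor, because the choice of the
  next vertex has to know which one to avoid.\<close>

lemma ex_infinite_nb_walk:
  assumes "adj x a"
  shows "\<exists>c. c 0 = x \<and> c 1 = a \<and> (\<forall>n. nb_walk c n)"
proof -
  define g where "g = rec_nat (x, a) (\<lambda>_ (y, z). (z, SOME z'. adj z z' \<and> z' \<noteq> y))"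
  have g: "g 0 = (x, a)" "g (Suc n) = (snd (g n), SOME z'. adj (snd (g n)) z' \<and> z' \<noteq> fst (g n))" for n
    by (simp_all add: g_def case_prod_beta)
  have step: "adj (snd (g n)) (snd (g (Suc n))) \<and> snd (g (Suc n)) \<noteq> fst (g n)"
    if "adj (fst (g n)) (snd (g n))" for n
  proof -
    have "\<exists>z'. adj (snd (g n)) z' \<and> z' \<noteq> fst (g n)"
      using another_nbr adj_V2[OF that] by blast
    from someI_ex[OF this] show ?thesis
      by (simp add: g)
  qed
  have fst_Suc: "fst (g (Suc n)) = snd (g n)" for n
    by (simp add: g)
  have adj_g: "adj (fst (g n)) (snd (g n))" for n
    by (induction n) (use assms step fst_Suc in \<open>auto simp: g(1)\<close>)
  have "nb_walk (\<lambda>n. fst (g n)) n" for n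
    unfolding nb_walk_def using adj_g step fst_Suc by metis
  then show ?thesis
    by (intro exI[of _ "\<lambda>n. fst (g n)"]) (simp add: g)
qed

lemma ex_nb_walk:
  assumes "adj x a"
  shows "\<exists>c. c 0 = x \<and> c 1 = a \<and> nb_walk c n"
  using ex_infinite_nb_walk[OF assms] by blast

text \<open>An apartment through \<open>a\<close>, \<open>L\<close>, \<open>b\<close>: the walk from
  \<open>L\<close> through \<open>a\<close> ends at an opposite vertex \<open>c 8\<close>, and a
  geodesic from there to \<open>b\<close> closes it. Index 17 repeats index 1 so that the turn at
  \<open>L\<close> is covered too.\<close>

lemma ex_16_cycle:
  assumes "adj L a" "adj L b" "a \<noteq> b"
  obtains c where "nb_walk c 17" "c 0 = L" "c 1 = a" "c 15 = b" "c 16 = L" "c 17 = a"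
proof -
  obtain c where c: "c 0 = L" "c 1 = a" "nb_walk c 8"
    using ex_nb_walk[OF assms(1)] by blast
  have bV: "b \<in> V" and cV: "c 8 \<in> V"
    using assms adj_V2 nb_walk_V[OF c(3)] by auto
  \<comment> \<open>With \<open>b\<close> put in front of \<open>L\<close>, the walk of length 8
    shows that \<open>b\<close> is opposite to \<open>c 7\<close>; its neighbour \<open>c 8\<close>
    is then at distance 7 from \<open>b\<close>.\<close>
  have "nb_walk (case_nat b c) 8"
    using c assms adj_sym unfolding nb_walk_def by (auto split: nat.split)
  from d_nb_walk[OF this] have b7: "d b (c 7) = 8"
    by (simp add: eval_nat_numeral)
  have "adj (c 7) (c 8)"
    using c(3) unfolding nb_walk_def by (auto simp: eval_nat_numeral)
  then have b8: "d b (c 8) = 7"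
    using d_adj[OF bV] b7 d_le_8[OF bV cV] by force
  have L8: "d L (c 8) = 8"
    using d_nb_walk[OF c(3)] c(1) by simp
  obtain g where g: "g 0 = c 8" "g 7 = b" "\<And>i. i \<le> 7 \<Longrightarrow> d b (g i) = 7 - i"
    "\<And>i. i < 7 \<Longrightarrow> adj (g i) (g (Suc i))"
    using ex_geodesic[OF bV cV] b8 by metis
  \<comment> \<open>The vertex \<open>g 6\<close> before \<open>b\<close> is within distance 6 of
    \<open>c 8\<close>, so it is not the opposite vertex \<open>L\<close>, and the closed walk does
    not turn back at \<open>b\<close>.\<close>
  have "d (c 8) (g i) \<le> i" if "i \<le> 7" for i
    using that
  proof (induction i)
    case (Suc i)
    then show ?case
      using d_adj_le[OF cV g(4)[of i]] by auto
  qed (simp add: g)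
  from this[of 6] have g6: "g 6 \<noteq> L"
    using L8 by (auto simp: d_sym)
  have g_ne: "g i \<noteq> g (Suc (Suc i))" if "i \<le> 5" for i
    using g(3)[of i] g(3)[of "Suc (Suc i)"] that by auto
  have g1: "g 1 \<noteq> c 7"
    using g(3)[of 1] b7 by auto
  define h where "h i = (if i \<le> 8 then c i else if i \<le> 15 then g (i - 8) else c (i - 16))" for i
  have "adj (h i) (h (Suc i))" if i: "i < 17" for i
  proof -
    consider "i < 8" | "8 \<le> i" "i < 15" | "i = 15" | "i = 16"
      using i by linarith
    then show ?thesis
    proof cases
      case 1
      then show ?thesis using c(3) by (auto simp: h_def nb_walk_def)
    next
      case 2
      then have "h i = g (i - 8)" "h (Suc i) = g (Suc (i - 8))"
        using g(1) by (auto simp: h_def simp flip: Suc_diff_le)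
      then show ?thesis using g(4)[of "i - 8"] 2 by auto
    next
      case 3
      then show ?thesis using g(2) c(1) assms(2) adj_sym by (auto simp: h_def)
    next
      case 4
      then show ?thesis using c assms by (auto simp: h_def)
    qed
  qed
  moreover have "h i \<noteq> h (Suc (Suc i))" if i: "Suc i < 17" for i
  proof -
    consider "i < 7" | "i = 7" | "8 \<le> i" "i \<le> 13" | "i = 14" | "i = 15"
      using i by linarith
    then show ?thesis
    proof cases
      case 1
      then show ?thesis using c(3) by (auto simp: h_def nb_walk_def)
    next
      case 2
      then show ?thesis using g1 by (auto simp: h_def)
    next
      case 3
      then have "i - 6 = Suc (Suc (i - 8))"
        by linarith
      then have "h i = g (i - 8)" "h (Suc (Suc i)) = g (Suc (Suc (i - 8)))"
        using g(1) 3 by (auto simp: h_def)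
      then show ?thesis using g_ne[of "i - 8"] 3 by auto
    next
      case 4
      then show ?thesis using g6 c(1) by (auto simp: h_def)
    next
      case 5
      then show ?thesis using g(2) c(2) assms by (auto simp: h_def)
    qed
  qed
  ultimately have "nb_walk h 17"
    by (simp add: nb_walk_def)
  moreover have "h 0 = L" "h 1 = a" "h 15 = b" "h 16 = L" "h 17 = a"
    using c g by (simp_all add: h_def)
  ultimately show thesis
    using that by blast
qed

end

section \<open>Weights of an epimorphism\<close>

text \<open>Used with a lower bound from the image, parity from the colours and the upper bound from
  the diameter to pin down distances in the source.\<close>

lemma odd_le_8:
  fixes k :: nat
  assumes "odd k" "k \<le> 8"
  shows "7 \<le> k \<Longrightarrow> k = 7" "5 \<le> k \<Longrightarrow> k = 5 \<or> k = 7"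
  using assms by presburger+

text \<open>\<open>D\<close> gives the number of neighbours upstairs as a function of the image.
  Surjectivity is assumed on vertices only; \<open>lift_adj\<close> derives it for the neighbours of
  each single vertex.\<close>

locale octagon_epi = S: octagon V A colS + T: octagon W B colT
  for V :: "'v set" and A colS and W :: "'w set" and B colT +
  fixes \<phi> :: "'v \<Rightarrow> 'w" and D :: "'w \<Rightarrow> nat"
  assumes finite_V: "finite V"
    and hom: "A x y \<Longrightarrow> B (\<phi> x) (\<phi> y)"
    and surj: "\<phi> ` V = W"
    and col_\<phi>: "x \<in> V \<Longrightarrow> colT (\<phi> x) = colS x"
    and degree: "x \<in> V \<Longrightarrow> card {y. A x y} = D (\<phi> x)"
begin

section \<open>Projection between opposite elements and the weights\<close>

lemma \<phi>_W: "x \<in> V \<Longrightarrow> \<phi> x \<in> W"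
  using surj by blast

lemma finite_W: "finite W"
  using finite_V surj by blast

lemma finite_nbrs [simp]: "finite {y. A x y}" "finite {y. A x y \<and> P y}"
  by (rule finite_subset[OF _ finite_V], use S.adj_V2 in blast)+

lemma finite_nbrs_T [simp]: "finite {y. B x y}"
  by (rule finite_subset[OF _ finite_W], use T.adj_V2 in blast)

lemma hom_walk: "(A ^^ k) u v \<Longrightarrow> (B ^^ k) (\<phi> u) (\<phi> v)"
proof (induction k arbitrary: v)
  case (Suc k)
  then obtain z where "(A ^^ k) u z" "A z v"
    by auto
  then show ?case
    using Suc.IH hom by auto
qed auto

lemma d_hom: "u \<in> V \<Longrightarrow> v \<in> V \<Longrightarrow> T.d (\<phi> u) (\<phi> v) \<le> S.d u v"
  by (meson S.walk_d T.d_le hom_walk)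

lemma even_d_hom: "u \<in> V \<Longrightarrow> v \<in> V \<Longrightarrow> even (T.d (\<phi> u) (\<phi> v)) \<longleftrightarrow> even (S.d u v)"
  using S.d_parity[of u v] T.d_parity[of "\<phi> u" "\<phi> v"] col_\<phi> \<phi>_W by auto

text \<open>Projection: a neighbour \<open>x\<close> of \<open>u\<close> goes to the neighbour of
  the opposite \<open>v\<close> nearest to it. As distances do not grow under \<open>\<phi>\<close>,
  the image of the result is a neighbour of \<open>c 8\<close> at distance 6 from
  \<open>c 1\<close>, and \<open>c 7\<close> is the only one. The projection is injective because
  \<open>u\<close>, at distance 7 from the result, has a unique neighbour at distance 6 from
  it.\<close>

lemma card_nbrs_le_opposite:
  assumes c: "T.nb_walk c 8" and u: "u \<in> V" "\<phi> u = c 0" and v: "v \<in> V" "\<phi> v = c 8"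
  shows "card {x. A u x \<and> \<phi> x = c 1} \<le> card {x. A v x \<and> \<phi> x = c 7}"
proof -
  have "T.d (c 0) (c 8) = 8"
    using T.d_nb_walk[OF c] by simp
  then have uv: "S.d u v = 8"
    using d_hom[of u v] S.d_le_8[of u v] u v by auto
  have "T.nb_walk (\<lambda>i. c (i + 1)) 7" "T.nb_walk (\<lambda>i. c (i + 1)) 6"
    using T.nb_walk_shift[of c 7 1] T.nb_walk_mono[of "\<lambda>i. c (i + 1)" 7 6] c by simp_all
  from this[THEN T.d_nb_walk] have T17: "T.d (c 1) (c 8) = 7" "T.d (c 1) (c 7) = 6"
    by simp_all
  have T1: "c 1 \<in> W" "B (c 8) (c 7)"
    using T.nb_walk_adj[OF c, of 7] T.nb_walk_V[OF c, of 1] by simp_all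
  define f where "f x = (SOME x'. A v x' \<and> S.d x x' = 6)" for x
  have x: "A v (f x) \<and> S.d x (f x) = 6 \<and> S.d u (f x) = 7 \<and> \<phi> (f x) = c 7"
    if "A u x" "\<phi> x = c 1" for x
  proof -
    have xV: "x \<in> V"
      using that S.adj_V2 by blast
    have "S.d v x = 7"
      using S.d_adj[OF v(1) that(1)] uv S.d_le_8[OF v(1) xV] by (auto simp: S.d_sym)
    then have "S.d x v = Suc 6"
      by (simp add: S.d_sym)
    from S.d_pred[OF xV v(1) this] have f: "A v (f x) \<and> S.d x (f x) = 6"
      unfolding f_def by (rule someI_ex)
    then have fV: "f x \<in> V"
      using S.adj_V2 by blast
    have "S.d u (f x) = 7"
      using S.d_adj[OF u(1), of v "f x"] f uv S.d_le_8[OF u(1) fV] by auto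
    moreover have "\<phi> (f x) = c 7"
    proof (rule T.unique_descent[of "c 1" "c 8"])
      have "B (c 8) (\<phi> (f x))"
        using hom[of v "f x"] f v by simp
      moreover have "T.d (c 1) (\<phi> (f x)) \<le> 6"
        using d_hom[OF xV fV] f that by simp
      ultimately show "B (c 8) (\<phi> (f x))" "T.d (c 1) (c 8) = Suc (T.d (c 1) (\<phi> (f x)))"
        using T.d_adj[OF T1(1), of "c 8" "\<phi> (f x)"] T17 by auto
    qed (use T1 T17 in auto)
    ultimately show ?thesis
      using f by simp
  qed
  have "inj_on f {x. A u x \<and> \<phi> x = c 1}"
  proof (rule inj_onI)
    fix x y assume "x \<in> {x. A u x \<and> \<phi> x = c 1}" "y \<in> {x. A u x \<and> \<phi> x = c 1}" "f x = f y"
    then have xy: "A u x" "\<phi> x = c 1" "A u y" "\<phi> y = c 1" "f x = f y"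
      by auto
    show "x = y"
    proof (rule S.unique_descent[of "f x" u])
      show "f x \<in> V" using x[OF xy(1,2)] S.adj_V2 by blast
    qed (use xy x[of x] x[of y] in \<open>simp_all add: S.d_sym\<close>)
  qed
  then show ?thesis
    by (rule card_inj_on_le) (use x in auto)
qed

lemma card_nbrs_opposite:
  assumes "T.nb_walk c 8" "u \<in> V" "\<phi> u = c 0" "v \<in> V" "\<phi> v = c 8"
  shows "card {x. A u x \<and> \<phi> x = c 1} = card {x. A v x \<and> \<phi> x = c 7}"
  using card_nbrs_le_opposite[OF assms] card_nbrs_le_opposite[OF T.nb_walk_rev[OF assms(1)], of v u] assms
  by simp

definition w :: "'w \<Rightarrow> 'w \<Rightarrow> nat" where
  "w x a = card {y. A (SOME u. u \<in> V \<and> \<phi> u = x) y \<and> \<phi> y = a}"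

text \<open>Any two elements over \<open>x\<close> are compared with one and the same element over
  the opposite vertex \<open>c 8\<close>, which removes the dependence on the choice in
  \<open>w\<close>.\<close>

lemma w_eq:
  assumes "u \<in> V" "\<phi> u = x" "B x a"
  shows "card {y. A u y \<and> \<phi> y = a} = w x a"
proof -
  obtain c where c: "c 0 = x" "c 1 = a" "T.nb_walk c 8"
    using T.ex_nb_walk[OF assms(3)] by blast
  have "c 8 \<in> W"
    using T.nb_walk_V[OF c(3)] by simp
  then obtain v where v: "v \<in> V" "\<phi> v = c 8"
    using surj by auto
  define u' where "u' = (SOME u. u \<in> V \<and> \<phi> u = x)"
  have "u' \<in> V \<and> \<phi> u' = x"
    unfolding u'_def by (rule someI[of _ u]) (use assms in auto)
  then show ?thesis
    using card_nbrs_opposite[OF c(3), of u v] card_nbrs_opposite[OF c(3), of u' v] v assms c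
    by (simp add: w_def u'_def)
qed

lemma w_opposite:
  assumes "T.nb_walk c 8"
  shows "w (c 0) (c 1) = w (c 8) (c 7)"
proof -
  have "c 0 \<in> W" "c 8 \<in> W"
    using T.nb_walk_V[OF assms] by simp_all
  then obtain u v where uv: "u \<in> V" "\<phi> u = c 0" "v \<in> V" "\<phi> v = c 8"
    using surj by (metis imageE)
  have "B (c 0) (c 1)" "B (c 8) (c 7)"
    using T.nb_walk_adj[OF assms, of 0] T.nb_walk_adj[OF assms, of 7] by simp_all
  then show ?thesis
    using card_nbrs_opposite[OF assms uv] w_eq[OF uv(1,2)] w_eq[OF uv(3,4)] by simp
qed

text \<open>Surjectivity yields some edge over the given one, but not yet one at \<open>u\<close>.
  An element \<open>v\<close> over the far end of a walk of length 7 through \<open>a\<close> forces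
  it: parity puts \<open>u\<close> at distance 7 from \<open>v\<close>, and the first step from
  \<open>u\<close> towards \<open>v\<close> must lie over the first step of the unique geodesic in
  the image.\<close>

lemma lift_adj:
  assumes "u \<in> V" "B (\<phi> u) a"
  shows "\<exists>y. A u y \<and> \<phi> y = a"
proof -
  obtain c where c: "c 0 = \<phi> u" "c 1 = a" "T.nb_walk c 7"
    using T.ex_nb_walk[OF assms(2)] by blast
  have c7: "c 7 \<in> W"
    using T.nb_walk_V[OF c(3)] by simp
  then obtain v where v: "v \<in> V" "\<phi> v = c 7"
    using surj by auto
  have T7: "T.d (c 7) (\<phi> u) = 7"
    using T.d_nb_walk[OF c(3)] c(1) by (simp add: T.d_sym)
  have "T.nb_walk (\<lambda>i. c (i + 1)) 6"
    using T.nb_walk_shift[of c 6 1] c by simp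
  from T.d_nb_walk[OF this] have T6: "T.d (c 7) a = 6"
    using c(2) by (simp add: T.d_sym)
  have "7 \<le> S.d v u" "odd (S.d v u)" "S.d v u \<le> 8"
    using d_hom[of v u] even_d_hom[of v u] S.d_le_8[of v u] v assms T7 by auto
  then have "S.d v u = Suc 6"
    by (cases "S.d v u = 8") auto
  then obtain z where z: "A u z" "S.d v z = 6"
    using S.d_pred v assms by metis
  have zV: "z \<in> V"
    using z S.adj_V2 by blast
  have "\<phi> z = a"
  proof (rule T.unique_descent[of "c 7" "\<phi> u"])
    show "B (\<phi> u) (\<phi> z)"
      using hom z by blast
    then show "T.d (c 7) (\<phi> u) = Suc (T.d (c 7) (\<phi> z))"
      using T.d_adj[OF c7, of "\<phi> u" "\<phi> z"] d_hom[OF v(1) zV] z v T7 by auto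
  qed (use T7 T6 c7 assms in auto)
  then show ?thesis
    using z by blast
qed

lemma w_pos: 
  assumes "B x a"
  shows "0 < w x a"
proof -
  obtain u where u: "u \<in> V" "\<phi> u = x"
    using surj T.adj_V[OF assms] by auto
  then have "{y. A u y \<and> \<phi> y = a} \<noteq> {}"
    using lift_adj[of u a] assms by auto
  then show ?thesis
    using w_eq[OF u assms] by (metis card_gt_0_iff finite_nbrs(2))
qed

lemma sum_w:
  assumes "x \<in> W"
  shows "(\<Sum>a | B x a. w x a) = D x"
proof -
  obtain u where u: "u \<in> V" "\<phi> u = x"
    using surj assms by auto
  have "D x = card (\<Union>a\<in>{a. B x a}. {y. A u y \<and> \<phi> y = a})"
    unfolding u(2)[symmetric] degree[OF u(1), symmetric]
    by (rule arg_cong[where f = card]) (use hom in auto)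
  also have "\<dots> = (\<Sum>a | B x a. card {y. A u y \<and> \<phi> y = a})"
    by (rule card_UN_disjoint) auto
  also have "\<dots> = (\<Sum>a | B x a. w x a)"
    by (rule sum.cong) (use w_eq u in auto)
  finally show ?thesis
    by simp
qed

section \<open>Distribution of a fibre over the distances from a base element\<close>

definition cnt :: "'v \<Rightarrow> nat \<Rightarrow> 'w \<Rightarrow> nat" where
  "cnt u k z = card {v \<in> V. \<phi> v = z \<and> S.d u v = k}"

text \<open>The bound on \<open>j\<close> keeps distance \<open>j + 2\<close> below 8, where exactly
  one neighbour is closer to \<open>u\<close>. For \<open>j = 0\<close> the vertex is
  \<open>u\<close> itself, and all its neighbours are farther away.\<close>

lemma card_nbrs_at_distance:
  assumes u: "u \<in> V" and v: "v \<in> V" and j: "j \<le> 5"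
  shows "card {y. A v y \<and> S.d u y = Suc j} =
    (if S.d u v = Suc (Suc j) then 1 else 0) +
    (if S.d u v = j then (if j = 0 then D (\<phi> v) else D (\<phi> v) - 1) else 0)"
proof -
  consider "S.d u v = Suc (Suc j)" | "S.d u v = 0" "j = 0" | "S.d u v = j" "j \<noteq> 0"
    | "S.d u v \<noteq> Suc (Suc j)" "S.d u v \<noteq> j"
    by auto
  then show ?thesis
  proof cases
    case 1
    then obtain a where a: "A v a" "S.d u a = Suc j"
      using S.d_pred[OF u v] by metis
    have "{y. A v y \<and> S.d u y = Suc j} = {a}"
      using S.unique_pred[OF u, of v] 1 a j by auto
    then show ?thesis using 1 by simp
  next
    case 2
    then have "{y. A v y \<and> S.d u y = Suc j} = {y. A v y}"
      using S.d_adj[OF u, of v] by auto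
    then show ?thesis using 2 degree[OF v] by simp
  next
    case 3
    then obtain a where a: "A v a" "S.d u a = j - 1"
      using S.d_pred[OF u v, of "j - 1"] by auto
    have "S.d u y = Suc j \<longleftrightarrow> y \<noteq> a" if "A v y" for y
    proof
      assume "y \<noteq> a"
      then have "S.d u v \<noteq> Suc (S.d u y)"
        using S.unique_descent[OF u that a(1)] 3 a(2) j by auto
      then show "S.d u y = Suc j"
        using S.d_adj[OF u that] 3 by simp
    qed (use a 3 in auto)
    then have "{y. A v y \<and> S.d u y = Suc j} = {y. A v y} - {a}"
      by auto
    then show ?thesis using 3 degree[OF v] a by simp
  next
    case 4
    then have "{y. A v y \<and> S.d u y = Suc j} = {}"
      using S.d_adj[OF u, of v] by fastforce
    then show ?thesis using 4 by (simp only: card.empty) simp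
  qed
qed

text \<open>Double counting of the edges between the fibre of \<open>z\<close> and the sphere of
  radius \<open>j + 1\<close> around \<open>u\<close>. On the sphere, an element over
  \<open>y\<close> has \<open>w y z\<close> of them; in the fibre, an element at distance
  \<open>j + 2\<close> has one, and an element at distance \<open>j\<close> has all its edges but
  the one leading back to \<open>u\<close>.\<close>

lemma cnt_rec:
  assumes u: "u \<in> V" and z: "z \<in> W" and j: "j \<le> 5"
  shows "(\<Sum>y | B z y. w y z * cnt u (Suc j) y) =
    cnt u (Suc (Suc j)) z + (if j = 0 then D z else D z - 1) * cnt u j z"
proof -
  define Fz where "Fz = {v \<in> V. \<phi> v = z}"
  define Lk where "Lk = {v \<in> V. S.d u v = Suc j}"
  have fin: "finite Fz" "finite Lk"
    using finite_V by (auto simp: Fz_def Lk_def)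
  have swap: "(\<Sum>v\<in>Fz. card {y \<in> Lk. A v y}) = (\<Sum>y\<in>Lk. card {v \<in> Fz. A v y})"
    by (rule sum_multicount_gen) (use fin in auto)
  have left: "(\<Sum>v\<in>Fz. card {y \<in> Lk. A v y}) =
    cnt u (Suc (Suc j)) z + (if j = 0 then D z else D z - 1) * cnt u j z"
  proof -
    have "{y \<in> Lk. A v y} = {y. A v y \<and> S.d u y = Suc j}" for v
      using S.adj_V2 by (auto simp: Lk_def)
    then have "(\<Sum>v\<in>Fz. card {y \<in> Lk. A v y}) =
      (\<Sum>v\<in>Fz. (if S.d u v = Suc (Suc j) then 1 else 0) +
        (if S.d u v = j then (if j = 0 then D z else D z - 1) else 0))"
      by (intro sum.cong refl) (use card_nbrs_at_distance[OF u _ j] in \<open>auto simp: Fz_def\<close>)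
    also have "\<dots> = cnt u (Suc (Suc j)) z + (if j = 0 then D z else D z - 1) * cnt u j z"
      using fin by (simp add: sum.distrib sum.If_cases cnt_def Fz_def Int_def conj_assoc mult.commute)
    finally show ?thesis .
  qed
  have right: "(\<Sum>y\<in>Lk. card {v \<in> Fz. A v y}) = (\<Sum>y | B z y. w y z * cnt u (Suc j) y)"
  proof -
    have "card {v \<in> Fz. A v y} = (if B z (\<phi> y) then w (\<phi> y) z else 0)" if "y \<in> Lk" for y
    proof -
      have y: "y \<in> V"
        using that by (simp add: Lk_def)
      have "{v \<in> Fz. A v y} = {v. A y v \<and> \<phi> v = z}"
        using S.adj_sym S.adj_V by (auto simp: Fz_def)
      moreover have "{v. A y v \<and> \<phi> v = z} = {}" if "\<not> B z (\<phi> y)"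
        using that hom T.adj_sym by blast
      ultimately show ?thesis
        using w_eq[OF y refl, of z] T.adj_sym by auto
    qed
    then have "(\<Sum>y\<in>Lk. card {v \<in> Fz. A v y}) = (\<Sum>y\<in>Lk. if B z (\<phi> y) then w (\<phi> y) z else 0)"
      by simp
    also have "\<dots> = (\<Sum>a\<in>W. \<Sum>y | y \<in> Lk \<and> \<phi> y = a. if B z (\<phi> y) then w (\<phi> y) z else 0)"
      by (rule sum.group[symmetric]) (use fin finite_W \<phi>_W in \<open>auto simp: Lk_def\<close>)
    also have "\<dots> = (\<Sum>a\<in>W. if B z a then w a z * cnt u (Suc j) a else 0)"
    proof (rule sum.cong[OF refl])
      fix a
      define Y where "Y = {y. y \<in> Lk \<and> \<phi> y = a}"
      have "card Y = cnt u (Suc j) a"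
        unfolding cnt_def Lk_def Y_def by (rule arg_cong[where f = card]) auto
      moreover have "(\<Sum>y\<in>Y. if B z (\<phi> y) then w (\<phi> y) z else 0) = (\<Sum>y\<in>Y. if B z a then w a z else 0)"
        by (rule sum.cong) (auto simp: Y_def)
      ultimately show "(\<Sum>y | y \<in> Lk \<and> \<phi> y = a. if B z (\<phi> y) then w (\<phi> y) z else 0) =
          (if B z a then w a z * cnt u (Suc j) a else 0)"
        unfolding Y_def[symmetric] by simp
    qed
    also have "\<dots> = (\<Sum>y | B z y. w y z * cnt u (Suc j) y)"
    proof -
      have "{a \<in> W. B z a} = {a. B z a}"
        using T.adj_V2 by auto
      then show ?thesis
        using sum.inter_filter[OF finite_W, of "\<lambda>a. w a z * cnt u (Suc j) a" "B z"] by simp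
    qed
    finally show ?thesis .
  qed
  show ?thesis
    by (rule trans[OF trans[OF right[symmetric] swap[symmetric]] left])
qed

lemma cnt_eq_0: "u \<in> V \<Longrightarrow> k < T.d (\<phi> u) y \<Longrightarrow> cnt u k y = 0"
  unfolding cnt_def using d_hom[of u] finite_V by (force simp: card_eq_0_iff)

lemma cnt_0: "u \<in> V \<Longrightarrow> cnt u 0 (\<phi> u) = 1"
proof -
  assume u: "u \<in> V"
  then have "{v \<in> V. \<phi> v = \<phi> u \<and> S.d u v = 0} = {u}"
    using S.d_eq_0_iff by auto
  then show ?thesis
    by (simp add: cnt_def)
qed

text \<open>In the recursion only \<open>y'\<close> contributes: the other neighbours of
  \<open>y\<close> are at distance \<open>k + 2\<close> from \<open>\<phi> u\<close>, so none of
  their lifts is at distance \<open>k\<close> from \<open>u\<close>.\<close>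

lemma cnt_step:
  assumes u: "u \<in> V" and y: "T.d (\<phi> u) y = Suc k" "k \<le> 6" and y': "B y y'" "T.d (\<phi> u) y' = k"
  shows "cnt u (Suc k) y = w y' y * cnt u k y'"
proof (cases k)
  case 0
  then have "y' = \<phi> u"
    using y'(2) T.d_eq_0_iff \<phi>_W[OF u] T.adj_V2[OF y'(1)] by metis
  have "{v \<in> V. \<phi> v = y \<and> S.d u v = 1} = {v. A u v \<and> \<phi> v = y}"
  proof -
    have "A u v" if "S.d u v = 1" "v \<in> V" for v
      using S.walk_d[OF u that(2)] that by (simp add: eq_OO)
    then show ?thesis
      using S.adj_V2 S.d_adj_1 by auto
  qed
  then have "cnt u (Suc 0) y = w (\<phi> u) y"
    using w_eq[OF u refl, of y] y'(1) \<open>y' = \<phi> u\<close> T.adj_sym by (simp add: cnt_def)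
  then show ?thesis
    using 0 \<open>y' = \<phi> u\<close> cnt_0[OF u] by simp
next
  case (Suc j)
  have "(\<Sum>z | B y z. w z y * cnt u (Suc j) z) = (\<Sum>z\<in>{y'}. w z y * cnt u (Suc j) z)"
  proof (rule sum.mono_neutral_right)
    show "\<forall>z\<in>{z. B y z} - {y'}. w z y * cnt u (Suc j) z = 0"
    proof
      fix z assume z: "z \<in> {z. B y z} - {y'}"
      then have "T.d (\<phi> u) z \<noteq> k"
        using T.unique_descent[OF \<phi>_W[OF u], of y z y'] y y' by auto
      then have "T.d (\<phi> u) z = Suc (Suc k)"
        using T.d_adj[OF \<phi>_W[OF u], of y z] z y by auto
      then show "w z y * cnt u (Suc j) z = 0"
        using cnt_eq_0[OF u] Suc by simp
    qed
  qed (use y' in auto)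
  moreover have "cnt u j y = 0"
    using cnt_eq_0[OF u] y Suc by simp
  ultimately show ?thesis
    using cnt_rec[OF u T.adj_V[OF y'(1)], of j] y Suc by simp
qed

lemma d_nb_walk_T: "T.nb_walk c n \<Longrightarrow> n \<le> 8 \<Longrightarrow> k \<le> n \<Longrightarrow> T.d (c 0) (c k) = k"
  using T.d_nb_walk T.nb_walk_mono by (meson le_trans)

lemma cnt_nb_walk_Suc:
  assumes "u \<in> V" "\<phi> u = c 0" "T.nb_walk c (Suc n)" "n \<le> 6"
  shows "cnt u (Suc n) (c (Suc n)) = w (c n) (c (Suc n)) * cnt u n (c n)"
proof (rule cnt_step)
  show "B (c (Suc n)) (c n)"
    by (rule T.adj_sym) (use assms(3) in \<open>simp add: T.nb_walk_def\<close>)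
qed (use assms d_nb_walk_T[of c "Suc n"] in auto)

lemma cnt_nb_walk:
  assumes "u \<in> V" "\<phi> u = c 0" "T.nb_walk c n" "n \<le> 7"
  shows "cnt u n (c n) = (\<Prod>j<n. w (c j) (c (Suc j)))"
  using assms
proof (induction n)
  case 0
  then show ?case using cnt_0[of u] by simp
next
  case (Suc n)
  then show ?case
    using cnt_nb_walk_Suc[of u c n] T.nb_walk_mono[of c "Suc n" n] by simp
qed

text \<open>The number of walks of length 2 from a given element over \<open>x\<close>, through the
  fibre of \<open>y\<close>, back into the fibre of \<open>x\<close>.\<close>

definition e :: "'w \<Rightarrow> 'w \<Rightarrow> int" where
  "e x y = int (w x y) * int (w y x)"

text \<open>Of all walks of length 2 from an element back into its fibre, \<open>D y\<close> return
  to the element itself; so \<open>\<sigma> y\<close> is the number of elements of the fibre at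
  distance 2 from it.\<close>

definition \<sigma> :: "'w \<Rightarrow> int" where
  "\<sigma> y = (\<Sum>z | B y z. e y z) - int (D y)"

text \<open>Elements at distance \<open>n + 2\<close> over \<open>c n\<close> are reached by lifts
  of the walk with one detour, and \<open>\<sigma> (c j)\<close> counts detours at
  \<open>c j\<close>. Going to and fro along an edge of the walk is seen from both ends: if the edge
  has weights a and b in its two directions, the ends contribute a(b - 1) + b(a - 1), whereas the
  absence of backtracking leaves (a - 1)(b - 1). The difference ab - 1 is the subtracted
  term.\<close>

lemma cnt_nb_walk_plus_2:
  assumes "u \<in> V" "\<phi> u = c 0" "T.nb_walk c n" "n \<le> 5"
  shows "int (cnt u (n + 2) (c n)) =
    int (cnt u n (c n)) * ((\<Sum>j\<le>n. \<sigma> (c j)) - (\<Sum>j<n. e (c j) (c (Suc j)) - 1))"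
  using assms
proof (induction n)
  case 0
  have "cnt u (Suc 0) y = w (\<phi> u) y" if "B (\<phi> u) y" for y
    using cnt_step[OF \<open>u \<in> V\<close>, of y 0 "\<phi> u"] T.d_adj_1[OF that] T.adj_sym[OF that] cnt_0[OF \<open>u \<in> V\<close>]
    by simp
  then have "(\<Sum>y | B (\<phi> u) y. w (\<phi> u) y * w y (\<phi> u)) =
      (\<Sum>y | B (\<phi> u) y. w y (\<phi> u) * cnt u (Suc 0) y)"
    by (intro sum.cong) auto
  then have "(\<Sum>y | B (\<phi> u) y. w (\<phi> u) y * w y (\<phi> u)) = cnt u 2 (\<phi> u) + D (\<phi> u)"
    using cnt_rec[OF \<open>u \<in> V\<close> \<phi>_W[OF \<open>u \<in> V\<close>], of 0] cnt_0[OF \<open>u \<in> V\<close>]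
    by (simp add: numeral_2_eq_2)
  from this[THEN arg_cong[where f = int]]
  have "(\<Sum>y | B (\<phi> u) y. e (\<phi> u) y) = int (cnt u 2 (\<phi> u)) + int (D (\<phi> u))"
    by (simp add: e_def)
  then show ?case
    using 0 cnt_0[OF \<open>u \<in> V\<close>] by (simp add: \<sigma>_def numeral_2_eq_2)
next
  case (Suc n)
  let ?x = "c n" and ?y = "c (Suc n)"
  define a where "a = int (cnt u n ?x)"
  define R where "R = (\<Sum>j\<le>n. \<sigma> (c j)) - (\<Sum>j<n. e (c j) (c (Suc j)) - 1)"
  note u = \<open>u \<in> V\<close>
  have IH: "int (cnt u (n + 2) ?x) = a * R"
    using Suc T.nb_walk_mono[of c "Suc n" n] by (simp add: a_def R_def)
  have yx: "B ?y ?x"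
    by (rule T.adj_sym) (use Suc.prems in \<open>simp add: T.nb_walk_def\<close>)
  have yW: "?y \<in> W"
    using yx T.adj_V by blast
  have dx: "T.d (\<phi> u) ?x = n" and dy: "T.d (\<phi> u) ?y = Suc n"
    using Suc.prems d_nb_walk_T[of c "Suc n"] by auto
  have y: "int (cnt u (Suc n) ?y) = int (w ?x ?y) * a"
    using cnt_nb_walk_Suc[of u c n] Suc.prems by (simp add: a_def)
  \<comment> \<open>A neighbour \<open>z\<close> of \<open>?y\<close> other than \<open>?x\<close>
    is farther from \<open>\<phi> u\<close>, so its count is one \<open>cnt_step\<close> beyond that
    of \<open>?y\<close>, and the weights of the edge in both directions combine to
    \<open>e\<close>.\<close>
  have z: "int (w z ?y * cnt u (Suc (Suc n)) z) = e ?y z * int (cnt u (Suc n) ?y)"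
    if "B ?y z" "z \<noteq> ?x" for z
  proof -
    have "T.d (\<phi> u) z \<noteq> n"
      using T.unique_descent[OF \<phi>_W[OF u], of ?y z ?x] dx dy that yx Suc.prems by auto
    then have "T.d (\<phi> u) z = Suc (Suc n)"
      using T.d_adj[OF \<phi>_W[OF u], of ?y z] that dy by auto
    then show ?thesis
      using cnt_step[OF u, of z "Suc n" ?y] Suc.prems T.adj_sym[OF that(1)] dy by (simp add: e_def)
  qed
  have split: "(\<Sum>z | B ?y z. f z) = f ?x + (\<Sum>z\<in>{z. B ?y z} - {?x}. f z)" for f :: "'w \<Rightarrow> int"
    using yx by (subst sum.remove[of _ ?x]) auto
  have D: "1 \<le> D ?y"
    using sum_w[OF yW] w_pos[OF yx] yx member_le_sum[of ?x "{z. B ?y z}" "w ?y"] by force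
  have "int (\<Sum>z | B ?y z. w z ?y * cnt u (Suc (Suc n)) z) =
      int (cnt u (Suc n + 2) ?y) + int (D ?y - 1) * int (cnt u (Suc n) ?y)"
    using cnt_rec[OF u yW, of "Suc n"] Suc.prems by simp
  also have "int (\<Sum>z | B ?y z. w z ?y * cnt u (Suc (Suc n)) z) =
      int (w ?x ?y * cnt u (Suc (Suc n)) ?x) +
      (\<Sum>z\<in>{z. B ?y z} - {?x}. e ?y z * int (cnt u (Suc n) ?y))"
    unfolding of_nat_sum split by (intro arg_cong2[where f = "(+)"] refl sum.cong z) auto
  also have "(\<Sum>z\<in>{z. B ?y z} - {?x}. e ?y z * int (cnt u (Suc n) ?y)) =
      (\<sigma> ?y + int (D ?y) - e ?y ?x) * int (cnt u (Suc n) ?y)"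
    using split[of "e ?y"] by (simp add: \<sigma>_def sum_distrib_right)
  finally have "int (cnt u (Suc n + 2) ?y) =
      int (w ?x ?y) * (a * R) + (\<sigma> ?y + 1 - e ?y ?x) * int (cnt u (Suc n) ?y)"
    using IH D by (simp add: algebra_simps of_nat_diff)
  also have "e ?y ?x = e ?x ?y"
    by (simp add: e_def)
  finally show ?case
    unfolding y by (simp add: R_def algebra_simps)
qed

text \<open>The fibre of \<open>c 7\<close> is counted from an element over \<open>c 0\<close>,
  which gives a product of seven weights, and from an element over \<open>c 2\<close>. The last five
  weights occur in both counts and are positive, so they cancel; the summand 1 stems from the part
  at distance 5.\<close>

lemma nb_walk_7_identity:
  assumes c: "T.nb_walk c 7"
  shows "int (w (c 0) (c 1)) * int (w (c 1) (c 2)) =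
    1 + (\<Sum>j\<le>5. \<sigma> (c (j + 2))) - (\<Sum>j<5. e (c (j + 2)) (c (j + 3)) - 1)"
proof -
  have W: "c 0 \<in> W" "c 2 \<in> W"
    using T.nb_walk_V[OF c] by simp_all
  obtain u where u: "u \<in> V" "\<phi> u = c 0"
    using W surj by (metis imageE)
  obtain u' where u': "u' \<in> V" "\<phi> u' = c 2"
    using W surj by (metis imageE)
  define b where "b i = c (i + 2)" for i
  have b: "T.nb_walk b 5" "\<phi> u' = b 0"
    using T.nb_walk_shift[of c 5 2] c u' by (simp_all add: b_def[abs_def] numeral_2_eq_2)
  let ?F = "{v \<in> V. \<phi> v = c 7}"
  have d7: "T.d (c 0) (c 7) = 7" and d5: "T.d (c 2) (c 7) = 5"
    using T.d_nb_walk[OF c] T.d_nb_walk[OF b(1)] by (simp_all add: b_def numeral_2_eq_2)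
  have "S.d u v = 7" if "v \<in> ?F" for v
  proof -
    have "odd (S.d u v)" "S.d u v \<le> 8" "7 \<le> S.d u v"
      using d_hom[of u v] S.d_le_8[of u v] even_d_hom[of u v] u that d7 by auto
    then show ?thesis by (rule odd_le_8(1))
  qed
  then have "?F = {v \<in> V. \<phi> v = c 7 \<and> S.d u v = 7}"
    by auto
  then have F7: "card ?F = cnt u 7 (c 7)"
    by (simp add: cnt_def)
  have "S.d u' v = 5 \<or> S.d u' v = 7" if "v \<in> ?F" for v
  proof -
    have "odd (S.d u' v)" "S.d u' v \<le> 8" "5 \<le> S.d u' v"
      using d_hom[of u' v] S.d_le_8[of u' v] even_d_hom[of u' v] u' that d5 by auto
    then show ?thesis by (rule odd_le_8(2))
  qed
  then have "?F = {v \<in> V. \<phi> v = c 7 \<and> S.d u' v = 5} \<union> {v \<in> V. \<phi> v = c 7 \<and> S.d u' v = 7}"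
    by auto
  then have "card ?F = cnt u' 5 (c 7) + cnt u' 7 (c 7)"
    unfolding cnt_def using finite_V by (subst card_Un_disjoint[symmetric]) auto
  with F7 have eq: "int (cnt u 7 (c 7)) = int (cnt u' 5 (b 5)) + int (cnt u' (5 + 2) (b 5))"
    by (simp add: b_def)
  have P: "cnt u' 5 (b 5) = (\<Prod>j<5. w (b j) (b (Suc j)))"
    using cnt_nb_walk[OF u'(1) b(2,1)] by simp
  have "cnt u 7 (c 7) = (\<Prod>j<7. w (c j) (c (Suc j)))"
    using cnt_nb_walk[OF u c] by simp
  also have "\<dots> = w (c 0) (c 1) * w (c 1) (c 2) * cnt u' 5 (b 5)"
    unfolding P by (simp add: b_def eval_nat_numeral lessThan_Suc mult.commute mult.left_commute)
  finally have "int (w (c 0) (c 1)) * int (w (c 1) (c 2)) * int (cnt u' 5 (b 5)) =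
      int (cnt u' 5 (b 5)) * (1 + ((\<Sum>j\<le>5. \<sigma> (b j)) - (\<Sum>j<5. e (b j) (b (Suc j)) - 1)))"
    using eq cnt_nb_walk_plus_2[OF u'(1) b(2,1)] by (simp add: algebra_simps)
  moreover have "cnt u' 5 (b 5) \<noteq> 0"
    unfolding P using b(1) w_pos by (auto simp: T.nb_walk_def)
  ultimately show ?thesis
    by (simp add: b_def eval_nat_numeral)
qed

text \<open>Source of the singleton fibre: seven weights equal to 1 along a walk leave one element
  over its end.\<close>

lemma card_fibre_nb_walk_7:
  assumes "T.nb_walk c 7"
  shows "card {v \<in> V. \<phi> v = c 7} = (\<Prod>j<7. w (c j) (c (Suc j)))"
proof -
  obtain u where u: "u \<in> V" "\<phi> u = c 0"
    using T.nb_walk_V[OF assms, of 0] surj by (metis imageE zero_le zero_less_numeral)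
  have "S.d u v = 7" if "v \<in> V" "\<phi> v = c 7" for v
  proof -
    have "odd (S.d u v)" "S.d u v \<le> 8" "7 \<le> S.d u v"
      using d_hom[of u v] S.d_le_8[of u v] even_d_hom[of u v] u that T.d_nb_walk[OF assms] by auto
    then show ?thesis by (rule odd_le_8(1))
  qed
  then have "{v \<in> V. \<phi> v = c 7} = {v \<in> V. \<phi> v = c 7 \<and> S.d u v = 7}"
    by auto
  then show ?thesis
    using cnt_nb_walk[OF u assms] by (simp add: cnt_def)
qed

end

section \<open>Consequences of the weight identity\<close>

text \<open>In the application \<open>p i\<close> and \<open>p (i + 8)\<close> are the two weights
  at the vertex \<open>c i\<close> of a 16-cycle, \<open>N i\<close> is the number of neighbours of
  an element over it, and \<open>p (i + j + 9)\<close> is the weight from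
  \<open>c (i + j + 1)\<close> back to \<open>c (i + j)\<close>.\<close>

lemma antiperiodic_weights:
  fixes p N :: "nat \<Rightarrow> int"
  assumes per: "\<And>i. p (i + 16) = p i"
    and sum: "\<And>i. p i + p (i + 8) = N i"
    and pos: "\<And>i. 1 \<le> p i"
    and N2: "\<And>i. N (i + 2) = N i"
    and N3: "\<And>i. 3 \<le> N i"
    and id: "\<And>i. p i * p (i + 1) =
      6 - 3 * (N i + N (i + 1)) + (\<Sum>j\<in>{1..7}. p (i + j) * p (i + j + 9))"
  shows "\<exists>i. \<forall>j\<in>{1..7}. p (i + j) = 1"
proof -
  \<comment> \<open>\<open>p i\<close> and \<open>p (i + 8)\<close> are at least 1 and add up to
    \<open>N i\<close>, so \<open>p i - 1\<close> ranges from 0 to \<open>N i - 2\<close>.\<close>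
  define \<alpha> where "\<alpha> i = real_of_int (p i - 1) / real_of_int (N i - 2)" for i
  \<comment> \<open>The probability that two independent bits with expectations \<open>a\<close> and
    \<open>b\<close> differ.\<close>
  define C :: "real \<Rightarrow> real \<Rightarrow> real" where "C a b = a * (1 - b) + (1 - a) * b" for a b
  have N8: "N (i + 8) = N i" for i
    using N2[of i] N2[of "i + 2"] N2[of "i + 4"] N2[of "i + 6"]
    unfolding add.assoc by simp
  have M: "0 < real_of_int (N i - 2)" for i
    using N3[of i] by simp
  have \<alpha>8: "\<alpha> (i + 8) = 1 - \<alpha> i" for i
    using sum[of i] M[of i] N8[of i] by (simp add: \<alpha>_def field_simps)
  have \<alpha>0: "0 \<le> \<alpha> i" for i
    unfolding \<alpha>_def using pos[of i] M[of i] by (intro divide_nonneg_pos) auto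
  have \<alpha>1: "\<alpha> i \<le> 1" for i
    using \<alpha>0[of "i + 8"] \<alpha>8[of i] by simp
  have p_eq_1: "p i = 1" if "\<alpha> i = 0" for i
    using that M[of i] by (simp add: \<alpha>_def)
  \<comment> \<open>This is \<open>id\<close> after normalisation. The common denominator
    \<open>?M\<close> is the same for all pairs of consecutive indices because \<open>N\<close> has
    period 2.\<close>
  have sum_C: "(\<Sum>m<8. C (\<alpha> (i + m)) (\<alpha> (i + m + 1))) = 1" for i
  proof -
    let ?M = "real_of_int ((N i - 2) * (N (i + 1) - 2))"
    define E where "E k = (p (i + k) - 1) * (p (i + k + 9) - 1) + (p (i + k + 8) - 1) * (p (i + k + 1) - 1)" for k
    have C: "C (\<alpha> k) (\<alpha> (k + 1)) * real_of_int ((N k - 2) * (N (k + 1) - 2)) =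
        real_of_int ((p k - 1) * (p (k + 9) - 1) + (p (k + 8) - 1) * (p (k + 1) - 1))" for k
    proof -
      have "C (\<alpha> k) (\<alpha> (k + 1)) = \<alpha> k * \<alpha> (k + 9) + \<alpha> (k + 8) * \<alpha> (k + 1)"
        using \<alpha>8[of k] \<alpha>8[of "k + 1"] unfolding add.assoc by (simp add: C_def)
      moreover have \<alpha>M: "real_of_int (p j - 1) = \<alpha> j * real_of_int (N j - 2)" for j
        using M[of j] by (simp add: \<alpha>_def)
      moreover have "N (k + 8) = N k" "N (k + 9) = N (k + 1)"
        using N8[of k] N8[of "k + 1"] unfolding add.assoc by simp_all
      ultimately show ?thesis
        unfolding of_int_add of_int_mult \<alpha>M by (simp only:) (simp only: algebra_simps)
    qed
    have "(N (i + m) - 2) * (N (i + m + 1) - 2) = (N i - 2) * (N (i + 1) - 2)" for m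
    proof (induction m)
      case (Suc m)
      then show ?case using N2[of "i + m"] by (simp add: mult.commute)
    qed simp
    then have "(\<Sum>m<8. C (\<alpha> (i + m)) (\<alpha> (i + m + 1))) * ?M = real_of_int (\<Sum>m<8. E m)"
      unfolding sum_distrib_right of_int_sum by (intro sum.cong refl) (metis C E_def)
    also have "(\<Sum>m<8. E m) = (N i - 2) * (N (i + 1) - 2)"
    proof -
      have per': "p (i + 16) = p i" "p (i + 17) = p (i + 1)" "p (i + 18) = p (i + 2)"
        "p (i + 19) = p (i + 3)" "p (i + 20) = p (i + 4)" "p (i + 21) = p (i + 5)"
        "p (i + 22) = p (i + 6)" "p (i + 23) = p (i + 7)" "p (i + 24) = p (i + 8)"
        using per[of i] per[of "i + 1"] per[of "i + 2"] per[of "i + 3"] per[of "i + 4"]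
          per[of "i + 5"] per[of "i + 6"] per[of "i + 7"] per[of "i + 8"]
        unfolding add.assoc by simp_all
      have N': "N (i + 8) = N i" "N (i + 9) = N (i + 1)"
        "N (i + 2) = N i" "N (i + 4) = N i" "N (i + 6) = N i"
        "N (i + 3) = N (i + 1)" "N (i + 5) = N (i + 1)" "N (i + 7) = N (i + 1)"
        using N8[of i] N8[of "i + 1"] N2[of i] N2[of "i + 1"] N2[of "i + 2"] N2[of "i + 3"]
          N2[of "i + 4"] N2[of "i + 5"]
        unfolding add.assoc by (simp_all add: eval_nat_numeral)
      have q: "p (i + 8) = N i - p i" "p (i + 9) = N (i + 1) - p (i + 1)"
        "p (i + 10) = N i - p (i + 2)" "p (i + 11) = N (i + 1) - p (i + 3)"
        "p (i + 12) = N i - p (i + 4)" "p (i + 13) = N (i + 1) - p (i + 5)"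
        "p (i + 14) = N i - p (i + 6)" "p (i + 15) = N (i + 1) - p (i + 7)"
        using sum[of i] sum[of "i + 1"] sum[of "i + 2"] sum[of "i + 3"] sum[of "i + 4"]
          sum[of "i + 5"] sum[of "i + 6"] sum[of "i + 7"] N'
        unfolding add.assoc by simp_all
      have one_to_7: "{1..7::nat} = {1, 2, 3, 4, 5, 6, 7}"
        by auto
      have "(\<Sum>m<8. E m) = E 0 + E 1 + E 2 + E 3 + E 4 + E 5 + E 6 + E 7"
        by (simp add: eval_nat_numeral)
      then show ?thesis
        using id[of i] unfolding E_def one_to_7 add.assoc
        by (simp add: per' q) (simp add: algebra_simps)
    qed
    finally show ?thesis
      using M[of i] M[of "i + 1"] by simp
  qed
  \<comment> \<open>If two bits differ, any third bit differs from one of them.\<close>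
  have triangle: "C a c \<le> C a b + C b c" if "0 \<le> a" "a \<le> 1" "0 \<le> b" "b \<le> 1" "0 \<le> c" "c \<le> 1" for a b c
  proof -
    have "0 \<le> a * c * (1 - b)" "0 \<le> (1 - a) * (1 - c) * b"
      using that by (intro mult_nonneg_nonneg; simp)+
    then show ?thesis
      by (simp add: C_def algebra_simps)
  qed
  have path: "C (\<alpha> i) (\<alpha> (i + Suc n)) \<le> (\<Sum>m<Suc n. C (\<alpha> (i + m)) (\<alpha> (i + m + 1)))" for i n
  proof (induction n)
    case (Suc n)
    have "C (\<alpha> i) (\<alpha> (i + Suc (Suc n))) \<le>
        C (\<alpha> i) (\<alpha> (i + Suc n)) + C (\<alpha> (i + Suc n)) (\<alpha> (i + Suc (Suc n)))"
      by (rule triangle) (rule \<alpha>0 \<alpha>1)+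
    then show ?case
      using Suc by simp
  qed simp
  have path': "C (\<alpha> i) (\<alpha> j) \<le> (\<Sum>m\<in>{i..<j}. C (\<alpha> m) (\<alpha> (m + 1)))" if "i < j" for i j
  proof -
    have "(\<Sum>m\<in>{i..<j}. C (\<alpha> m) (\<alpha> (m + 1))) = (\<Sum>m<j - i. C (\<alpha> (i + m)) (\<alpha> (i + m + 1)))"
      by (rule sum.reindex_bij_witness[of _ "\<lambda>m. i + m" "\<lambda>m. m - i"]) auto
    then show ?thesis
      using path[of i "j - i - 1"] that by (simp add: Suc_diff_Suc)
  qed
  \<comment> \<open>The bits at \<open>i\<close>, \<open>j\<close>, \<open>k\<close> followed by the
    complement of the first change once or three times, and on average at most once. So three
    changes have probability 0; the two products are the probabilities of the two patterns that have
    them.\<close>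
  have zero: "\<alpha> i * \<alpha> k * (1 - \<alpha> j) = 0 \<and> (1 - \<alpha> i) * (1 - \<alpha> k) * \<alpha> j = 0"
    if "i < j" "j < k" "k < i + 8" for i j k
  proof -
    let ?S = "\<lambda>i j. \<Sum>m\<in>{i..<j}. C (\<alpha> m) (\<alpha> (m + 1))"
    have "?S i (i + 8) = (\<Sum>m<8. C (\<alpha> (i + m)) (\<alpha> (i + m + 1)))"
      by (rule sum.reindex_bij_witness[of _ "\<lambda>m. i + m" "\<lambda>m. m - i"]) auto
    moreover have "?S i (i + 8) = ?S i j + ?S j k + ?S k (i + 8)"
      using that by (simp add: sum.atLeastLessThan_concat)
    ultimately have "C (\<alpha> i) (\<alpha> j) + C (\<alpha> j) (\<alpha> k) + C (\<alpha> k) (1 - \<alpha> i) \<le> 1"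
      using sum_C[of i] path'[OF that(1)] path'[OF that(2)] path'[OF that(3)] \<alpha>8[of i] by simp
    then have "\<alpha> i * \<alpha> k * (1 - \<alpha> j) + (1 - \<alpha> i) * (1 - \<alpha> k) * \<alpha> j \<le> 0"
      by (simp add: C_def algebra_simps)
    moreover have "0 \<le> \<alpha> i * \<alpha> k * (1 - \<alpha> j)" "0 \<le> (1 - \<alpha> i) * (1 - \<alpha> k) * \<alpha> j"
      using \<alpha>0 \<alpha>1 by (intro mult_nonneg_nonneg; simp)+
    ultimately show ?thesis
      by linarith
  qed
  \<comment> \<open>Otherwise a positive value makes all later values 1, although values at distance
    8 add up to 1.\<close>
  have "\<exists>m. 0 < \<alpha> m \<and> \<alpha> (m + 1) < 1"
  proof (rule ccontr)
    assume "\<nexists>m. 0 < \<alpha> m \<and> \<alpha> (m + 1) < 1"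
    then have step: "\<alpha> (Suc m) = 1" if "0 < \<alpha> m" for m
      using that \<alpha>1[of "Suc m"] by force
    obtain m where m: "0 < \<alpha> m"
      using \<alpha>8[of 0] \<alpha>0[of 0] by (metis diff_zero not_less_iff_gr_or_eq order_less_le zero_less_one)
    have "\<alpha> (m + Suc n) = 1" for n
      by (induction n) (use step m in auto)
    from this[of 7] this[of 15] show False
      using \<alpha>8[of "m + 8"] unfolding add.assoc by simp
  qed
  then obtain m where m: "0 < \<alpha> m" "\<alpha> (m + 1) < 1"
    by blast
  \<comment> \<open>A 1 at \<open>m\<close> followed by a 0 has positive probability, so a later 1
    would complete a pattern with three changes. These are six zeros; the seventh is at
    \<open>m + 8\<close> or at \<open>m + 1\<close>.\<close>
  have later: "\<alpha> k = 0" if "m + 1 < k" "k < m + 8" for k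
    using zero[of m "m + 1" k] m that by simp
  show ?thesis
  proof (cases "\<alpha> m = 1")
    case True
    then have "\<alpha> (m + 8) = 0"
      using \<alpha>8[of m] by simp
    then have "\<alpha> (m + 1 + j) = 0" if "j \<in> {1..7}" for j
      using later[of "m + (1 + j)"] that unfolding add.assoc by (cases "j = 7") auto
    then show ?thesis
      using p_eq_1 by blast
  next
    case False
    then have "\<alpha> (m + 1) = 0"
      using zero[of m "m + 1" "m + 2"] later[of "m + 2"] by simp
    then have "\<alpha> (m + j) = 0" if "j \<in> {1..7}" for j
      using later[of "m + j"] that by (cases "j = 1") auto
    then show ?thesis
      using p_eq_1 by blast
  qed
qed

section \<open>Projectivities, and the weights around a 16-cycle\<close>

context octagon_epi
begin

text \<open>With the walk spelled out vertex by vertex, walks that branch off an apartment can be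
  given directly.\<close>

lemma w_opposite':
  assumes "B a0 a1" "B a1 a2" "B a2 a3" "B a3 a4" "B a4 a5" "B a5 a6" "B a6 a7" "B a7 a8"
    and "a0 \<noteq> a2" "a1 \<noteq> a3" "a2 \<noteq> a4" "a3 \<noteq> a5" "a4 \<noteq> a6" "a5 \<noteq> a7" "a6 \<noteq> a8"
  shows "w a0 a1 = w a8 a7"
proof -
  have "T.nb_walk (\<lambda>i. [a0, a1, a2, a3, a4, a5, a6, a7, a8] ! i) 8"
    using assms unfolding T.nb_walk_def by (simp add: All_less_Suc eval_nat_numeral)
  from w_opposite[OF this] show ?thesis
    by (simp add: eval_nat_numeral)
qed

lemma third_nbr:
  assumes "3 \<le> card {y. B x y}"
  shows "\<exists>y. B x y \<and> y \<noteq> a \<and> y \<noteq> b"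
proof (rule ccontr)
  assume "\<nexists>y. B x y \<and> y \<noteq> a \<and> y \<noteq> b"
  then have "card {y. B x y} \<le> card {a, b}"
    by (intro card_mono) auto
  then show False
    using assms card_insert_le_m1[of 2 "{b}" a] by simp
qed

lemma col_nb_walk:
  assumes "T.nb_walk c n" "i \<le> n"
  shows "colT (c i) \<longleftrightarrow> (colT (c 0) \<longleftrightarrow> even i)"
  using assms(2)
proof (induction i)
  case (Suc i)
  then show ?case
    using T.adj_col[OF T.nb_walk_adj(1)[OF assms(1), of i]] by auto
qed simp

lemma nb_walk_17_D:
  assumes "T.nb_walk c 17"
  shows "B (c 0) (c 1)" "B (c 1) (c 2)" "B (c 2) (c 3)" "B (c 3) (c 4)" "B (c 4) (c 5)"
    "B (c 5) (c 6)" "B (c 6) (c 7)" "B (c 7) (c 8)" "B (c 8) (c 9)" "B (c 9) (c 10)"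
    "B (c 10) (c 11)" "B (c 11) (c 12)" "B (c 12) (c 13)" "B (c 13) (c 14)"
    "B (c 14) (c 15)" "B (c 15) (c 16)"
    "c 0 \<noteq> c 2" "c 1 \<noteq> c 3" "c 2 \<noteq> c 4" "c 3 \<noteq> c 5" "c 4 \<noteq> c 6" "c 5 \<noteq> c 7" "c 6 \<noteq> c 8"
    "c 7 \<noteq> c 9" "c 8 \<noteq> c 10" "c 9 \<noteq> c 11" "c 10 \<noteq> c 12" "c 11 \<noteq> c 13" "c 12 \<noteq> c 14"
    "c 13 \<noteq> c 15" "c 14 \<noteq> c 16"
  using assms unfolding T.nb_walk_def by (simp_all add: All_less_Suc eval_nat_numeral)

text \<open>A projectivity: leave the apartment through \<open>L\<close>, \<open>a\<close>, \<open>b\<close> at two lines at distance four from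
  each other, so that three consecutive perspectivities carry \<open>a\<close> to \<open>b\<close>.\<close>

lemma w_line_const:
  assumes lines: "\<And>x. x \<in> W \<Longrightarrow> colT x \<Longrightarrow> 3 \<le> card {y. B x y}"
    and L: "colT L" "B L a" "B L b"
  shows "w L a = w L b"
proof (cases "a = b")
  case False
  obtain c where c: "T.nb_walk c 17" "c 0 = L" "c 1 = a" "c 15 = b" "c 16 = L" "c 17 = a"
    using T.ex_16_cycle[OF L(2,3) False] by blast
  note c' = nb_walk_17_D[OF c(1)]
  have "colT (c 6)" "colT (c 10)"
    using col_nb_walk[OF c(1), of 6] col_nb_walk[OF c(1), of 10] L c by auto
  then obtain y z where y: "B (c 6) y" "y \<noteq> c 5" "y \<noteq> c 7" and z: "B (c 10) z" "z \<noteq> c 9" "z \<noteq> c 11"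
    using third_nbr[OF lines, of "c 6" "c 5" "c 7"] third_nbr[OF lines, of "c 10" "c 9" "c 11"]
      T.nb_walk_V[OF c(1), of 6] T.nb_walk_V[OF c(1), of 10] by auto
  obtain l' l'' where l: "B y l'" "l' \<noteq> c 6" "B z l''" "l'' \<noteq> c 10"
    using T.another_nbr y z T.adj_V2 by metis
  have "w (c 0) (c 1) = w l' y"
    by (rule w_opposite'[of _ _ "c 2" "c 3" "c 4" "c 5" "c 6"]) (use c' y l in blast)+
  also have "w l' y = w l'' z"
    by (rule w_opposite'[of _ _ "c 6" "c 7" "c 8" "c 9" "c 10"])
      (use c' y z l T.adj_commute in blast)+
  also have "w l'' z = w (c 16) (c 15)"
    by (rule w_opposite'[of _ _ "c 10" "c 11" "c 12" "c 13" "c 14"])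
      (use c' y z l T.adj_commute in blast)+
  finally show ?thesis
    using c by simp
qed simp

text \<open>Seen from a point, the lines of the apartment have odd indices. The excursion at
  \<open>c 5\<close> therefore has length 3 and the one at \<open>c 9\<close> length 1, which again
  makes all three walks have length 8: 5 + 3, 3 + 4 + 1 and 1 + 7.\<close>

lemma w_point_const:
  assumes lines: "\<And>x. x \<in> W \<Longrightarrow> colT x \<Longrightarrow> 3 \<le> card {y. B x y}"
    and L: "\<not> colT x" "B x a" "B x b"
  shows "w x a = w x b"
proof (cases "a = b")
  case False
  obtain c where c: "T.nb_walk c 17" "c 0 = x" "c 1 = a" "c 15 = b" "c 16 = x" "c 17 = a"
    using T.ex_16_cycle[OF L(2,3) False] by blast
  note c' = nb_walk_17_D[OF c(1)]
  have "colT (c 5)" "colT (c 9)"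
    using col_nb_walk[OF c(1), of 5] col_nb_walk[OF c(1), of 9] L c by auto
  then obtain y z where y: "B (c 5) y" "y \<noteq> c 4" "y \<noteq> c 6" and z: "B (c 9) z" "z \<noteq> c 8" "z \<noteq> c 10"
    using third_nbr[OF lines, of "c 5" "c 4" "c 6"] third_nbr[OF lines, of "c 9" "c 8" "c 10"]
      T.nb_walk_V[OF c(1), of 5] T.nb_walk_V[OF c(1), of 9] by auto
  obtain y' where y': "B y y'" "y' \<noteq> c 5"
    using T.another_nbr y T.adj_V2 by metis
  obtain y'' where y'': "B y' y''" "y'' \<noteq> y"
    using T.another_nbr y' T.adj_V2 by metis
  have "w (c 0) (c 1) = w y'' y'"
    by (rule w_opposite'[of _ _ "c 2" "c 3" "c 4" "c 5" y]) (use c' y y' y'' in blast)+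
  also have "w y'' y' = w z (c 9)"
    by (rule w_opposite'[of _ _ y "c 5" "c 6" "c 7" "c 8"])
      (use c' y y' y'' z T.adj_commute in blast)+
  also have "w z (c 9) = w (c 16) (c 15)"
    by (rule w_opposite'[of _ _ "c 10" "c 11" "c 12" "c 13" "c 14"])
      (use c' z T.adj_commute in blast)+
  finally show ?thesis
    using c by simp
qed simp

lemma no_thick_lines:
  assumes points: "\<And>x. x \<in> W \<Longrightarrow> \<not> colT x \<Longrightarrow> card {y. B x y} = 2"
    and lines: "\<And>x. x \<in> W \<Longrightarrow> colT x \<Longrightarrow> card {y. B x y} = n"
    and D: "\<And>x. x \<in> W \<Longrightarrow> D x = (if colT x then s1 else t1)"
    and s1: "3 \<le> s1" and t1: "3 \<le> t1" and W: "W \<noteq> {}"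
  shows "n < 3"
proof (rule ccontr)
  assume "\<not> n < 3"
  then have lines3: "3 \<le> card {y. B x y}" if "x \<in> W" "colT x" for x
    using lines that by simp
  have wL: "n * w x a = s1" if "B x a" "colT x" for x a
  proof -
    have "(\<Sum>b | B x b. w x b) = (\<Sum>b | B x b. w x a)"
      by (intro sum.cong refl w_line_const[OF lines3]) (use that in auto)
    then show ?thesis
      using sum_w[of x] D[of x] lines[of x] that T.adj_V[of x a] by simp
  qed
  have wP: "2 * w x a = t1" if "B x a" "\<not> colT x" for x a
  proof -
    have "(\<Sum>b | B x b. w x b) = (\<Sum>b | B x b. w x a)"
      by (intro sum.cong refl w_point_const[OF lines3]) (use that in auto)
    then show ?thesis
      using sum_w[of x] D[of x] points[of x] that T.adj_V[of x a] by simp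
  qed
  define C where "C = s1 div n"
  define f where "f = t1 div 2"
  have n0: "0 < n"
    using \<open>\<not> n < 3\<close> by simp
  have w_eq_Cf: "w x a = (if colT x then C else f)" if "B x a" for x a
    using wL[OF that] wP[OF that] n0 by (auto simp: C_def f_def)
  have e: "e x a = int C * int f" if "B x a" for x a
    using w_eq_Cf[OF that] w_eq_Cf[OF T.adj_sym[OF that]] T.adj_col[OF that] by (auto simp: e_def)
  obtain x where "x \<in> W"
    using W by blast
  then obtain y where "B x y"
    using T.another_nbr by blast
  then obtain c where c: "T.nb_walk c 7" "c 0 = x"
    using T.ex_nb_walk by blast
  have nC: "int n * int C = int s1" and f2: "2 * int f = int t1"
  proof -
    obtain x y where "B x y" "colT x"
      using \<open>B x y\<close> T.adj_col[OF \<open>B x y\<close>] T.adj_sym[OF \<open>B x y\<close>] by blast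
    then show "int n * int C = int s1" "2 * int f = int t1"
      using wL[of x y] wP[of y x] w_eq_Cf[of x y] w_eq_Cf[of y x] T.adj_sym[of x y] T.adj_col[of x y]
      by (auto simp flip: of_nat_mult)
  qed
  have \<sigma>: "\<sigma> x = (if colT x then int s1 * int f - int s1 else 2 * int C * int f - int t1)"
    if "x \<in> W" for x
  proof -
    have "(\<Sum>z | B x z. e x z) = (\<Sum>z | B x z. int C * int f)"
      by (intro sum.cong refl e) simp
    then have "(\<Sum>z | B x z. e x z) = int (card {z. B x z}) * (int C * int f)"
      by simp
    then show ?thesis
      using points[OF that] lines[OF that] D[OF that] nC by (auto simp: \<sigma>_def)
  qed
  have \<sigma>_pair: "\<sigma> (c i) + \<sigma> (c (Suc i)) = int s1 * int f - int s1 + 2 * int C * int f - int t1"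
    if "i < 7" for i
    using \<sigma>[of "c i"] \<sigma>[of "c (Suc i)"] T.nb_walk_V[OF c(1)] that
      T.adj_col[OF T.nb_walk_adj(1)[OF c(1) that]] by auto
  have "int (w (c 0) (c 1)) * int (w (c 1) (c 2)) = int C * int f"
    using w_eq_Cf[of "c 0" "c 1"] w_eq_Cf[of "c 1" "c 2"] T.nb_walk_adj(1)[OF c(1), of 0]
      T.nb_walk_adj(1)[OF c(1), of 1] T.adj_col[of "c 0" "c 1"] by (auto simp: numeral_2_eq_2)
  moreover have "(\<Sum>j\<le>5. \<sigma> (c (j + 2))) = 3 * (int s1 * int f - int s1 + 2 * int C * int f - int t1)"
    using \<sigma>_pair[of 2] \<sigma>_pair[of 4] \<sigma>_pair[of 6] by (simp add: eval_nat_numeral)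
  moreover have "(\<Sum>j<5. e (c (j + 2)) (c (j + 3)) - 1) = (\<Sum>j<(5::nat). int C * int f - 1)"
  proof (rule sum.cong[OF refl])
    fix j :: nat assume "j \<in> {..<5}"
    then have "B (c (j + 2)) (c (Suc (j + 2)))"
      using T.nb_walk_adj(1)[OF c(1), of "j + 2"] by simp
    then show "e (c (j + 2)) (c (j + 3)) - 1 = int C * int f - 1"
      using e by (simp add: eval_nat_numeral)
  qed
  \<comment> \<open>\<open>C * f\<close> occurs once on the left and 6 - 5 times on the right. What
    remains, with \<open>2 * f\<close> for \<open>t1\<close>, is three times this product.\<close>
  ultimately have "(int s1 - 2) * (int f - 1) = 0"
    using nb_walk_7_identity[OF c(1)] f2 by (simp add: algebra_simps)
  then show False
    using s1 t1 f2 by auto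
qed

lemma ex_singleton_fibre:
  assumes c: "\<And>i. c (i + 16) = c i" "\<And>n. T.nb_walk c n"
    and nbrs: "\<And>i. {y. B (c (Suc i)) y} = {c i, c (Suc (Suc i))}"
    and D: "\<And>x. x \<in> W \<Longrightarrow> D x = (if colT x then s1 else t1)"
    and s1: "3 \<le> s1" and t1: "3 \<le> t1"
  shows "\<exists>z\<in>W. card {v \<in> V. \<phi> v = z} = 1"
proof -
  have cW: "c i \<in> W" for i
    using T.nb_walk_V[OF c(2)[of "Suc i"], of i] by simp
  have B: "B (c i) (c (Suc i))" for i
    using T.nb_walk_adj(1)[OF c(2)[of "Suc i"]] by simp
  have ne: "c i \<noteq> c (Suc (Suc i))" for i
    using c(2)[of "Suc (Suc i)"] by (simp add: T.nb_walk_def)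
  have shift: "T.nb_walk (\<lambda>i. c (i + k)) n" for k n
    by (rule T.nb_walk_shift[OF c(2)])
  define p where "p i = int (w (c i) (c (Suc i)))" for i
  define N where "N i = int (D (c i))" for i
  have per: "p (i + 16) = p i" for i
    using c(1)[of i] c(1)[of "Suc i"] by (simp add: p_def)
  \<comment> \<open>The walk of length 8 from \<open>c (i + 9)\<close> ends at
    \<open>c (i + 17)\<close>, which is \<open>c (i + 1)\<close>. Thus backward weights are forward
    weights, and one sequence \<open>p\<close> describes them all.\<close>
  have opp: "int (w (c (Suc i)) (c i)) = p (i + 9)" for i
    using w_opposite[OF shift[of "i + 9" 8]] c(1)[of i] c(1)[of "Suc i"]
    by (simp add: p_def add.commute[of _ i] add.assoc)
  have e_p: "e (c i) (c (Suc i)) = p i * p (i + 9)" for i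
    unfolding e_def opp by (simp add: p_def)
  have sum1: "p (Suc i) + p (i + 9) = N (Suc i)" for i
    using sum_w[OF cW[of "Suc i"]] ne[of i] opp[of i] unfolding nbrs by (simp add: p_def N_def)
  \<comment> \<open>\<open>sum1\<close> speaks about successors only; it is used at
    \<open>i + 15\<close>, and the period 16 brings the indices back.\<close>
  have sum: "p i + p (i + 8) = N i" for i
  proof -
    have "p (i + 16) + p (i + 24) = N (i + 16)"
      using sum1[of "i + 15"] unfolding Suc_eq_plus1 add.assoc by simp
    then show ?thesis
      using per[of i] per[of "i + 8"] c(1)[of i] unfolding add.assoc by (simp add: N_def)
  qed
  have \<sigma>1: "\<sigma> (c (Suc i)) = p i * p (i + 9) + p (Suc i) * p (i + 10) - N (Suc i)" for i
  proof -
    have "e (c (Suc i)) (c i) = p i * p (i + 9)"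
      unfolding e_p[symmetric] by (simp add: e_def)
    then show ?thesis
      using ne[of i] e_p[of "Suc i"] unfolding \<sigma>_def nbrs by (simp add: N_def add.commute[of _ i])
  qed
  have col: "colT (c (Suc i)) \<noteq> colT (c i)" for i
    using T.adj_col[OF B[of i]] by simp
  have N2: "N (i + 2) = N i" for i
    using col[of i] col[of "Suc i"] D[OF cW] by (auto simp: N_def numeral_2_eq_2)
  have N3: "3 \<le> N i" for i
    using D[OF cW[of i]] s1 t1 by (auto simp: N_def)
  have pos: "1 \<le> p i" for i
    using w_pos[OF B[of i]] by (simp add: p_def)
  \<comment> \<open>The six terms \<open>\<sigma>\<close> contain each of the five inner edges twice
    and the two outer ones once; the five subtracted terms remove one copy of each inner edge. Seven
    products remain, with the constant 1 + 5.\<close>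
  have id: "p i * p (i + 1) =
      6 - 3 * (N i + N (i + 1)) + (\<Sum>j\<in>{1..7}. p (i + j) * p (i + j + 9))" for i
  proof -
    have one_to_7: "{1..7::nat} = {1, 2, 3, 4, 5, 6, 7}"
      by auto
    have N': "N (i + 2) = N i" "N (i + 4) = N i" "N (i + 6) = N i"
      "N (i + 3) = N (i + 1)" "N (i + 5) = N (i + 1)" "N (i + 7) = N (i + 1)"
      using N2[of i] N2[of "i + 1"] N2[of "i + 2"] N2[of "i + 3"] N2[of "i + 4"] N2[of "i + 5"]
      unfolding add.assoc by (simp_all add: eval_nat_numeral)
    have \<sigma>': "\<sigma> (c (i + 2)) = p (i + 1) * p (i + 10) + p (i + 2) * p (i + 11) - N i"
      "\<sigma> (c (i + 3)) = p (i + 2) * p (i + 11) + p (i + 3) * p (i + 12) - N (i + 1)"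
      "\<sigma> (c (i + 4)) = p (i + 3) * p (i + 12) + p (i + 4) * p (i + 13) - N i"
      "\<sigma> (c (i + 5)) = p (i + 4) * p (i + 13) + p (i + 5) * p (i + 14) - N (i + 1)"
      "\<sigma> (c (i + 6)) = p (i + 5) * p (i + 14) + p (i + 6) * p (i + 15) - N i"
      "\<sigma> (c (i + 7)) = p (i + 6) * p (i + 15) + p (i + 7) * p (i + 16) - N (i + 1)"
      using \<sigma>1[of "i + 1"] \<sigma>1[of "i + 2"] \<sigma>1[of "i + 3"] \<sigma>1[of "i + 4"] \<sigma>1[of "i + 5"] \<sigma>1[of "i + 6"] N'
      unfolding Suc_eq_plus1 add.assoc by simp_all
    have e': "e (c (i + 2)) (c (i + 3)) = p (i + 2) * p (i + 11)"
      "e (c (i + 3)) (c (i + 4)) = p (i + 3) * p (i + 12)"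
      "e (c (i + 4)) (c (i + 5)) = p (i + 4) * p (i + 13)"
      "e (c (i + 5)) (c (i + 6)) = p (i + 5) * p (i + 14)"
      "e (c (i + 6)) (c (i + 7)) = p (i + 6) * p (i + 15)"
      using e_p[of "i + 2"] e_p[of "i + 3"] e_p[of "i + 4"] e_p[of "i + 5"] e_p[of "i + 6"]
      unfolding Suc_eq_plus1 add.assoc by simp_all
    have s5: "(\<Sum>j\<le>5. \<sigma> (c (j + 2 + i))) =
        \<sigma> (c (i + 2)) + \<sigma> (c (i + 3)) + \<sigma> (c (i + 4)) + \<sigma> (c (i + 5)) + \<sigma> (c (i + 6)) + \<sigma> (c (i + 7))"
      by (simp add: eval_nat_numeral add.commute)
    have s4: "(\<Sum>j<5. e (c (j + 2 + i)) (c (j + 3 + i)) - 1) = e (c (i + 2)) (c (i + 3)) + e (c (i + 3)) (c (i + 4)) +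
        e (c (i + 4)) (c (i + 5)) + e (c (i + 5)) (c (i + 6)) + e (c (i + 6)) (c (i + 7)) - 5"
      by (simp add: eval_nat_numeral add.commute)
    have "p i * p (i + 1) = 1 + (\<Sum>j\<le>5. \<sigma> (c (j + 2 + i))) -
        (\<Sum>j<5. e (c (j + 2 + i)) (c (j + 3 + i)) - 1)"
      using nb_walk_7_identity[OF shift[of i 7]] by (simp add: p_def eval_nat_numeral)
    then show ?thesis
      unfolding s5 s4 \<sigma>' e' one_to_7 unfolding add.assoc by simp
  qed
  obtain i where i: "\<forall>j\<in>{1..7}. p (i + j) = 1"
    using antiperiodic_weights[OF per sum pos N2 N3 id] by blast
  have "w (c (j + Suc i)) (c (Suc j + Suc i)) = 1" if "j < 7" for j
    using i[rule_format, of "Suc j"] that by (simp add: p_def add.commute)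
  then have "card {v \<in> V. \<phi> v = c (7 + Suc i)} = 1"
    using card_fibre_nb_walk_7[OF shift[of "Suc i" 7]] by simp
  then show ?thesis
    using cW by blast
qed

end

section \<open>Cycle graphs\<close>

text \<open>The labelling is periodic on all of \<open>nat\<close>, so that successors and shifts
  can be written without reduction modulo \<open>n\<close>.\<close>

definition cycle_graph :: "nat \<Rightarrow> 'v set \<Rightarrow> ('v \<Rightarrow> 'v \<Rightarrow> bool) \<Rightarrow> (nat \<Rightarrow> 'v) \<Rightarrow> bool" where
  "cycle_graph n V adj c \<longleftrightarrow> (\<forall>i. c (i + n) = c i) \<and> bij_betw c {..<n} V \<and>
     (\<forall>x y. adj x y \<longleftrightarrow> (\<exists>i. x = c i \<and> y = c (Suc i) \<or> y = c i \<and> x = c (Suc i)))"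

lemma cycle_graph_modI:
  assumes "0 < n" and bij: "bij_betw c {..<n} V"
    and adj: "\<And>x y. adj x y \<longleftrightarrow>
      (\<exists>i<n. x = c i \<and> y = c (Suc i mod n) \<or> y = c i \<and> x = c (Suc i mod n))"
  shows "cycle_graph n V adj (\<lambda>i. c (i mod n))"
  unfolding cycle_graph_def
proof (intro conjI allI)
  show "bij_betw (\<lambda>i. c (i mod n)) {..<n} V"
    using bij by (rule bij_betw_cong[THEN iffD1, rotated]) simp
  fix x y
  show "adj x y \<longleftrightarrow> (\<exists>i. x = c (i mod n) \<and> y = c (Suc i mod n) \<or> y = c (i mod n) \<and> x = c (Suc i mod n))"
    unfolding adj
  proof safe
    fix i
    show "\<exists>i'<n. c (i mod n) = c i' \<and> c (Suc i mod n) = c (Suc i' mod n) \<or>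
        c (Suc i mod n) = c i' \<and> c (i mod n) = c (Suc i' mod n)"
      using \<open>0 < n\<close> by (intro exI[of _ "i mod n"]) (simp add: mod_Suc_eq)
    show "\<exists>i'<n. c (Suc i mod n) = c i' \<and> c (i mod n) = c (Suc i' mod n) \<or>
        c (i mod n) = c i' \<and> c (Suc i mod n) = c (Suc i' mod n)"
      using \<open>0 < n\<close> by (intro exI[of _ "i mod n"]) (simp add: mod_Suc_eq)
  qed (metis mod_less)+
qed simp

context
  fixes n :: nat and V :: "'v set" and adj c
  assumes cyc: "cycle_graph n V adj c"
begin

lemma cycle_period: "c (i + n) = c i"
  using cyc by (simp add: cycle_graph_def)

lemma cycle_adj: "adj x y \<longleftrightarrow> (\<exists>i. x = c i \<and> y = c (Suc i) \<or> y = c i \<and> x = c (Suc i))"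
  using cyc by (simp add: cycle_graph_def)

lemma cycle_mod: "c (i mod n) = c i"
proof -
  have "c (i + k * n) = c i" for i k
  proof (induction k)
    case (Suc k)
    then show ?case
      using cycle_period[of "i + k * n"] by (simp add: add.assoc add.commute[of n])
  qed simp
  from this[of "i mod n" "i div n"] show ?thesis
    by simp
qed

lemma cycle_mem:
  assumes "0 < n"
  shows "c i \<in> V" "x \<in> V \<Longrightarrow> \<exists>i<n. x = c i"
proof -
  have V: "c ` {..<n} = V"
    using cyc by (simp add: cycle_graph_def bij_betw_def)
  have "c (i mod n) \<in> V"
    using assms unfolding V[symmetric] by simp
  then show "c i \<in> V"
    by (simp only: cycle_mod)
  show "\<exists>i<n. x = c i" if "x \<in> V"
    using that unfolding V[symmetric] by auto
qed

lemma cycle_eq_iff: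
  assumes "0 < n"
  shows "c i = c j \<longleftrightarrow> i mod n = j mod n"
proof -
  have "inj_on c {..<n}"
    using cyc by (simp add: cycle_graph_def bij_betw_def)
  then have "c (i mod n) = c (j mod n) \<longleftrightarrow> i mod n = j mod n"
    using assms by (simp add: inj_on_eq_iff)
  then show ?thesis
    by (simp only: cycle_mod)
qed

lemma cycle_eq_add:
  assumes "0 < n"
  shows "c (i + k) = c (j + k) \<longleftrightarrow> c i = c j"
proof
  assume "c i = c j"
  then show "c (i + k) = c (j + k)"
    unfolding cycle_eq_iff[OF assms] by (metis mod_add_left_eq)
next
  assume "c (i + k) = c (j + k)"
  \<comment> \<open>The shift by \<open>k\<close> is undone by going on to the next multiple of
    \<open>n\<close>, since indices cannot be lowered below 0.\<close>
  then have "c (i + k + (n - k mod n)) = c (j + k + (n - k mod n))"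
    unfolding cycle_eq_iff[OF assms] by (metis mod_add_left_eq)
  moreover have "c (i + k + (n - k mod n)) = c i" for i
  proof -
    have "k + (n - k mod n) = n + k div n * n"
      using assms div_mult_mod_eq[of k n] mod_less_divisor[of n k] by linarith
    then have "k + (n - k mod n) = Suc (k div n) * n"
      by simp
    then show ?thesis
      unfolding cycle_eq_iff[OF assms] add.assoc by (simp only: mod_mult_self1)
  qed
  ultimately show "c i = c j"
    by simp
qed

lemma cycle_Suc_eq: "0 < n \<Longrightarrow> c (Suc i) = c (Suc j) \<longleftrightarrow> c i = c j"
  using cycle_eq_add[of i 1 j] by simp

lemma cycle_Suc_Suc_neq: "3 \<le> n \<Longrightarrow> c i \<noteq> c (Suc (Suc i))"
  using cycle_eq_add[of 0 i 2] by (simp add: cycle_eq_iff)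

text \<open>Stated at a successor because index 0 has no predecessor; an arbitrary vertex is moved
  to this form by the period.\<close>

lemma cycle_nbrs:
  assumes "0 < n"
  shows "{y. adj (c (Suc i)) y} = {c i, c (Suc (Suc i))}"
  unfolding cycle_adj using cycle_Suc_eq[OF assms] by auto

end

lemma cycle_shift:
  assumes cyc: "cycle_graph n V adj c" and "0 < n"
  shows "cycle_graph n V adj (\<lambda>i. c (i + k))"
  unfolding cycle_graph_def
proof (intro conjI allI)
  show "c (i + n + k) = c (i + k)" for i
    using cycle_period[OF cyc, of "i + k"] by (simp add: ac_simps)
  have back_k: "\<exists>j. c i = c (j + k)" for i
  proof -
    have "i + (n * k - k) + k = i + k * n"
      using \<open>0 < n\<close> by (cases n) auto
    then have "c i = c (i + (n * k - k) + k)"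
      unfolding cycle_eq_iff[OF cyc \<open>0 < n\<close>] by (simp only: mod_mult_self1)
    then show ?thesis ..
  qed
  show "bij_betw (\<lambda>i. c (i + k)) {..<n} V"
    unfolding bij_betw_def
  proof
    show "inj_on (\<lambda>i. c (i + k)) {..<n}"
      using cycle_eq_add[OF cyc \<open>0 < n\<close>] cycle_eq_iff[OF cyc \<open>0 < n\<close>] by (simp add: inj_on_def)
    show "(\<lambda>i. c (i + k)) ` {..<n} = V"
    proof (intro equalityI subsetI)
      fix x assume "x \<in> V"
      then obtain j where "x = c (j + k)"
        using cycle_mem(2)[OF cyc \<open>0 < n\<close>] back_k by metis
      then have "x = c (j mod n + k)"
        using cycle_eq_add[OF cyc \<open>0 < n\<close>, of "j mod n" k j] cycle_mod[OF cyc, of j] by simp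
      then show "x \<in> (\<lambda>i. c (i + k)) ` {..<n}"
        using \<open>0 < n\<close> by auto
    qed (use cycle_mem(1)[OF cyc \<open>0 < n\<close>] in auto)
  qed
  show "adj x y \<longleftrightarrow> (\<exists>i. x = c (i + k) \<and> y = c (Suc i + k) \<or> y = c (i + k) \<and> x = c (Suc i + k))" for x y
  proof -
    have "\<exists>j. c i = c (j + k) \<and> c (Suc i) = c (Suc j + k)" for i
      using back_k[of i] cycle_Suc_eq[OF cyc \<open>0 < n\<close>] by auto
    then show ?thesis
      unfolding cycle_adj[OF cyc] by (metis add_Suc)
  qed
qed

context bip_graph
begin

text \<open>Two geodesics that end in different predecessors, for the least possible distance, bound an
  induced cycle.\<close>

lemma ex_short_cycle:
  assumes "x \<in> V" "d x y < 8" "adj y a" "adj y b" "d x y = Suc (d x a)" "d x y = Suc (d x b)" "a \<noteq> b"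
  shows "\<exists>k c. 2 \<le> k \<and> k < 8 \<and> c ` {..<2 * k} \<subseteq> V \<and>
    cycle_graph (2 * k) (c ` {..<2 * k}) (\<lambda>x y. adj x y \<and> x \<in> c ` {..<2 * k} \<and> y \<in> c ` {..<2 * k}) c"
proof -
  \<comment> \<open>All four vertices are quantified, so that minimality also applies to violations
    with another base vertex.\<close>
  define P where "P k \<longleftrightarrow> (\<exists>x y a b. x \<in> V \<and> d x y = k \<and> k < 8 \<and> adj y a \<and> adj y b \<and>
    d x y = Suc (d x a) \<and> d x y = Suc (d x b) \<and> a \<noteq> b)" for k
  define k where "k = (LEAST k. P k)"
  have "P (d x y)"
    unfolding P_def using assms by blast
  then have "P k" and min: "\<And>j. j < k \<Longrightarrow> \<not> P j"
    unfolding k_def by (auto intro: LeastI dest: not_less_Least)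
  then obtain x y a b where x: "x \<in> V" and k: "d x y = k" "k < 8" and a: "adj y a" "k = Suc (d x a)"
    and b: "adj y b" "k = Suc (d x b)" and "a \<noteq> b"
    unfolding P_def by metis
  have V: "a \<in> V" "b \<in> V"
    using a b adj_V2 by auto
  have path: "\<exists>G. G 0 = x \<and> G k = y \<and> G (k - 1) = a \<and> (\<forall>i\<le>k. d x (G i) = i \<and> G i \<in> V) \<and>
      (\<forall>i<k. adj (G i) (G (Suc i)))" if a: "adj y a" "k = Suc (d x a)" for a
  proof -
    obtain g where g: "g 0 = a" "g (d x a) = x" "\<forall>i\<le>d x a. d x (g i) = d x a - i"
      "\<forall>i<d x a. adj (g i) (g (Suc i))"
      using ex_geodesic[OF x adj_V2[OF a(1)]] by blast
    define G where "G i = (if i = k then y else g (k - 1 - i))" for i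
    have adj: "adj (G i) (G (Suc i))" if "i < k" for i
    proof (cases "Suc i = k")
      case True
      then show ?thesis using g(1) a adj_sym by (auto simp: G_def)
    next
      case False
      then have "k - 1 - i = Suc (k - 1 - Suc i)" "k - 1 - Suc i < d x a"
        using that a by auto
      then have "adj (g (k - 1 - i)) (g (k - 1 - Suc i))"
        using g(4) adj_sym by metis
      then show ?thesis
        using that False by (simp add: G_def)
    qed
    moreover have "d x (G i) = i \<and> G i \<in> V" if "i \<le> k" for i
    proof (cases "i = k")
      case True
      then show ?thesis using k adj_V[OF a(1)] by (simp add: G_def)
    next
      case False
      then show ?thesis
        using g(3)[rule_format, of "k - 1 - i"] adj_V[OF adj[of i]] that a by (simp add: G_def)
    qed
    moreover have "G 0 = x" "G k = y" "G (k - 1) = a"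
      using g a by (auto simp: G_def)
    ultimately show ?thesis
      by blast
  qed
  obtain G where G: "G 0 = x" "G k = y" "G (k - 1) = a" "\<And>i. i \<le> k \<Longrightarrow> d x (G i) = i"
    "\<And>i. i \<le> k \<Longrightarrow> G i \<in> V" "\<And>i. i < k \<Longrightarrow> adj (G i) (G (Suc i))"
    using path[OF a] by blast
  obtain H where H: "H 0 = x" "H k = y" "H (k - 1) = b" "\<And>i. i \<le> k \<Longrightarrow> d x (H i) = i"
    "\<And>i. i \<le> k \<Longrightarrow> H i \<in> V" "\<And>i. i < k \<Longrightarrow> adj (H i) (H (Suc i))"
    using path[OF b] by blast
  have along: "d (F i) (F (i + m)) = m"
    if F: "\<And>i. i \<le> k \<Longrightarrow> d x (F i) = i" "\<And>i. i \<le> k \<Longrightarrow> F i \<in> V" "\<And>i. i < k \<Longrightarrow> adj (F i) (F (Suc i))"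
      and "i + m \<le> k" for F i m
  proof -
    have "d (F i) (F (i + m)) \<le> m"
      using that(4)
    proof (induction m)
      case (Suc m)
      then show ?case
        using d_adj_le[OF F(2)[of i] F(3)[of "i + m"]] by auto
    qed simp
    moreover have "i + m \<le> i + d (F i) (F (i + m))"
      using d_triangle[OF x F(2)[of i] F(2)[of "i + m"]] F(1)[of i] F(1)[of "i + m"] that(4) by simp
    ultimately show ?thesis
      by simp
  qed
  \<comment> \<open>A common inner vertex would be the base of a violation at distance
    \<open>k - i\<close>, with the same \<open>y\<close>, \<open>a\<close> and
    \<open>b\<close>.\<close>
  have GH: "G i \<noteq> H i" if "0 < i" "i < k" for i
  proof
    assume eq: "G i = H i"
    then have i: "i < k - 1"
      using G(3) H(3) \<open>a \<noteq> b\<close> that by (cases "i = k - 1") auto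
    have "d (G i) y = k - i" "d (G i) a = k - 1 - i"
      using along[of G i "k - i", OF G(4,5,6)] along[of G i "k - 1 - i", OF G(4,5,6)] G i by auto
    moreover have "d (G i) b = k - 1 - i"
      using along[of H i "k - 1 - i", OF H(4,5,6)] H(3) eq i by auto
    ultimately have "P (k - i)"
      unfolding P_def using G(5)[of i] a(1) b(1) \<open>a \<noteq> b\<close> that k(2) i
      by (intro exI[of _ "G i"] exI[of _ y] exI[of _ a] exI[of _ b]) auto
    then show False
      using min[of "k - i"] that by simp
  qed
  \<comment> \<open>Such an edge gives \<open>F j\<close> two predecessors at a distance less than
    \<open>k\<close> from \<open>x\<close>.\<close>
  have chord: False if "adj z (F j)" "d x z = i" "z \<noteq> F i" "j = Suc i" "j < k"
    and F: "\<And>i. i \<le> k \<Longrightarrow> d x (F i) = i" "\<And>i. i < k \<Longrightarrow> adj (F i) (F (Suc i))" for F z i j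
  proof -
    have "P j"
      unfolding P_def using that x k(2) F(1)[of i] F(1)[of j] F(2)[of i] adj_sym
      by (intro exI[of _ x] exI[of _ "F j"] exI[of _ z] exI[of _ "F i"]) auto
    then show False
      using min[OF \<open>j < k\<close>] by simp
  qed
  have noGH: "\<not> adj (G i) (H j)" if "0 < i" "i < k" "0 < j" "j < k" for i j
  proof
    assume adj: "adj (G i) (H j)"
    have "j = Suc i \<or> i = Suc j"
      using d_adj[OF x adj] G(4)[of i] H(4)[of j] that by auto
    then show False
    proof
      assume "j = Suc i"
      then show False
        using chord[OF adj _ GH _ _ H(4,6)] G(4)[of i] that by simp
    next
      assume "i = Suc j"
      then show False
        using chord[OF adj_sym[OF adj] _ GH[symmetric] _ _ G(4,6)] H(4)[of j] that by simp
    qed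
  qed
  have k2: "2 \<le> k"
  proof (rule ccontr)
    assume "\<not> 2 \<le> k"
    then have "d x a = 0" "d x b = 0"
      using a b by auto
    then show False
      using d_eq_0_iff[OF x] V \<open>a \<noteq> b\<close> by auto
  qed
  define c where "c i = (if i \<le> k then G i else H (2 * k - i))" for i
  have cH: "c i = H (2 * k - i)" if "k \<le> i" for i
    using that G(2) H(2) by (auto simp: c_def)
  have lev: "d x (c i) = (if i \<le> k then i else 2 * k - i)" if "i < 2 * k" for i
    using G(4)[of i] H(4)[of "2 * k - i"] that by (auto simp: c_def)
  have sides: "c i \<noteq> c j" if "i \<le> k" "k < j" "j < 2 * k" for i j
  proof
    assume eq: "c i = c j"
    then have "i = 2 * k - j"
      using lev[of i] lev[of j] that by simp
    then show False
      using GH[of i] eq that by (auto simp: c_def)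
  qed
  have inj: "i = j" if "i < 2 * k" "j < 2 * k" "c i = c j" for i j
  proof -
    have "\<not> (i \<le> k \<and> k < j)" "\<not> (j \<le> k \<and> k < i)"
      using sides[of i j] sides[of j i] that(1,2) that(3) that(3)[symmetric] by blast+
    moreover have "(if i \<le> k then i else 2 * k - i) = (if j \<le> k then j else 2 * k - j)"
      using lev[OF that(1)] lev[OF that(2)] unfolding that(3) by simp
    ultimately show ?thesis
      using that(1,2) by (simp split: if_splits)
  qed
  have step: "adj (c i) (c (Suc i mod (2 * k)))" if i: "i < 2 * k" for i
  proof -
    consider "i < k" | "k \<le> i" "Suc i < 2 * k" | "Suc i = 2 * k"
      using i by linarith
    then show ?thesis
    proof cases
      case 1
      then show ?thesis using G(6)[of i] by (simp add: c_def)
    next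
      case 2
      then have "2 * k - i = Suc (2 * k - Suc i)" "2 * k - Suc i < k"
        by auto
      then have "adj (H (2 * k - i)) (H (2 * k - Suc i))"
        using adj_sym[OF H(6)[of "2 * k - Suc i"]] by simp
      then show ?thesis
        using 2 cH[of i] cH[of "Suc i"] by simp
    next
      case 3
      then have "k \<le> i" "2 * k - i = 1"
        using k2 by linarith+
      then have "c i = H 1" "c (Suc i mod (2 * k)) = H 0"
        using cH[of i] 3 G(1) H(1) by (simp_all add: c_def)
      then show ?thesis
        using adj_sym[OF H(6)[of 0]] k2 by simp
    qed
  qed
  \<comment> \<open>Within one geodesic, distances from \<open>x\<close> exclude chords; between
    inner vertices of both, \<open>noGH\<close> does. Edges from one side to the other remain only
    at the ends \<open>x\<close> and \<open>y\<close>.\<close>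
  have only: "j = Suc i mod (2 * k) \<or> i = Suc j mod (2 * k)"
    if ij: "i < 2 * k" "j < 2 * k" "adj (c i) (c j)" for i j
  proof -
    have lev_ij: "d x (c j) = Suc (d x (c i)) \<or> d x (c i) = Suc (d x (c j))"
      using d_adj[OF x ij(3)] .
    have mixed: "j = Suc i mod (2 * k) \<or> i = Suc j mod (2 * k)"
      if "i \<le> k" "k < j" "j < 2 * k" "adj (c i) (c j)"
        "d x (c j) = Suc (d x (c i)) \<or> d x (c i) = Suc (d x (c j))" for i j
    proof -
      consider "i = 0" | "i = k" | "0 < i" "i < k"
        using \<open>i \<le> k\<close> by linarith
      then show ?thesis
      proof cases
        case 1
        then have "Suc j = 2 * k"
          using lev[of i] lev[of j] that by auto
        then show ?thesis using 1 by simp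
      next
        case 2
        then have "j = Suc i"
          using lev[of i] lev[of j] that k2 by auto
        then show ?thesis
          using that by simp
      next
        case 3
        then show ?thesis
          using noGH[of i "2 * k - j"] that by (auto simp: c_def)
      qed
    qed
    consider "i \<le> k" "j \<le> k" | "i \<le> k" "k < j" | "k < i" "j \<le> k" | "k < i" "k < j"
      by linarith
    then show ?thesis
    proof cases
      case 1
      then show ?thesis using lev_ij lev[of i] lev[of j] ij by auto
    next
      case 2
      then show ?thesis using mixed[of i j] ij lev_ij by blast
    next
      case 3
      then show ?thesis using mixed[of j i] ij lev_ij adj_sym by blast
    next
      case 4
      then have "j = Suc i \<or> i = Suc j"
        using lev_ij lev[of i] lev[of j] ij by auto
      then show ?thesis
        using ij by auto
    qed
  qed
  have image: "(\<lambda>i. c (i mod (2 * k))) ` {..<2 * k} = c ` {..<2 * k}"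
    by (rule image_cong) auto
  have "c ` {..<2 * k} \<subseteq> V"
    using G(5) H(5) by (auto simp: c_def)
  moreover have "cycle_graph (2 * k) (c ` {..<2 * k})
     (\<lambda>x y. adj x y \<and> x \<in> c ` {..<2 * k} \<and> y \<in> c ` {..<2 * k}) (\<lambda>i. c (i mod (2 * k)))"
  proof (rule cycle_graph_modI)
    show "bij_betw c {..<2 * k} (c ` {..<2 * k})"
      using inj by (auto simp: bij_betw_def inj_on_def)
    fix x y
    have m: "Suc i mod (2 * k) < 2 * k" for i
      using k2 by simp
    show "(adj x y \<and> x \<in> c ` {..<2 * k} \<and> y \<in> c ` {..<2 * k}) \<longleftrightarrow>
       (\<exists>i<2 * k. x = c i \<and> y = c (Suc i mod (2 * k)) \<or> y = c i \<and> x = c (Suc i mod (2 * k)))"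
      (is "?l \<longleftrightarrow> ?r")
    proof
      assume ?l
      then show ?r
        using only by blast
    next
      assume ?r
      then show ?l
        using step adj_sym m by (metis imageI lessThan_iff)
    qed
  qed (use k2 in simp)
  ultimately show ?thesis
    using k2 k(2) image by (intro exI[of _ k] exI[of _ "\<lambda>i. c (i mod (2 * k))"]) simp
qed

end

section \<open>Incidence graphs\<close>

definition iadj :: "('p, 'l) geometry \<Rightarrow> 'p + 'l \<Rightarrow> 'p + 'l \<Rightarrow> bool" where
  "iadj \<Gamma> x y \<longleftrightarrow> (\<exists>p l. (p, l) \<in> inc \<Gamma> \<and> (x = Inl p \<and> y = Inr l \<or> x = Inr l \<and> y = Inl p))"

abbreviation elems :: "('p, 'l) geometry \<Rightarrow> ('p + 'l) set" where
  "elems \<Gamma> \<equiv> points \<Gamma> <+> lines \<Gamma>"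

lemma iadj_simps [simp]:
  "iadj \<Gamma> (Inl p) (Inr l) \<longleftrightarrow> (p, l) \<in> inc \<Gamma>"
  "iadj \<Gamma> (Inr l) (Inl p) \<longleftrightarrow> (p, l) \<in> inc \<Gamma>"
  "\<not> iadj \<Gamma> (Inl p) (Inl q)"
  "\<not> iadj \<Gamma> (Inr l) (Inr m)"
  by (auto simp: iadj_def)

lemma iadj_sym: "iadj \<Gamma> x y \<Longrightarrow> iadj \<Gamma> y x"
  by (auto simp: iadj_def)

lemma iadj_isl: "iadj \<Gamma> x y \<Longrightarrow> isl x \<noteq> isl y"
  by (auto simp: iadj_def)

lemma iadj_elems: "is_geometry \<Gamma> \<Longrightarrow> iadj \<Gamma> x y \<Longrightarrow> x \<in> elems \<Gamma>"
  by (auto simp: iadj_def is_geometry_def)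

lemma nbrs_point: "is_geometry \<Gamma> \<Longrightarrow> {y. iadj \<Gamma> (Inl p) y} = Inr ` lines_through \<Gamma> p"
  by (auto simp: iadj_def is_geometry_def lines_through_def)

lemma nbrs_line: "is_geometry \<Gamma> \<Longrightarrow> {y. iadj \<Gamma> (Inr l) y} = Inl ` points_on \<Gamma> l"
  by (auto simp: iadj_def is_geometry_def points_on_def)

lemma card_nbrs_point: "is_geometry \<Gamma> \<Longrightarrow> card {y. iadj \<Gamma> (Inl p) y} = card (lines_through \<Gamma> p)"
  unfolding nbrs_point by (rule card_image) simp

lemma card_nbrs_line: "is_geometry \<Gamma> \<Longrightarrow> card {y. iadj \<Gamma> (Inr l) y} = card (points_on \<Gamma> l)"
  unfolding nbrs_line by (rule card_image) simp

lemma cycle_isl: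
  assumes "cycle_graph n V (iadj \<Gamma>) c"
  shows "isl (c i) \<longleftrightarrow> (isl (c 0) \<longleftrightarrow> even i)"
proof (induction i)
  case (Suc i)
  have "iadj \<Gamma> (c i) (c (Suc i))"
    using cycle_adj[OF assms] by blast
  then show ?case
    using Suc iadj_isl by fastforce
qed simp

lemma ordinary_polygonD:
  assumes "ordinary_polygon k \<Gamma>"
  shows "2 \<le> k" "is_geometry \<Gamma>" "\<exists>c. cycle_graph (2 * k) (elems \<Gamma>) (iadj \<Gamma>) c"
proof -
  obtain p l where k: "2 \<le> k" and p: "bij_betw p {..<k} (points \<Gamma>)" and l: "bij_betw l {..<k} (lines \<Gamma>)"
    and inc: "inc \<Gamma> = {(p i, l i) |i. i < k} \<union> {(p (Suc i mod k), l i) |i. i < k}"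
    using assms by (auto simp: ordinary_polygon_def)
  show "2 \<le> k"
    by (rule k)
  have mem: "p i \<in> points \<Gamma>" "l i \<in> lines \<Gamma>" if "i < k" for i
    using p l that by (auto simp: bij_betw_def)
  show "is_geometry \<Gamma>"
    using mem k by (auto simp: is_geometry_def inc)
  define c where "c i = (if even i then Inl (p (i div 2)) else Inr (l (i div 2)))" for i
  have cyc: "cycle_graph (2 * k) (elems \<Gamma>) (iadj \<Gamma>) (\<lambda>i. c (i mod (2 * k)))"
  proof (rule cycle_graph_modI)
    show "bij_betw c {..<2 * k} (elems \<Gamma>)"
      unfolding bij_betw_def
    proof
      show "inj_on c {..<2 * k}"
      proof (rule inj_onI)
        fix i j assume ij: "i \<in> {..<2 * k}" "j \<in> {..<2 * k}" "c i = c j"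
        have "i div 2 = j div 2"
          using ij p l by (auto simp: c_def bij_betw_def inj_on_eq_iff split: if_splits)
        moreover have "even i \<longleftrightarrow> even j"
          using ij(3) by (auto simp: c_def split: if_splits)
        ultimately show "i = j"
          by (metis even_two_times_div_two odd_two_times_div_two_succ)
      qed
      show "c ` {..<2 * k} = elems \<Gamma>"
      proof (intro equalityI subsetI)
        fix x assume "x \<in> elems \<Gamma>"
        then have "x \<in> Inl ` p ` {..<k} \<or> x \<in> Inr ` l ` {..<k}"
          using p l by (auto simp: bij_betw_def)
        then consider i where "i < k" "x = Inl (p i)" | i where "i < k" "x = Inr (l i)"
          by blast
        then show "x \<in> c ` {..<2 * k}"
        proof cases
          case (1 i)
          then show ?thesis by (intro image_eqI[of _ _ "2 * i"]) (simp_all add: c_def)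
        next
          case (2 i)
          then show ?thesis by (intro image_eqI[of _ _ "Suc (2 * i)"]) (simp_all add: c_def)
        qed
      qed (use mem in \<open>auto simp: c_def\<close>)
    qed
    have c_even: "c (2 * i) = Inl (p i)" and c_odd: "c (Suc (2 * i)) = Inr (l i)" for i
      by (simp_all add: c_def)
    have c_next: "c (Suc (Suc (2 * i)) mod (2 * k)) = Inl (p (Suc i mod k))" for i
    proof -
      have "Suc (Suc (2 * i)) mod (2 * k) = 2 * (Suc i mod k)"
        using mult_mod_right[of 2 "Suc i" k] by simp
      then show ?thesis
        by (simp add: c_even)
    qed
    have incident: "(q, m) \<in> inc \<Gamma> \<longleftrightarrow> (\<exists>i<2 * k. Inl q = c i \<and> Inr m = c (Suc i mod (2 * k)) \<or>
        Inr m = c i \<and> Inl q = c (Suc i mod (2 * k)))" for q m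
    proof
      assume "(q, m) \<in> inc \<Gamma>"
      then obtain i where i: "i < k" "m = l i" "q = p i \<or> q = p (Suc i mod k)"
        by (auto simp: inc)
      then have "Inl q = c (2 * i) \<and> Inr m = c (Suc (2 * i) mod (2 * k)) \<or>
        Inr m = c (Suc (2 * i)) \<and> Inl q = c (Suc (Suc (2 * i)) mod (2 * k))"
        by (auto simp: c_even c_odd c_next)
      moreover have "2 * i < 2 * k" "Suc (2 * i) < 2 * k"
        using i by auto
      ultimately show "\<exists>i<2 * k. Inl q = c i \<and> Inr m = c (Suc i mod (2 * k)) \<or>
        Inr m = c i \<and> Inl q = c (Suc i mod (2 * k))"
        by blast
    next
      assume "\<exists>i<2 * k. Inl q = c i \<and> Inr m = c (Suc i mod (2 * k)) \<or>
        Inr m = c i \<and> Inl q = c (Suc i mod (2 * k))"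
      then obtain i where i: "i < 2 * k" "Inl q = c i \<and> Inr m = c (Suc i mod (2 * k)) \<or>
        Inr m = c i \<and> Inl q = c (Suc i mod (2 * k))"
        by blast
      show "(q, m) \<in> inc \<Gamma>"
      proof (cases "even i")
        case True
        then obtain j where j: "i = 2 * j"
          by blast
        then have "Suc i mod (2 * k) = Suc (2 * j)"
          using i(1) by auto
        then show ?thesis
          using i j by (auto simp: c_even c_odd inc)
      next
        case False
        then obtain j where j: "i = Suc (2 * j)"
          by (metis oddE Suc_eq_plus1)
        then show ?thesis
          using i by (auto simp: c_odd c_next inc)
      qed
    qed
    show "iadj \<Gamma> x y \<longleftrightarrow>
      (\<exists>i<2 * k. x = c i \<and> y = c (Suc i mod (2 * k)) \<or> y = c i \<and> x = c (Suc i mod (2 * k)))" for x y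
    proof -
      have "isl (c i) \<noteq> isl (c (Suc i mod (2 * k)))" if "i < 2 * k" for i
      proof (cases "Suc i = 2 * k")
        case True
        then have "odd i"
          by presburger
        then show ?thesis
          using True by (simp add: c_def)
      qed (use that in \<open>simp add: c_def\<close>)
      then have no: False if "i < 2 * k" "isl (c i) = isl (c (Suc i mod (2 * k)))" for i
        using that by blast
      show ?thesis
      proof (cases "isl x = isl y")
        case True
        then show ?thesis
          using iadj_isl no by metis
      next
        case False
        then show ?thesis
          using incident by (cases x; cases y) (simp_all, blast+)
      qed
    qed
  qed (use k in simp)
  then show "\<exists>c. cycle_graph (2 * k) (elems \<Gamma>) (iadj \<Gamma>) c"
    by blast
qed

lemma ordinary_polygonI:
  assumes geo: "is_geometry \<Gamma>" and k: "2 \<le> k" and cyc: "cycle_graph (2 * k) (elems \<Gamma>) (iadj \<Gamma>) c"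
  shows "ordinary_polygon k \<Gamma>"
proof -
  have n: "0 < 2 * k"
    using k by simp
  \<comment> \<open>If the cycle starts at a line, a shift by one makes it start at a point; points
    then have the even indices.\<close>
  have "\<exists>c. cycle_graph (2 * k) (elems \<Gamma>) (iadj \<Gamma>) c \<and> isl (c 0)"
  proof (cases "isl (c 0)")
    case False
    then have "isl (c (0 + 1))"
      using cycle_isl[OF cyc, of 1] by simp
    then show ?thesis
      using cycle_shift[OF cyc n, of 1] by blast
  qed (use cyc in blast)
  then obtain c where cyc: "cycle_graph (2 * k) (elems \<Gamma>) (iadj \<Gamma>) c" and c0: "isl (c 0)"
    by blast
  note isl = cycle_isl[OF cyc] and eq = cycle_eq_iff[OF cyc n] and mem = cycle_mem[OF cyc n]
  define p where "p i = projl (c (2 * i))" for i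
  define l where "l i = projr (c (Suc (2 * i)))" for i
  have p: "c (2 * i) = Inl (p i)" and l: "c (Suc (2 * i)) = Inr (l i)" for i
    using isl[of "2 * i"] isl[of "Suc (2 * i)"] c0 by (simp_all add: p_def l_def)
  have p_mod: "p (i mod k) = p i" for i
  proof -
    have "c (2 * (i mod k)) = c (2 * i)"
      using eq[of "2 * (i mod k)" "2 * i"] by simp
    then show ?thesis
      by (simp add: p)
  qed
  have "bij_betw p {..<k} (points \<Gamma>)"
    unfolding bij_betw_def
  proof
    show "inj_on p {..<k}"
    proof (rule inj_onI)
      fix i j assume "i \<in> {..<k}" "j \<in> {..<k}" "p i = p j"
      then show "i = j"
        using eq[of "2 * i" "2 * j"] by (simp add: p)
    qed
    show "p ` {..<k} = points \<Gamma>"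
    proof (intro equalityI subsetI)
      fix x assume "x \<in> points \<Gamma>"
      then obtain i where i: "i < 2 * k" "Inl x = c i"
        using mem(2)[of "Inl x"] by auto
      then have "even i"
        using isl[of i] c0 by (metis sum.disc(1))
      then show "x \<in> p ` {..<k}"
        using i p by (auto elim!: evenE)
    next
      fix x assume "x \<in> p ` {..<k}"
      then obtain i where "x = p i"
        by blast
      then show "x \<in> points \<Gamma>"
        using mem(1)[of "2 * i"] p[of i] by auto
    qed
  qed
  moreover have "bij_betw l {..<k} (lines \<Gamma>)"
    unfolding bij_betw_def
  proof
    show "inj_on l {..<k}"
    proof (rule inj_onI)
      fix i j assume "i \<in> {..<k}" "j \<in> {..<k}" "l i = l j"
      then show "i = j"
        using eq[of "Suc (2 * i)" "Suc (2 * j)"] by (simp add: l)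
    qed
    show "l ` {..<k} = lines \<Gamma>"
    proof (intro equalityI subsetI)
      fix x assume "x \<in> lines \<Gamma>"
      then obtain i where i: "i < 2 * k" "Inr x = c i"
        using mem(2)[of "Inr x"] by auto
      then have "odd i"
        using isl[of i] c0 by (metis sum.disc(2))
      then show "x \<in> l ` {..<k}"
        using i l by (auto elim!: oddE)
    next
      fix x assume "x \<in> l ` {..<k}"
      then obtain i where "x = l i"
        by blast
      then show "x \<in> lines \<Gamma>"
        using mem(1)[of "Suc (2 * i)"] l[of i] by auto
    qed
  qed
  moreover have "inc \<Gamma> = {(p i, l i) |i. i < k} \<union> {(p (Suc i mod k), l i) |i. i < k}"
  proof -
    have "(q, m) \<in> inc \<Gamma> \<longleftrightarrow> (\<exists>i<k. m = l i \<and> (q = p i \<or> q = p (Suc i mod k)))" for q m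
    proof
      assume qm: "(q, m) \<in> inc \<Gamma>"
      then have "m \<in> lines \<Gamma>"
        using geo by (auto simp: is_geometry_def)
      then obtain i where i: "i < k" "m = l i"
        using \<open>bij_betw l {..<k} (lines \<Gamma>)\<close> by (auto simp: bij_betw_def)
      then have "Inl q \<in> {y. iadj \<Gamma> (c (Suc (2 * i))) y}"
        using qm by (simp add: l)
      then have "Inl q = c (2 * i) \<or> Inl q = c (2 * Suc i)"
        unfolding cycle_nbrs[OF cyc n] by simp
      then have "q = p i \<or> q = p (Suc i)"
        unfolding p by simp
      then show "\<exists>i<k. m = l i \<and> (q = p i \<or> q = p (Suc i mod k))"
        using i by (auto simp: p_mod)
    next
      assume "\<exists>i<k. m = l i \<and> (q = p i \<or> q = p (Suc i mod k))"
      then obtain i where i: "m = l i" "q = p i \<or> q = p (Suc i)"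
        by (auto simp: p_mod)
      then have "Inl q \<in> {c (2 * i), c (Suc (Suc (2 * i)))}"
        using p[of i] p[of "Suc i"] by auto
      then have "iadj \<Gamma> (c (Suc (2 * i))) (Inl q)"
        unfolding cycle_nbrs[OF cyc n, symmetric] by simp
      then show "(q, m) \<in> inc \<Gamma>"
        by (simp add: l i)
    qed
    then show ?thesis
      by (auto simp: set_eq_iff)
  qed
  ultimately show ?thesis
    using k unfolding ordinary_polygon_def by blast
qed

section \<open>From weak generalized octagons to the graph axioms\<close>

lemma elems_subgeometry: "subgeometry \<Delta> \<Gamma> \<Longrightarrow> elems \<Delta> \<subseteq> elems \<Gamma>"
  by (auto simp: subgeometry_def)

lemma iadj_subgeometry:
  "subgeometry \<Delta> \<Gamma> \<Longrightarrow> iadj \<Delta> x y \<longleftrightarrow> iadj \<Gamma> x y \<and> x \<in> elems \<Delta> \<and> y \<in> elems \<Delta>"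
  by (cases x; cases y) (auto simp: subgeometry_def)

lemma cycle_walk:
  assumes "cycle_graph n V adj c"
  shows "(adj ^^ k) (c i) (c (i + k))"
proof (induction k)
  case (Suc k)
  moreover have "adj (c (i + k)) (c (i + Suc k))"
    using cycle_adj[OF assms] by auto
  ultimately show ?case
    by auto
qed simp

text \<open>Of the two arcs between two vertices, of lengths \<open>j - i\<close> and
  \<open>16 - (j - i)\<close>, one has length at most 8.\<close>

lemma cycle_diam:
  assumes cyc: "cycle_graph 16 V adj c" and "x \<in> V" "y \<in> V"
  shows "\<exists>k\<le>8. (adj ^^ k) x y"
proof -
  have sym: "adj x y \<Longrightarrow> adj y x" for x y
    unfolding cycle_adj[OF cyc] by blast
  have rev: "(adj ^^ k) y x \<Longrightarrow> (adj ^^ k) x y" for k x y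
  proof (induction k arbitrary: x)
    case (Suc k)
    then show ?case
      using sym relpowp_Suc_I2[of adj] by (metis relpowp_Suc_E)
  qed simp
  have ex: "\<exists>k\<le>8. (adj ^^ k) (c i) (c j)" if "i \<le> j" "j < 16" for i j
  proof (cases "j - i \<le> 8")
    case True
    then show ?thesis
      using cycle_walk[OF cyc, of "j - i" i] that by (intro exI[of _ "j - i"]) simp
  next
    case False
    then have "(adj ^^ (16 - (j - i))) (c j) (c (i + 16))"
      using cycle_walk[OF cyc, of "16 - (j - i)" j] that by (simp add: add.commute)
    then show ?thesis
      using False rev cycle_period[OF cyc, of i] by (intro exI[of _ "16 - (j - i)"]) simp
  qed
  obtain i j where "i < 16" "j < 16" "x = c i" "y = c j"
    using cycle_mem(2)[OF cyc] assms by (metis zero_less_numeral)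
  then show ?thesis
    using ex[of i j] ex[of j i] rev by (metis nat_le_linear)
qed

text \<open>A common apartment bounds the distance of two elements by 8 and gives each of them two
  neighbours. A second predecessor below distance 8 would produce an induced cycle, that is, an
  ordinary sub \<open>k\<close>-gon with \<open>k < 8\<close>. The colour marks the lines.\<close>

lemma octagon_of_polygon:
  assumes "weak_generalized_polygon 8 \<Gamma>"
  shows "octagon (elems \<Gamma>) (iadj \<Gamma>) (\<lambda>x. \<not> isl x)"
proof -
  have geo: "is_geometry \<Gamma>"
    using assms by (simp add: weak_generalized_polygon_def)
  have ex: "\<exists>\<Delta> c. subgeometry \<Delta> \<Gamma> \<and> cycle_graph 16 (elems \<Delta>) (iadj \<Delta>) c \<and> x \<in> elems \<Delta> \<and> y \<in> elems \<Delta>"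
    if xy: "x \<in> elems \<Gamma>" "y \<in> elems \<Gamma>" for x y
  proof -
    have "\<forall>x\<in>elems \<Gamma>. \<forall>y\<in>elems \<Gamma>. \<exists>\<Delta>. subgeometry \<Delta> \<Gamma> \<and> ordinary_polygon 8 \<Delta> \<and>
        x \<in> elems \<Delta> \<and> y \<in> elems \<Delta>"
      using assms unfolding weak_generalized_polygon_def by (elim conjE)
    then obtain \<Delta> where \<Delta>: "subgeometry \<Delta> \<Gamma>" "ordinary_polygon 8 \<Delta>" "x \<in> elems \<Delta>" "y \<in> elems \<Delta>"
      using xy by metis
    then show ?thesis
      using ordinary_polygonD(3)[OF \<Delta>(2)] by auto
  qed
  interpret bip_graph "elems \<Gamma>" "iadj \<Gamma>" "\<lambda>x. \<not> isl x"
  proof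
    fix x y assume "x \<in> elems \<Gamma>" "y \<in> elems \<Gamma>"
    then obtain \<Delta> c where \<Delta>: "subgeometry \<Delta> \<Gamma>" "cycle_graph 16 (elems \<Delta>) (iadj \<Delta>) c"
      "x \<in> elems \<Delta>" "y \<in> elems \<Delta>"
      using ex by blast
    have "(iadj \<Delta> ^^ k) x y \<Longrightarrow> (iadj \<Gamma> ^^ k) x y" for k
      by (rule relpowp_mono[of "iadj \<Delta>"]) (simp_all add: iadj_subgeometry[OF \<Delta>(1)])
    then show "\<exists>k\<le>8. (iadj \<Gamma> ^^ k) x y"
      using cycle_diam[OF \<Delta>(2-4)] by blast
  qed (use iadj_sym iadj_elems[OF geo] iadj_isl in blast)+
  show ?thesis
  proof
    fix x y
    assume "x \<in> elems \<Gamma>"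
    then obtain \<Delta> c where \<Delta>: "subgeometry \<Delta> \<Gamma>" "cycle_graph 16 (elems \<Delta>) (iadj \<Delta>) c" "x \<in> elems \<Delta>"
      using ex by blast
    obtain i where "x = c i"
      using cycle_mem(2)[OF \<Delta>(2) _ \<Delta>(3)] by auto
    then have x: "x = c (Suc (i + 15))"
      using cycle_period[OF \<Delta>(2), of i] by (simp add: add.commute)
    have "iadj \<Gamma> x (c (i + 15))" "iadj \<Gamma> x (c (Suc (Suc (i + 15))))"
      using cycle_nbrs[OF \<Delta>(2), of "i + 15"] iadj_subgeometry[OF \<Delta>(1)] x by auto
    moreover have "c (i + 15) \<noteq> c (Suc (Suc (i + 15)))"
      by (rule cycle_Suc_Suc_neq[OF \<Delta>(2)]) simp
    ultimately show "\<exists>z. iadj \<Gamma> x z \<and> z \<noteq> y"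
      by metis
  next
    fix x y a b
    assume *: "x \<in> elems \<Gamma>" "d x y < 8" "iadj \<Gamma> y a" "iadj \<Gamma> y b" "d x y = Suc (d x a)" "d x y = Suc (d x b)"
    show "a = b"
    proof (rule ccontr)
      assume "a \<noteq> b"
      from ex_short_cycle[OF * this] obtain k c where k: "2 \<le> k" "k < 8" and sub: "c ` {..<2 * k} \<subseteq> elems \<Gamma>"
        and cyc: "cycle_graph (2 * k) (c ` {..<2 * k})
          (\<lambda>x y. iadj \<Gamma> x y \<and> x \<in> c ` {..<2 * k} \<and> y \<in> c ` {..<2 * k}) c"
        by blast
      define X where "X = c ` {..<2 * k}"
      define \<Delta> where "\<Delta> = \<lparr>points = Inl -` X, lines = Inr -` X, inc = inc \<Gamma> \<inter> (Inl -` X \<times> Inr -` X)\<rparr>"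
      have sub': "subgeometry \<Delta> \<Gamma>"
        using sub by (auto simp: subgeometry_def \<Delta>_def X_def[symmetric])
      have elems: "elems \<Delta> = X"
      proof (intro set_eqI)
        show "z \<in> elems \<Delta> \<longleftrightarrow> z \<in> X" for z
          by (cases z) (auto simp: \<Delta>_def)
      qed
      have "cycle_graph (2 * k) (elems \<Delta>) (iadj \<Delta>) c"
        using cyc unfolding X_def[symmetric] elems iadj_subgeometry[OF sub', abs_def] .
      moreover have "is_geometry \<Delta>"
        by (simp add: is_geometry_def \<Delta>_def)
      ultimately have "ordinary_polygon k \<Delta>"
        using ordinary_polygonI k by blast
      then show False
        using assms sub' k by (auto simp: weak_generalized_polygon_def)
    qed
  qed
qed

section \<open>Ordinary octagons as the octagons of order (1, 1)\<close>

lemma subgeometry_eq: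
  assumes "subgeometry \<Delta> \<Gamma>" "elems \<Delta> = elems \<Gamma>" "is_geometry \<Gamma>"
  shows "\<Delta> = \<Gamma>"
proof -
  have "points \<Delta> = Inl -` elems \<Delta>" "lines \<Delta> = Inr -` elems \<Delta>"
    by auto
  then have "points \<Delta> = points \<Gamma>" "lines \<Delta> = lines \<Gamma>"
    unfolding assms(2) by auto
  moreover from this have "inc \<Delta> = inc \<Gamma>"
    using assms by (auto simp: subgeometry_def is_geometry_def)
  ultimately show ?thesis
    by (simp add: geometry.equality)
qed

text \<open>Where all degrees are 2, a cycle already contains all neighbours of its vertices; by
  connectedness it is everything.\<close>

lemma cycle_subgeometry_eq:
  assumes sub: "subgeometry \<Delta> \<Gamma>" and cyc: "cycle_graph n (elems \<Delta>) (iadj \<Delta>) c" "3 \<le> n"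
    and deg: "\<And>x. x \<in> elems \<Gamma> \<Longrightarrow> card {y. iadj \<Gamma> x y} = 2"
    and conn: "\<And>x y. x \<in> elems \<Gamma> \<Longrightarrow> y \<in> elems \<Gamma> \<Longrightarrow> \<exists>k. (iadj \<Gamma> ^^ k) x y"
  shows "elems \<Delta> = elems \<Gamma>"
proof
  have closed: "y \<in> elems \<Delta>" if "x \<in> elems \<Delta>" "iadj \<Gamma> x y" for x y
  proof -
    have "\<exists>i<n. x = c i"
      using cycle_mem(2)[OF cyc(1) _ that(1)] cyc(2) by simp
    then obtain i where i: "x = c i"
      by blast
    define j where "j = i + (n - 1)"
    have x: "x = c (Suc j)"
      using i cycle_period[OF cyc(1), of i] cyc(2) by (simp add: j_def)
    have nbrs: "{c j, c (Suc (Suc j))} \<subseteq> {y. iadj \<Gamma> x y}"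
      using cycle_nbrs[OF cyc(1), of j] cyc(2) x iadj_subgeometry[OF sub] by auto
    have deg_x: "card {y. iadj \<Gamma> x y} = 2"
      by (rule deg, rule subsetD[OF elems_subgeometry[OF sub] that(1)])
    then have "finite {y. iadj \<Gamma> x y}"
      by (intro card_ge_0_finite) simp
    then have "{c j, c (Suc (Suc j))} = {y. iadj \<Gamma> x y}"
      using nbrs deg_x cycle_Suc_Suc_neq[OF cyc, of j] by (intro card_subset_eq) auto
    then have "y = c j \<or> y = c (Suc (Suc j))"
      using that(2) by blast
    then show ?thesis
      using cycle_mem(1)[OF cyc(1)] cyc(2) by (auto simp only:)
  qed
  have walk: "y \<in> elems \<Delta>" if "x \<in> elems \<Delta>" "(iadj \<Gamma> ^^ k) x y" for x y k
    using that(2) by (induction k arbitrary: y) (use that(1) closed in auto)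
  have "c 0 \<in> elems \<Delta>"
    using cycle_mem(1)[OF cyc(1)] cyc(2) by auto
  then show "elems \<Gamma> \<subseteq> elems \<Delta>"
    using walk conn elems_subgeometry[OF sub] by blast
qed (rule elems_subgeometry[OF sub])

text \<open>The octagon is its own apartment. A smaller ordinary subpolygon would have to be
  everything, but has \<open>2 * k\<close> instead of 16 elements.\<close>

lemma ordinary_octagon_thin:
  assumes "ordinary_polygon 8 \<Gamma>"
  shows "thin_generalized_polygon 8 1 \<Gamma>"
proof -
  have geo: "is_geometry \<Gamma>"
    using ordinary_polygonD(2)[OF assms] .
  obtain c where cyc: "cycle_graph 16 (elems \<Gamma>) (iadj \<Gamma>) c"
    using ordinary_polygonD(3)[OF assms] by auto
  have deg: "card {y. iadj \<Gamma> x y} = 2" if "x \<in> elems \<Gamma>" for x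
  proof -
    have "\<exists>i<16. x = c i"
      using cycle_mem(2)[OF cyc _ that] by simp
    then obtain i where "x = c i"
      by blast
    then have x: "x = c (Suc (i + 15))"
      using cycle_period[OF cyc, of i] by (simp add: add.commute)
    show ?thesis
      unfolding x using cycle_nbrs[OF cyc, of "i + 15"] cycle_Suc_Suc_neq[OF cyc, of "i + 15"] by simp
  qed
  have "has_order \<Gamma> 1 1"
    unfolding has_order_def using deg card_nbrs_point[OF geo] card_nbrs_line[OF geo] by force
  moreover have "\<not> (\<exists>\<Delta>. subgeometry \<Delta> \<Gamma> \<and> ordinary_polygon k \<Delta>)" if "k < 8" for k
  proof
    assume "\<exists>\<Delta>. subgeometry \<Delta> \<Gamma> \<and> ordinary_polygon k \<Delta>"
    then obtain \<Delta> where \<Delta>: "subgeometry \<Delta> \<Gamma>" "ordinary_polygon k \<Delta>"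
      by blast
    obtain c' where c': "cycle_graph (2 * k) (elems \<Delta>) (iadj \<Delta>) c'"
      using ordinary_polygonD(3)[OF \<Delta>(2)] by blast
    have "elems \<Delta> = elems \<Gamma>"
    proof (rule cycle_subgeometry_eq[OF \<Delta>(1) c' _ deg])
      show "\<exists>k. (iadj \<Gamma> ^^ k) x y" if "x \<in> elems \<Gamma>" "y \<in> elems \<Gamma>" for x y
        using cycle_diam[OF cyc that] by blast
    qed (use ordinary_polygonD(1)[OF \<Delta>(2)] in simp)
    moreover have "card (elems \<Delta>) = 2 * k" "card (elems \<Gamma>) = 16"
      using c' cyc by (auto simp: cycle_graph_def dest!: bij_betw_same_card)
    ultimately show False
      using that by simp
  qed
  moreover have "subgeometry \<Gamma> \<Gamma>"
    using geo by (auto simp: subgeometry_def is_geometry_def)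
  moreover have "elems \<Gamma> \<noteq> {}"
    using cycle_mem(1)[OF cyc] by (metis empty_iff zero_less_numeral)
  moreover have "(3::nat) \<le> 8" "(1::nat) \<le> 1"
    by simp_all
  ultimately show ?thesis
    unfolding thin_generalized_polygon_def weak_generalized_polygon_def using geo assms by blast
qed

lemma ex_ordinary_octagon: "\<exists>\<Gamma> :: (nat, nat) geometry. ordinary_polygon 8 \<Gamma>"
proof -
  define \<Gamma> :: "(nat, nat) geometry" where "\<Gamma> = \<lparr>points = {..<8}, lines = {..<8},
    inc = {(i, i) |i. i < 8} \<union> {(Suc i mod 8, i) |i. i < 8}\<rparr>"
  have "ordinary_polygon 8 \<Gamma>"
    unfolding ordinary_polygon_def \<Gamma>_def
    by (auto intro!: exI[of _ "\<lambda>i. i"] simp: bij_betw_def)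
  then show ?thesis
    by blast
qed

text \<open>Order (1, 1) makes all degrees 2, so a single apartment exhausts the geometry.\<close>

lemma thin_octagon_ordinary:
  assumes "thin_generalized_polygon 8 1 \<Gamma>"
  shows "ordinary_polygon 8 \<Gamma>"
proof -
  have weak: "weak_generalized_polygon 8 \<Gamma>" and ord: "has_order \<Gamma> 1 1"
    using assms by (auto simp: thin_generalized_polygon_def)
  have geo: "is_geometry \<Gamma>"
    using weak by (simp add: weak_generalized_polygon_def)
  interpret octagon "elems \<Gamma>" "iadj \<Gamma>" "\<lambda>x. \<not> isl x"
    by (rule octagon_of_polygon[OF weak])
  obtain x where "x \<in> elems \<Gamma>"
    using weak unfolding weak_generalized_polygon_def by blast
  then obtain \<Delta> where \<Delta>: "subgeometry \<Delta> \<Gamma>" "ordinary_polygon 8 \<Delta>"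
    using weak unfolding weak_generalized_polygon_def by blast
  obtain c where c: "cycle_graph (2 * 8) (elems \<Delta>) (iadj \<Delta>) c"
    using ordinary_polygonD(3)[OF \<Delta>(2)] by blast
  have "elems \<Delta> = elems \<Gamma>"
  proof (rule cycle_subgeometry_eq[OF \<Delta>(1) c])
    show "card {y. iadj \<Gamma> x y} = 2" if "x \<in> elems \<Gamma>" for x
      using that ord card_nbrs_point[OF geo] card_nbrs_line[OF geo]
      by (cases x) (auto simp: has_order_def)
    show "\<exists>k. (iadj \<Gamma> ^^ k) x y" if "x \<in> elems \<Gamma>" "y \<in> elems \<Gamma>" for x y
      using diam[OF that] by blast
  qed simp
  then show ?thesis
    using subgeometry_eq[OF \<Delta>(1) _ geo] \<Delta>(2) by simp
qed

section \<open>Duality and the two classes\<close>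

lemma dual_simps [simp]:
  "points (dual \<Gamma>) = lines \<Gamma>" "lines (dual \<Gamma>) = points \<Gamma>" "(l, p) \<in> inc (dual \<Gamma>) \<longleftrightarrow> (p, l) \<in> inc \<Gamma>"
  by (simp_all add: dual_def)

lemma dual_dual [simp]: "dual (dual \<Gamma>) = \<Gamma>"
  by (simp add: dual_def)

lemma is_geometry_dual [simp]: "is_geometry (dual \<Gamma>) \<longleftrightarrow> is_geometry \<Gamma>"
  by (auto simp: is_geometry_def dual_def)

lemma points_on_dual [simp]: "points_on (dual \<Gamma>) = lines_through \<Gamma>"
  by (simp add: points_on_def lines_through_def fun_eq_iff)

lemma lines_through_dual [simp]: "lines_through (dual \<Gamma>) = points_on \<Gamma>"
  by (simp add: points_on_def lines_through_def fun_eq_iff)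

lemma has_order_dual [simp]: "has_order (dual \<Gamma>) t s \<longleftrightarrow> has_order \<Gamma> s t"
  by (auto simp: has_order_def)

lemma finite_geometry_dual [simp]: "finite_geometry (dual \<Gamma>) \<longleftrightarrow> finite_geometry \<Gamma>"
  by (auto simp: finite_geometry_def)

lemma subgeometry_dual: "subgeometry \<Delta> \<Gamma> \<Longrightarrow> subgeometry (dual \<Delta>) (dual \<Gamma>)"
  by (auto simp: subgeometry_def dual_def)

definition swap_sum :: "'a + 'b \<Rightarrow> 'b + 'a" where
  "swap_sum = case_sum Inr Inl"

lemma swap_sum_simps [simp]: "swap_sum (Inl x) = Inr x" "swap_sum (Inr y) = Inl y" "swap_sum (swap_sum z) = z"
  by (auto simp: swap_sum_def split: sum.split)

lemma iadj_dual: "iadj (dual \<Gamma>) x y \<longleftrightarrow> iadj \<Gamma> (swap_sum x) (swap_sum y)"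
  by (cases x; cases y) simp_all

lemma elems_dual: "elems (dual \<Gamma>) = swap_sum ` elems \<Gamma>"
  by (force simp: image_iff)

lemma mem_elems_dual: "x \<in> elems (dual \<Gamma>) \<longleftrightarrow> swap_sum x \<in> elems \<Gamma>"
  by (cases x) auto

text \<open>The definition treats points and lines asymmetrically, whereas the cycle does not; hence
  the detour through \<open>cycle_graph\<close>.\<close>

lemma ordinary_polygon_dual:
  assumes "ordinary_polygon k \<Gamma>"
  shows "ordinary_polygon k (dual \<Gamma>)"
proof -
  obtain c where cyc: "cycle_graph (2 * k) (elems \<Gamma>) (iadj \<Gamma>) c"
    using ordinary_polygonD(3)[OF assms] by blast
  have swap_eq: "x = swap_sum y \<longleftrightarrow> swap_sum x = y" for x :: "'c + 'd" and y
    by auto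
  have "cycle_graph (2 * k) (elems (dual \<Gamma>)) (iadj (dual \<Gamma>)) (swap_sum \<circ> c)"
    unfolding cycle_graph_def
  proof (intro conjI allI)
    have "bij_betw swap_sum (elems \<Gamma>) (elems (dual \<Gamma>))"
      unfolding elems_dual by (rule bij_betw_imageI) (auto intro: inj_on_inverseI[of _ swap_sum])
    moreover have "bij_betw c {..<2 * k} (elems \<Gamma>)"
      using cyc by (simp add: cycle_graph_def)
    ultimately show "bij_betw (swap_sum \<circ> c) {..<2 * k} (elems (dual \<Gamma>))"
      using bij_betw_trans by blast
    show "(swap_sum \<circ> c) (i + 2 * k) = (swap_sum \<circ> c) i" for i
      using cycle_period[OF cyc] by simp
    show "iadj (dual \<Gamma>) x y \<longleftrightarrow> (\<exists>i. x = (swap_sum \<circ> c) i \<and> y = (swap_sum \<circ> c) (Suc i) \<or>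
        y = (swap_sum \<circ> c) i \<and> x = (swap_sum \<circ> c) (Suc i))" for x y
      unfolding iadj_dual cycle_adj[OF cyc] comp_def by (metis swap_sum_simps(3))
  qed
  then show ?thesis
    using ordinary_polygonI ordinary_polygonD[OF assms] is_geometry_dual by blast
qed

lemma weak_generalized_polygon_dual:
  assumes "weak_generalized_polygon m \<Gamma>"
  shows "weak_generalized_polygon m (dual \<Gamma>)"
  unfolding weak_generalized_polygon_def
proof (intro conjI ballI allI impI)
  note w = assms[unfolded weak_generalized_polygon_def]
  show "3 \<le> m" "is_geometry (dual \<Gamma>)"
    using w by simp_all
  show "elems (dual \<Gamma>) \<noteq> {}"
    using w unfolding elems_dual by blast
  have conn: "\<forall>x\<in>elems \<Gamma>. \<forall>y\<in>elems \<Gamma>. \<exists>\<Delta>. subgeometry \<Delta> \<Gamma> \<and> ordinary_polygon m \<Delta> \<and>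
      x \<in> elems \<Delta> \<and> y \<in> elems \<Delta>"
    using w by (elim conjE)
  show "\<exists>\<Delta>. subgeometry \<Delta> (dual \<Gamma>) \<and> ordinary_polygon m \<Delta> \<and> x \<in> elems \<Delta> \<and> y \<in> elems \<Delta>"
    if "x \<in> elems (dual \<Gamma>)" "y \<in> elems (dual \<Gamma>)" for x y
  proof -
    have "\<exists>\<Delta>. subgeometry \<Delta> \<Gamma> \<and> ordinary_polygon m \<Delta> \<and> swap_sum x \<in> elems \<Delta> \<and> swap_sum y \<in> elems \<Delta>"
      using conn that unfolding mem_elems_dual by metis
    then show ?thesis
      using subgeometry_dual ordinary_polygon_dual mem_elems_dual by metis
  qed
  show "\<not> (\<exists>\<Delta>. subgeometry \<Delta> (dual \<Gamma>) \<and> ordinary_polygon k \<Delta>)" if "2 \<le> k \<and> k < m" for k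
  proof
    assume "\<exists>\<Delta>. subgeometry \<Delta> (dual \<Gamma>) \<and> ordinary_polygon k \<Delta>"
    then obtain \<Delta> where "subgeometry \<Delta> (dual \<Gamma>)" "ordinary_polygon k \<Delta>"
      by blast
    then have "subgeometry (dual \<Delta>) \<Gamma>" "ordinary_polygon k (dual \<Delta>)"
      using subgeometry_dual[of \<Delta> "dual \<Gamma>"] ordinary_polygon_dual by simp_all
    then show False
      using w that by blast
  qed
qed

lemma epimorphism_dual:
  "epimorphism S G \<Phi> \<Longrightarrow> epimorphism (dual S) (dual G) (prod.swap \<Phi>)"
  unfolding epimorphism_def morphism_def by (cases \<Phi>) auto

lemma line_fibre_dual: "line_fibre (dual S) (prod.swap \<Phi>) = point_fibre S \<Phi>"
  by (simp add: line_fibre_def point_fibre_def fun_eq_iff)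

section \<open>From a singleton line fibre to class (a)\<close>

abbreviation elem_map :: "('p \<Rightarrow> 'q) \<times> ('l \<Rightarrow> 'm) \<Rightarrow> 'p + 'l \<Rightarrow> 'q + 'm" where
  "elem_map \<Phi> \<equiv> map_sum (fst \<Phi>) (snd \<Phi>)"

lemma octagon_epi_of_epimorphism:
  assumes "finite_geometry S" "weak_generalized_polygon 8 S" "has_order S s t"
    and "weak_generalized_polygon 8 G" "epimorphism S G \<Phi>"
  shows "octagon_epi (elems S) (iadj S) (\<lambda>x. \<not> isl x) (elems G) (iadj G) (\<lambda>x. \<not> isl x)
    (elem_map \<Phi>) (\<lambda>x. if \<not> isl x then s + 1 else t + 1)"
proof -
  interpret S: octagon "elems S" "iadj S" "\<lambda>x. \<not> isl x"
    by (rule octagon_of_polygon) fact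
  interpret G: octagon "elems G" "iadj G" "\<lambda>x. \<not> isl x"
    by (rule octagon_of_polygon) fact
  have geo: "is_geometry S"
    using assms(2) by (simp add: weak_generalized_polygon_def)
  show ?thesis
  proof
    show "finite (elems S)"
      using assms(1) by (simp add: finite_geometry_def)
    show "iadj G (elem_map \<Phi> x) (elem_map \<Phi> y)" if "iadj S x y" for x y
      using that assms(5) by (cases x; cases y) (auto simp: epimorphism_def morphism_def)
    have \<Phi>: "fst \<Phi> ` points S = points G" "snd \<Phi> ` lines S = lines G"
      using assms(5) by (simp_all add: epimorphism_def)
    show "elem_map \<Phi> ` elems S = elems G"
      unfolding Plus_def image_Un image_image \<Phi>[symmetric] by simp
    show "(\<not> isl (elem_map \<Phi> x)) = (\<not> isl x)" for x
      by (cases x) auto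
    show "card {y. iadj S x y} = (if \<not> isl (elem_map \<Phi> x) then s + 1 else t + 1)" if "x \<in> elems S" for x
      using that assms(3) card_nbrs_point[OF geo] card_nbrs_line[OF geo]
      by (cases x) (auto simp: has_order_def)
  qed
qed

text \<open>\<open>P 0, \<dots>, P 7\<close> is \<open>c, d, e, f, g, h, a, b\<close> and \<open>Q (i + 1)\<close> is the line joining \<open>P i\<close> to \<open>P (i + 1)\<close>.\<close>

lemma octagon_labelling:
  fixes G :: "('p, 'l) geometry"
  assumes "ordinary_polygon 8 G" "M \<in> lines G"
  obtains P :: "nat \<Rightarrow> 'p" and Q :: "nat \<Rightarrow> 'l" where "Q 0 = M" "\<And>i. P (i + 8) = P i" "\<And>i. Q (i + 8) = Q i"
    "points G = P ` {..<8}" "inj_on P {..<8}" "inj_on Q {..<8}"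
    "\<And>i m. (P i, m) \<in> inc G \<longleftrightarrow> m = Q i \<or> m = Q (i + 1)"
    "\<And>i x. (x, Q (i + 1)) \<in> inc G \<longleftrightarrow> x = P i \<or> x = P (i + 1)"
proof -
  obtain c' where c': "cycle_graph 16 (elems G) (iadj G) c'"
    using ordinary_polygonD(3)[OF assms(1)] by auto
  have "Inr M \<in> elems G"
    using assms(2) by (rule InrI)
  then have "\<exists>k<16. Inr M = c' k"
    using cycle_mem(2)[OF c', of "Inr M"] by simp
  then obtain k where k: "Inr M = c' k"
    by blast
  define c where "c i = c' (i + k)" for i
  have cyc: "cycle_graph 16 (elems G) (iadj G) c"
    using cycle_shift[OF c', of k] by (simp add: c_def[abs_def])
  have c0: "c 0 = Inr M"
    using k by (simp add: c_def)
  have isl: "isl (c i) \<longleftrightarrow> odd i" for i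
    using cycle_isl[OF cyc, of i] c0 by simp
  define P where "P i = projl (c (2 * i + 1))" for i
  define Q where "Q i = projr (c (2 * i))" for i
  have P: "c (2 * i + 1) = Inl (P i)" for i
    using isl[of "2 * i + 1"] unfolding P_def by simp
  have Q: "c (2 * i) = Inr (Q i)" for i
    using isl[of "2 * i"] unfolding Q_def by simp
  have nbrs: "iadj G (c (Suc i)) y \<longleftrightarrow> y = c i \<or> y = c (Suc (Suc i))" for i y
    using cycle_nbrs[OF cyc, of i] by (auto simp: set_eq_iff)
  show thesis
  proof (rule that[where P = P and Q = Q])
    show "Q 0 = M"
      using Q[of 0] c0 by simp
    show "P (i + 8) = P i" "Q (i + 8) = Q i" for i
      using cycle_period[OF cyc, of "2 * i + 1"] cycle_period[OF cyc, of "2 * i"]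
      by (simp_all add: P_def Q_def add.commute)
    show "inj_on P {..<8}"
    proof (rule inj_onI)
      fix i j assume "i \<in> {..<8}" "j \<in> {..<8}" "P i = P j"
      then show "i = j"
        using cycle_eq_iff[OF cyc, of "2 * i + 1" "2 * j + 1"] unfolding P by simp
    qed
    show "inj_on Q {..<8}"
    proof (rule inj_onI)
      fix i j assume "i \<in> {..<8}" "j \<in> {..<8}" "Q i = Q j"
      then show "i = j"
        using cycle_eq_iff[OF cyc, of "2 * i" "2 * j"] unfolding Q by simp
    qed
    show "points G = P ` {..<8}"
    proof (intro equalityI subsetI)
      fix x assume "x \<in> points G"
      then have "Inl x \<in> elems G"
        by (rule InlI)
      then have "\<exists>i<16. Inl x = c i"
        using cycle_mem(2)[OF cyc, of "Inl x"] by simp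
      then obtain i where i: "i < 16" "Inl x = c i"
        by blast
      then have "odd i"
        using isl[of i] by (metis sum.disc(1))
      then obtain j where "i = 2 * j + 1"
        by (rule oddE)
      then show "x \<in> P ` {..<8}"
        using i P[of j] by auto
    next
      fix x assume "x \<in> P ` {..<8}"
      then obtain i where "x = P i"
        by blast
      then show "x \<in> points G"
        using cycle_mem(1)[OF cyc, of "2 * i + 1"] unfolding P by auto
    qed
    show "(P i, m) \<in> inc G \<longleftrightarrow> m = Q i \<or> m = Q (i + 1)" for i m
      using nbrs[of "2 * i" "Inr m"] P[of i] Q[of i] Q[of "i + 1"] by simp
    show "(x, Q (i + 1)) \<in> inc G \<longleftrightarrow> x = P i \<or> x = P (i + 1)" for i x
      using nbrs[of "2 * i + 1" "Inl x"] P[of i] P[of "i + 1"] Q[of "i + 1"] by simp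
  qed
qed

lemma epimorphism_inc: "epimorphism S G \<Phi> \<Longrightarrow> (p, l) \<in> inc S \<Longrightarrow> (fst \<Phi> p, snd \<Phi> l) \<in> inc G"
  by (simp add: epimorphism_def morphism_def)

lemma lines_meeting_point_fibre:
  assumes epi: "epimorphism S G \<Phi>"
    and geo: "is_geometry S"
    and lift: "\<And>l x. l \<in> lines S \<Longrightarrow> (x, snd \<Phi> l) \<in> inc G \<Longrightarrow> \<exists>p. (p, l) \<in> inc S \<and> fst \<Phi> p = x"
  shows "lines_meeting S (point_fibre S \<Phi> x) = {l \<in> lines S. (x, snd \<Phi> l) \<in> inc G}"
proof (intro equalityI subsetI)
  fix l assume "l \<in> lines_meeting S (point_fibre S \<Phi> x)"
  then show "l \<in> {l \<in> lines S. (x, snd \<Phi> l) \<in> inc G}"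
    using epimorphism_inc[OF epi] by (auto simp: lines_meeting_def point_fibre_def)
next
  fix l assume l: "l \<in> {l \<in> lines S. (x, snd \<Phi> l) \<in> inc G}"
  then obtain p where "(p, l) \<in> inc S" "fst \<Phi> p = x"
    using lift by blast
  then show "l \<in> lines_meeting S (point_fibre S \<Phi> x)"
    using l geo by (auto simp: lines_meeting_def point_fibre_def is_geometry_def)
qed

text \<open>Two lifts are composed: a line over \<open>m\<close> through \<open>y\<close>, then a
  point over \<open>x\<close> on that line. It differs from \<open>y\<close> because the images
  differ.\<close>

lemma collinear_with_point_fibre:
  assumes epi: "epimorphism S G \<Phi>"
    and geo: "is_geometry S"
    and lift: "\<And>l x. l \<in> lines S \<Longrightarrow> (x, snd \<Phi> l) \<in> inc G \<Longrightarrow> \<exists>p. (p, l) \<in> inc S \<and> fst \<Phi> p = x"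
    and lift': "\<And>p m. p \<in> points S \<Longrightarrow> (fst \<Phi> p, m) \<in> inc G \<Longrightarrow> \<exists>l. (p, l) \<in> inc S \<and> snd \<Phi> l = m"
    and y: "fst \<Phi> y \<noteq> x"
  shows "y \<in> collinear_with_some S (point_fibre S \<Phi> x) \<longleftrightarrow>
    y \<in> points S \<and> (\<exists>m. (fst \<Phi> y, m) \<in> inc G \<and> (x, m) \<in> inc G)"
proof
  assume "y \<in> collinear_with_some S (point_fibre S \<Phi> x)"
  then obtain p l where "y \<in> points S" "fst \<Phi> p = x" "(y, l) \<in> inc S" "(p, l) \<in> inc S"
    by (auto simp: collinear_with_some_def point_fibre_def collinear_def)
  then have "y \<in> points S" "(fst \<Phi> y, snd \<Phi> l) \<in> inc G" "(x, snd \<Phi> l) \<in> inc G"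
    using epimorphism_inc[OF epi, of y l] epimorphism_inc[OF epi, of p l] by simp_all
  then show "y \<in> points S \<and> (\<exists>m. (fst \<Phi> y, m) \<in> inc G \<and> (x, m) \<in> inc G)"
    by blast
next
  assume r: "y \<in> points S \<and> (\<exists>m. (fst \<Phi> y, m) \<in> inc G \<and> (x, m) \<in> inc G)"
  then obtain m where m: "(fst \<Phi> y, m) \<in> inc G" "(x, m) \<in> inc G"
    by blast
  then obtain l where l: "(y, l) \<in> inc S" "snd \<Phi> l = m"
    using lift' r by blast
  then have "l \<in> lines S"
    using geo by (auto simp: is_geometry_def)
  then obtain p where p: "(p, l) \<in> inc S" "fst \<Phi> p = x"
    using lift l m by blast
  then have "p \<in> points S" "y \<noteq> p"
    using geo y by (auto simp: is_geometry_def)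
  then show "y \<in> collinear_with_some S (point_fibre S \<Phi> x)"
    using r p l \<open>l \<in> lines S\<close> by (auto simp: collinear_with_some_def point_fibre_def collinear_def)
qed

text \<open>By lifting, the lines that meet a point fibre form the two adjacent line fibres, and the
  points collinear with it form, outside it, the two adjacent point fibres. Each set in class (a) is
  one of the two after removal of the other, and \<open>L\<close> is where both chains
  start.\<close>

lemma class_a_of_singleton_fibre:
  assumes S: "finite_geometry S" "weak_generalized_polygon 8 S" "has_order S s t"
    and G: "ordinary_polygon 8 G" and epi: "epimorphism S G \<Phi>"
    and M: "M \<in> lines G" "line_fibre S \<Phi> M = {L}"
  shows "class_a S s G \<Phi>"
proof -
  have weakG: "weak_generalized_polygon 8 G"
    using ordinary_octagon_thin[OF G] by (simp add: thin_generalized_polygon_def)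
  interpret octagon_epi "elems S" "iadj S" "\<lambda>x. \<not> isl x" "elems G" "iadj G" "\<lambda>x. \<not> isl x"
    "elem_map \<Phi>" "\<lambda>x. if \<not> isl x then s + 1 else t + 1"
    by (rule octagon_epi_of_epimorphism) fact+
  have geo: "is_geometry S" and geoG: "is_geometry G"
    using S(2) weakG by (simp_all add: weak_generalized_polygon_def)
  have lift: "\<exists>p. (p, l) \<in> inc S \<and> fst \<Phi> p = x" if "l \<in> lines S" "(x, snd \<Phi> l) \<in> inc G" for l x
  proof -
    have "\<exists>y. iadj S (Inr l) y \<and> elem_map \<Phi> y = Inl x"
      by (rule lift_adj) (use that in auto)
    then obtain y where y: "iadj S (Inr l) y" "elem_map \<Phi> y = Inl x"
      by blast
    then show ?thesis
      by (cases y) auto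
  qed
  have lift': "\<exists>l. (p, l) \<in> inc S \<and> snd \<Phi> l = m" if "p \<in> points S" "(fst \<Phi> p, m) \<in> inc G" for p m
  proof -
    have "\<exists>y. iadj S (Inl p) y \<and> elem_map \<Phi> y = Inr m"
      by (rule lift_adj) (use that in auto)
    then obtain y where y: "iadj S (Inl p) y" "elem_map \<Phi> y = Inr m"
      by blast
    then show ?thesis
      by (cases y) auto
  qed
  obtain P :: "nat \<Rightarrow> _" and Q :: "nat \<Rightarrow> _" where Q0: "Q 0 = M" and perP: "\<And>i. P (i + 8) = P i" and perQ: "\<And>i. Q (i + 8) = Q i"
    and pts: "points G = P ` {..<8}" and injP: "inj_on P {..<8}" and injQ: "inj_on Q {..<8}"
    and incP: "\<And>i m. (P i, m) \<in> inc G \<longleftrightarrow> m = Q i \<or> m = Q (i + 1)"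
    and incQ: "\<And>i x. (x, Q (i + 1)) \<in> inc G \<longleftrightarrow> x = P i \<or> x = P (i + 1)"
    by (rule octagon_labelling[OF G M(1)]) (rule that)
  have eqP: "P i = P j \<longleftrightarrow> i = j" if "i < 8" "j < 8" for i j
    using injP that by (simp add: inj_on_eq_iff)
  have eqQ: "Q i = Q j \<longleftrightarrow> i = j" if "i < 8" "j < 8" for i j
    using injQ that by (simp add: inj_on_eq_iff)
  define F where "F i = point_fibre S \<Phi> (P i)" for i
  define K where "K i = line_fibre S \<Phi> (Q i)" for i
  have F: "y \<in> F i \<longleftrightarrow> y \<in> points S \<and> fst \<Phi> y = P i" for y i
    by (simp add: F_def point_fibre_def)
  have K: "l \<in> K i \<longleftrightarrow> l \<in> lines S \<and> snd \<Phi> l = Q i" for l i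
    by (simp add: K_def line_fibre_def)
  have meet: "l \<in> lines_meeting S (F i) \<longleftrightarrow> l \<in> K i \<or> l \<in> K (i + 1)" for l i
    using lines_meeting_point_fibre[OF epi geo lift, of "P i"] by (auto simp: F_def K incP)
  have coll: "y \<in> collinear_with_some S (F (i + 1)) \<longleftrightarrow> y \<in> F i \<or> y \<in> F (i + 2)"
    if "y \<notin> F (i + 1)" for y i
  proof (cases "y \<in> points S")
    case True
    then have "fst \<Phi> y \<noteq> P (i + 1)"
      using that by (simp add: F)
    have two: "i + 2 = i + 1 + 1"
      by simp
    have "(\<exists>m. (z, m) \<in> inc G \<and> (P (i + 1), m) \<in> inc G) \<longleftrightarrow> z = P i \<or> z = P (i + 1) \<or> z = P (i + 2)" for z
      unfolding two incP[of "i + 1"] using incQ[of z i] incQ[of z "i + 1"] by blast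
    then show ?thesis
      using collinear_with_point_fibre[OF epi geo lift lift' \<open>fst \<Phi> y \<noteq> P (i + 1)\<close>] True
        \<open>fst \<Phi> y \<noteq> P (i + 1)\<close> unfolding F_def[symmetric] F by blast
  next
    case False
    then show ?thesis
      by (auto simp: collinear_with_some_def F)
  qed
  have join: "joining_line G (P i) (P (i + 1)) = Q (i + 1)" "joining_line G (P (i + 1)) (P i) = Q (i + 1)"
    if i8: "i < 8" for i
  proof -
    \<comment> \<open>The points \<open>P i\<close> and \<open>P (i + 1)\<close> have the lines
      \<open>Q i\<close>, \<open>Q (i + 1)\<close> and \<open>Q (i + 1)\<close>,
      \<open>Q (i + 2)\<close>; their joining line is unique once the outer two differ.\<close>
    have ne: "Q i \<noteq> Q (i + 2)"
    proof -
      have Q89: "Q 8 = Q 0" "Q 9 = Q 1"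
        using perQ[of 0] perQ[of 1] by simp_all
      consider "i < 6" | "i = 6" | "i = 7"
        using i8 by linarith
      then show ?thesis
      proof cases
        case 1
        then show ?thesis using eqQ[of i "i + 2"] by simp
      next
        case 2
        then show ?thesis using eqQ[of 6 0] Q89 by simp
      next
        case 3
        then show ?thesis using eqQ[of 7 1] Q89 by simp
      qed
    qed
    have "L = Q (i + 1)" if "(P i, L) \<in> inc G" "(P (i + 1), L) \<in> inc G" for L
      using that ne incP[of i] incP[of "i + 1"] by (auto simp: numeral_2_eq_2)
    moreover have "(P i, Q (i + 1)) \<in> inc G" "(P (i + 1), Q (i + 1)) \<in> inc G"
      using incQ by simp_all
    moreover from this have "Q (i + 1) \<in> lines G"
      using geoG by (auto simp: is_geometry_def)
    ultimately show "joining_line G (P i) (P (i + 1)) = Q (i + 1)"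
      "joining_line G (P (i + 1)) (P i) = Q (i + 1)"
      unfolding joining_line_def by (blast intro!: the_equality)+
  qed
  have collin: "collinear G (P i) (P (i + 1))" if "P i \<noteq> P (i + 1)" for i
  proof -
    have "(P i, Q (i + 1)) \<in> inc G" "(P (i + 1), Q (i + 1)) \<in> inc G"
      using incQ by simp_all
    then show ?thesis
      using that geoG by (auto simp: collinear_def is_geometry_def)
  qed
  have P8: "P 8 = P 0" and Q8: "Q 8 = Q 0" and F8: "F 8 = F 0" and F9: "F 9 = F 1" and K8: "K 8 = K 0"
    using perP[of 0] perP[of 1] perQ[of 0] by (simp_all add: F_def K_def)
  have K0: "K 0 = {L}"
    using M(2) by (simp add: K_def Q0)
  have L: "L \<in> lines S" "snd \<Phi> L = Q 0"
    using K[of L 0] K0 by auto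
  \<comment> \<open>Each point over \<open>P 0\<close> or \<open>P 7\<close> lies on some line over
    \<open>Q 0\<close>, and \<open>L\<close> is the only such line.\<close>
  have on_L: "points_on S L = F 0 \<union> F 7"
  proof (intro equalityI subsetI)
    fix p assume "p \<in> points_on S L"
    then have p: "p \<in> points S" "(p, L) \<in> inc S"
      by (auto simp: points_on_def)
    then have "(fst \<Phi> p, Q (7 + 1)) \<in> inc G"
      using epimorphism_inc[OF epi p(2)] L Q8 by simp
    then show "p \<in> F 0 \<union> F 7"
      using p P8 unfolding incQ by (auto simp: F)
  next
    fix p assume "p \<in> F 0 \<union> F 7"
    then have p: "p \<in> points S" "(fst \<Phi> p, Q 0) \<in> inc G"
      using Q8 incP[of 0] incP[of 7] by (auto simp: F)
    then obtain l where l: "(p, l) \<in> inc S" "snd \<Phi> l = Q 0"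
      using lift' by blast
    then have "l \<in> K 0"
      using geo by (auto simp: K is_geometry_def)
    then show "p \<in> points_on S L"
      using l p K0 by (simp add: points_on_def)
  qed
  have fin: "finite (F i)" for i
    using S(1) by (simp add: F_def point_fibre_def finite_geometry_def)
  have card_F: "1 \<le> card (F i)" if "i < 8" for i
  proof -
    have "P i \<in> fst \<Phi> ` points S"
      using pts that epi by (simp add: epimorphism_def)
    then have "F i \<noteq> {}"
      by (auto simp: F)
    then show ?thesis
      using fin[of i] by (simp add: Suc_le_eq card_gt_0_iff)
  qed
  have F07: "F 0 \<inter> F 7 = {}"
    using eqP[of 0 7] by (auto simp: F)
  then have "card (F 0) + card (F 7) = s + 1"
    using card_Un_disjoint[OF fin fin, of 0 7] S(3) L(1) unfolding on_L[symmetric]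
    by (simp add: has_order_def)
  then have card_le: "card (F 0) \<le> s" "card (F 7) \<le> s"
    using card_F[of 0] card_F[of 7] by simp_all
  have coll': "y \<notin> F 0 \<Longrightarrow> y \<in> collinear_with_some S (F 0) \<longleftrightarrow> y \<in> F 7 \<or> y \<in> F 1"
    "y \<notin> F 1 \<Longrightarrow> y \<in> collinear_with_some S (F 1) \<longleftrightarrow> y \<in> F 0 \<or> y \<in> F 2"
    "y \<notin> F 2 \<Longrightarrow> y \<in> collinear_with_some S (F 2) \<longleftrightarrow> y \<in> F 1 \<or> y \<in> F 3"
    "y \<notin> F 7 \<Longrightarrow> y \<in> collinear_with_some S (F 7) \<longleftrightarrow> y \<in> F 0 \<or> y \<in> F 6"
    "y \<notin> F 6 \<Longrightarrow> y \<in> collinear_with_some S (F 6) \<longleftrightarrow> y \<in> F 7 \<or> y \<in> F 5"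
    "y \<notin> F 5 \<Longrightarrow> y \<in> collinear_with_some S (F 5) \<longleftrightarrow> y \<in> F 6 \<or> y \<in> F 4" for y
    using coll[of y 7] coll[of y 0] coll[of y 1] coll[of y 6] coll[of y 5] coll[of y 4] F8 F9
    by (simp_all add: eval_nat_numeral disj_commute)
  have meet': "lines_meeting S (F i) = K i \<union> K (i + 1)" for i
    using meet[of _ i] by blast
  have disjF: "F i \<inter> F j = {}" if "i \<noteq> j" "i < 8" "j < 8" for i j
    using eqP[of i j] that by (auto simp: F)
  have disjK: "K i \<inter> K j = {}" if "i \<noteq> j" "i < 8" "j < 8" for i j
    using eqQ[of i j] that by (auto simp: K)
  \<comment> \<open>Both orders of the union occur in the definition of class (a).\<close>
  have peel: "Z = C - (X \<union> Y)" "Z = C - (Y \<union> X)"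
    if "\<And>y. y \<notin> X \<Longrightarrow> y \<in> C \<longleftrightarrow> y \<in> Y \<or> y \<in> Z" "X \<inter> Z = {}" "Y \<inter> Z = {}" for X Y Z C :: "'z set"
    using that by blast+
  have F1: "F 1 = collinear_with_some S (F 0) - points_on S L"
    unfolding on_L by (rule peel(1), rule coll'(1), assumption, (rule disjF; simp)+)
  have F6: "F 6 = collinear_with_some S (F 7) - points_on S L"
    unfolding on_L by (rule peel(2), rule coll'(4), assumption, (rule disjF; simp)+)
  have F2: "F 2 = collinear_with_some S (F 1) - (F 0 \<union> F 1)"
    by (rule peel(2), rule coll'(2), assumption, (rule disjF; simp)+)
  have F5: "F 5 = collinear_with_some S (F 6) - (F 6 \<union> F 7)"
    by (rule peel(1), rule coll'(5), assumption, (rule disjF; simp)+)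
  have F3: "F 3 = collinear_with_some S (F 2) - (F 1 \<union> F 2)"
    by (rule peel(2), rule coll'(3), assumption, (rule disjF; simp)+)
  have F4: "F 4 = collinear_with_some S (F 5) - (F 6 \<union> F 5)"
    by (rule peel(2), rule coll'(6), assumption, (rule disjF; simp)+)
  have lines: "K 1 = lines_meeting S (F 0) - {L}" "K 7 = lines_meeting S (F 7) - {L}"
    "K 2 = lines_meeting S (F 1) - K 1" "K 6 = lines_meeting S (F 6) - K 7"
    "K 3 = lines_meeting S (F 2) - K 2" "K 5 = lines_meeting S (F 5) - K 6"
    "K 4 = lines_meeting S (F 4) - K 5" "K 4 = lines_meeting S (F 3) - K 3"
    unfolding K0[symmetric] meet' using K8 disjK[of 0 1] disjK[of 0 7] disjK[of 1 2] disjK[of 6 7]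
      disjK[of 2 3] disjK[of 5 6] disjK[of 4 5] disjK[of 3 4] by (simp_all add: eval_nat_numeral) blast+
  have join': "joining_line G (P 0) (P 7) = Q 0" "joining_line G (P 0) (P 1) = Q 1"
    "joining_line G (P 6) (P 7) = Q 7" "joining_line G (P 1) (P 2) = Q 2"
    "joining_line G (P 1) (P 0) = Q 1" "joining_line G (P 6) (P 5) = Q 6"
    "joining_line G (P 2) (P 3) = Q 3" "joining_line G (P 4) (P 5) = Q 5"
    "joining_line G (P 4) (P 3) = Q 4" "joining_line G (P 5) (P 4) = Q 5"
    using join[of 0] join[of 1] join[of 2] join[of 3] join[of 4] join[of 5] join[of 6] join[of 7] P8 Q8
    by (simp_all add: eval_nat_numeral)
  have collin': "collinear G (P 6) (P 7)" "collinear G (P 7) (P 0)" "collinear G (P 0) (P 1)"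
    "collinear G (P 1) (P 2)" "collinear G (P 2) (P 3)" "collinear G (P 3) (P 4)"
    "collinear G (P 4) (P 5)" "collinear G (P 5) (P 6)"
    using collin[of 0] collin[of 1] collin[of 2] collin[of 3] collin[of 4] collin[of 5] collin[of 6]
      collin[of 7] eqP P8 by (simp_all add: eval_nat_numeral)
  have G_eq: "points G = {P 6, P 7, P 0, P 1, P 2, P 3, P 4, P 5}"
    unfolding pts by (auto simp: lessThan_Suc eval_nat_numeral)
  have dist: "distinct [P 6, P 7, P 0, P 1, P 2, P 3, P 4, P 5]"
    by (simp add: eqP)
  have card_ge: "1 \<le> card (F 0)" "1 \<le> card (F 7)"
    using card_F by simp_all
  show ?thesis
    unfolding class_a_def Let_def
    apply (rule exI[of _ "P 6"], rule exI[of _ "P 7"], rule exI[of _ "P 0"], rule exI[of _ "P 1"],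
        rule exI[of _ "P 2"], rule exI[of _ "P 3"], rule exI[of _ "P 4"], rule exI[of _ "P 5"])
    unfolding join' F_def[symmetric] K_def[symmetric]
    by (intro conjI bexI[of _ L])
      (rule G_eq dist collin' on_L[symmetric] F07 card_ge card_le F1 F2 F3 F4 F5 F6 K0 lines L(1))+
qed

section \<open>Epimorphisms onto thin octagons\<close>

context octagon
begin

text \<open>Fold \<open>V\<close> onto the cycle by the distance from \<open>L\<close>; the side is decided by whether the geodesic to
  \<open>L\<close> ends with the neighbour \<open>x\<close>.\<close>

lemma ex_folding:
  assumes L: "L \<in> V" and cyc: "cycle_graph 16 W B c"
  shows "\<exists>\<phi>. \<phi> ` V = W \<and> (\<forall>x y. adj x y \<longrightarrow> B (\<phi> x) (\<phi> y)) \<and>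
    (\<forall>v\<in>V. \<phi> v = c 0 \<longleftrightarrow> v = L) \<and> (\<forall>v\<in>V. \<exists>i. \<phi> v = c i \<and> (even i \<longleftrightarrow> col v = col L))"
proof -
  obtain x where x: "adj L x"
    using another_nbr[OF L] by blast
  obtain x' where x': "adj L x'" "x' \<noteq> x"
    using another_nbr[OF L] by blast
  have xV: "x \<in> V"
    using x adj_V2 by blast
  define near where "near v \<longleftrightarrow> Suc (d x v) = d L v" for v
  \<comment> \<open>Vertices opposite to \<open>L\<close> can be reached from both sides, so they
    all go to \<open>c 8\<close>, where the two arcs meet.\<close>
  define \<phi> where "\<phi> v = (if d L v = 8 then c 8 else if near v then c (d L v) else c (16 - d L v))" for v
  have c16: "c 16 = c 0"
    using cycle_period[OF cyc, of 0] by simp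
  have B: "B (c i) (c (Suc i))" "B (c (Suc i)) (c i)" for i
    unfolding cycle_adj[OF cyc] by blast+
  \<comment> \<open>The last vertex \<open>z\<close> before \<open>L\<close> on a geodesic from
    \<open>v\<close> also serves \<open>v'\<close>, and below distance 8 it is unique; so
    \<open>v\<close> and \<open>v'\<close> are on the same side.\<close>
  have near_iff: "near v \<longleftrightarrow> near v'" if "adj v v'" "d L v' = Suc (d L v)" "0 < d L v" "d L v < 7" for v v'
  proof
    have V: "v \<in> V" "v' \<in> V"
      using that adj_V adj_V2 by blast+
    {
      assume "near v"
      then have "d x v' \<le> d L v"
        using d_adj_le[OF xV that(1)] by (simp add: near_def)
      moreover have "d L v' \<le> Suc (d x v')"
        using d_from_adj[OF x V(2)] by auto
      ultimately show "near v'"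
        using that(2) by (simp add: near_def)
    next
      assume v': "near v'"
      obtain k where k: "d L v = Suc k"
        using \<open>0 < d L v\<close> gr0_conv_Suc by blast
      then obtain z where z: "adj L z" "d v z = k"
        using d_pred[OF V(1) L, of k] by (auto simp: d_sym)
      have "d v' z \<le> Suc k"
        using d_from_adj[OF that(1) adj_V2[OF z(1)]] z(2) by auto
      moreover have "d v' L = Suc (Suc k)"
        using that(2) k by (simp add: d_sym)
      ultimately have "d v' L = Suc (d v' z)"
        using d_adj[OF V(2) z(1)] by auto
      moreover have "d v' L = Suc (d v' x)"
        using v' by (simp add: near_def d_sym)
      ultimately have "z = x"
        using unique_pred[OF V(2) _ z(1) x] that(2,4) by (simp add: d_sym)
      then show "near v"
        using z(2) k by (simp add: near_def d_sym)
    }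
  qed
  have hom1: "B (\<phi> v) (\<phi> v') \<and> B (\<phi> v') (\<phi> v)" if "adj v v'" "d L v' = Suc (d L v)" for v v'
  proof -
    define k where "k = d L v"
    have "d L v' \<le> 8"
      using d_le_8[OF L adj_V2[OF that(1)]] .
    then have "k \<le> 7"
      using that(2) k_def by linarith
    then consider "k = 0" | "0 < k" "k < 7" | "k = 7"
      by linarith
    then show ?thesis
    proof cases
      case 1
      then have "\<phi> v = c 0"
        using c16 by (simp add: \<phi>_def k_def[symmetric] near_def)
      moreover have "\<phi> v' = c 1 \<or> \<phi> v' = c 15"
        using that(2) 1 by (simp add: \<phi>_def k_def)
      ultimately show ?thesis
        using B[of 0] B[of 15] c16 by auto
    next
      case 2
      then have "16 - k = Suc (16 - Suc k)"
        by simp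
      moreover have "\<phi> v = (if near v then c k else c (16 - k))"
        "\<phi> v' = (if near v then c (Suc k) else c (16 - Suc k))"
        using 2 near_iff[OF that] that(2) by (auto simp: \<phi>_def k_def)
      ultimately show ?thesis
        using B[of k] B[of "16 - Suc k"] by simp
    next
      case 3
      then have "\<phi> v = c 7 \<or> \<phi> v = c 9" "\<phi> v' = c 8"
        using that(2) by (auto simp: \<phi>_def k_def)
      then show ?thesis
        using B[of 7] B[of 8] by auto
    qed
  qed
  have hom: "B (\<phi> v) (\<phi> v')" if "adj v v'" for v v'
    using d_adj[OF L that] hom1[OF that] hom1[OF adj_sym[OF that]] by blast
  have "\<phi> ` V = W"
  proof (intro equalityI subsetI)
    fix z assume "z \<in> \<phi> ` V"
    then show "z \<in> W"
      using cycle_mem(1)[OF cyc] by (auto simp: \<phi>_def)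
  next
    fix z assume "z \<in> W"
    then have "\<exists>i<16. z = c i"
      using cycle_mem(2)[OF cyc] by simp
    then obtain i where i: "i < 16" "z = c i"
      by blast
    obtain h where h: "h 0 = L" "h 1 = x" "nb_walk h 8"
      using ex_nb_walk[OF x] by blast
    obtain h' where h': "h' 0 = L" "h' 1 = x'" "nb_walk h' 8"
      using ex_nb_walk[OF x'(1)] by blast
    show "z \<in> \<phi> ` V"
    proof (cases "0 < i \<and> i \<le> 8")
      case True
      then obtain j where j: "i = Suc j"
        using gr0_conv_Suc by blast
      have "d L (h i) = i"
        using d_nb_walk[OF nb_walk_mono[OF h(3)], of i] True h(1) by simp
      moreover have "nb_walk (\<lambda>m. h (m + 1)) j"
        using nb_walk_shift[of h j 1] nb_walk_mono[OF h(3), of i] True j by simp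
      from d_nb_walk[OF this] have "d x (h i) = j"
        using True h(2) j by simp
      ultimately have "\<phi> (h i) = c i"
        using j by (simp add: \<phi>_def near_def)
      then show ?thesis
        using i(2) nb_walk_V[OF h(3), of i] True by force
    next
      case False
      \<comment> \<open>The labels left are \<open>c 0\<close> and \<open>c 9\<close> to
        \<open>c 15\<close>, at distance \<open>j\<close> from \<open>L\<close> on the other arc.
        Putting \<open>x\<close> in front of the walk through \<open>x'\<close> shows that its
        vertices are not \<open>near\<close>.\<close>
      define j where "j = (16 - i) mod 16"
      have j: "j \<le> 7" "c (16 - j) = c i"
        using False i(1) c16 by (auto simp: j_def)
      have "d L (h' j) = j"
        using d_nb_walk[OF nb_walk_mono[OF h'(3)], of j] j h'(1) by simp
      moreover have "nb_walk (case_nat x h') 8"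
        using h' x x' adj_sym unfolding nb_walk_def by (auto split: nat.split)
      from d_nb_walk[OF nb_walk_mono[OF this, of "Suc j"]] have "d x (h' j) = Suc j"
        using j by simp
      ultimately have "\<phi> (h' j) = c i"
        using j by (simp add: \<phi>_def near_def)
      then show ?thesis
        using i(2) nb_walk_V[OF h'(3), of j] j by force
    qed
  qed
  moreover have "\<phi> v = c 0 \<longleftrightarrow> v = L" if "v \<in> V" for v
  proof
    assume v: "\<phi> v = c 0"
    have "d L v = 0"
    proof (rule ccontr)
      assume "d L v \<noteq> 0"
      then have "d L v mod 16 \<noteq> 0" "(16 - d L v) mod 16 \<noteq> 0"
        using d_le_8[OF L that] by auto
      then have "c (d L v) \<noteq> c 0" "c (16 - d L v) \<noteq> c 0"
        using cycle_eq_iff[OF cyc, of _ 0] by simp_all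
      then show False
        using v by (auto simp: \<phi>_def split: if_splits)
    qed
    then show "v = L"
      using d_eq_0_iff[OF L that] by simp
  qed (use c16 in \<open>simp add: \<phi>_def near_def\<close>)
  moreover have "\<exists>i. \<phi> v = c i \<and> (even i \<longleftrightarrow> col v = col L)" if "v \<in> V" for v
  proof -
    have "even (16 - d L v) \<longleftrightarrow> even (d L v)"
      using d_le_8[OF L that] by simp
    then show ?thesis
      using d_parity[OF L that] by (cases "d L v = 8 \<or> near v")
        (auto simp: \<phi>_def intro: exI[of _ "d L v"] exI[of _ "16 - d L v"])
  qed
  ultimately show ?thesis
    using hom by blast
qed

end

section \<open>Existence of both classes, and the classification\<close>

lemma vimage_Plus: "Inl -` (X <+> Y) = X" "Inr -` (X <+> Y) = Y"
  by auto

text \<open>The folding at a line \<open>L\<close> onto a cycle labelled from a line preserves types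
  and has \<open>L\<close> as its only element over \<open>c 0\<close>; it is therefore an
  epimorphism with a singleton line fibre.\<close>

lemma ex_class_a:
  fixes S :: "('a, 'b) geometry"
  assumes S: "finite_geometry S" "weak_generalized_polygon 8 S" "has_order S s t"
    and G: "ordinary_polygon 8 G"
  shows "\<exists>\<Phi>. epimorphism S G \<Phi> \<and> class_a S s G \<Phi>"
proof -
  interpret S: octagon "elems S" "iadj S" "\<lambda>x. \<not> isl x"
    by (rule octagon_of_polygon[OF S(2)])
  have geo: "is_geometry S"
    using S(2) by (simp add: weak_generalized_polygon_def)
  obtain x where x: "x \<in> elems S"
    using S(2) unfolding weak_generalized_polygon_def by blast
  then obtain y where "iadj S x y"
    using S.another_nbr by blast
  then obtain L where L: "L \<in> lines S"
    using geo by (auto simp: iadj_def is_geometry_def)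
  obtain c' where c': "cycle_graph 16 (elems G) (iadj G) c'"
    using ordinary_polygonD(3)[OF G] by auto
  obtain k where "\<not> isl (c' k)"
    using cycle_isl[OF c', of 1] by auto
  define c where "c i = c' (i + k)" for i
  have cyc: "cycle_graph 16 (elems G) (iadj G) c"
    using cycle_shift[OF c', of k] by (simp add: c_def[abs_def])
  have isl: "isl (c i) \<longleftrightarrow> odd i" for i
    using cycle_isl[OF cyc, of i] \<open>\<not> isl (c' k)\<close> by (simp add: c_def)
  obtain M where M: "c 0 = Inr M"
    using isl[of 0] by (cases "c 0") auto
  have M_line: "M \<in> lines G"
    using cycle_mem(1)[OF cyc, of 0] M by auto
  have "Inr L \<in> elems S"
    using L by (rule InrI)
  from S.ex_folding[OF this cyc] obtain \<phi> where \<phi>: "\<phi> ` elems S = elems G"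
    "\<forall>x y. iadj S x y \<longrightarrow> iadj G (\<phi> x) (\<phi> y)" "\<forall>v\<in>elems S. \<phi> v = c 0 \<longleftrightarrow> v = Inr L"
    and parity: "\<forall>v\<in>elems S. \<exists>i. \<phi> v = c i \<and> (even i \<longleftrightarrow> (\<not> isl v) = (\<not> isl (Inr L :: 'a + 'b)))"
    by (elim exE conjE) (rule that)
  have isl_\<phi>: "isl (\<phi> v) \<longleftrightarrow> isl v" if v: "v \<in> elems S" for v
  proof -
    obtain i where "\<phi> v = c i" "even i \<longleftrightarrow> \<not> isl v"
      using bspec[OF parity v] by auto
    then show ?thesis
      using isl[of i] by (simp only:) blast
  qed
  define \<Phi> where "\<Phi> = (\<lambda>p. projl (\<phi> (Inl p)), \<lambda>l. projr (\<phi> (Inr l)))"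
  have P: "\<phi> (Inl p) = Inl (fst \<Phi> p)" if "p \<in> points S" for p
    using isl_\<phi>[OF InlI[OF that]] by (simp add: \<Phi>_def)
  have Q: "\<phi> (Inr l) = Inr (snd \<Phi> l)" if "l \<in> lines S" for l
    using isl_\<phi>[OF InrI[OF that]] by (simp add: \<Phi>_def)
  have "\<phi> ` elems S = fst \<Phi> ` points S <+> snd \<Phi> ` lines S"
    unfolding Plus_def image_Un image_image using P Q by simp
  then have "Inl -` elems G = Inl -` (fst \<Phi> ` points S <+> snd \<Phi> ` lines S)"
    "Inr -` elems G = Inr -` (fst \<Phi> ` points S <+> snd \<Phi> ` lines S)"
    unfolding \<phi>(1) by (rule arg_cong)+
  then have img: "points G = fst \<Phi> ` points S" "lines G = snd \<Phi> ` lines S"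
    unfolding vimage_Plus .
  have inc_\<Phi>: "(fst \<Phi> p, snd \<Phi> l) \<in> inc G" if "(p, l) \<in> inc S" for p l
  proof -
    have "p \<in> points S" "l \<in> lines S"
      using that geo by (auto simp: is_geometry_def)
    then show ?thesis
      using \<phi>(2)[rule_format, of "Inl p" "Inr l"] that P Q by simp
  qed
  have epi: "epimorphism S G \<Phi>"
    unfolding epimorphism_def morphism_def using img inc_\<Phi> by simp
  have "line_fibre S \<Phi> M = {L}"
  proof -
    have "snd \<Phi> l = M \<longleftrightarrow> l = L" if "l \<in> lines S" for l
      using bspec[OF \<phi>(3) InrI[OF that]] Q[OF that] M by simp
    then show ?thesis
      using L by (auto simp: line_fibre_def)
  qed
  then show ?thesis
    using class_a_of_singleton_fibre[OF S G epi M_line] epi by blast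
qed

lemma ex_class_b:
  assumes S: "finite_geometry S" "weak_generalized_polygon 8 S" "has_order S s t"
    and G: "ordinary_polygon 8 G"
  shows "\<exists>\<Phi>. epimorphism S G \<Phi> \<and> class_b S t G \<Phi>"
proof -
  obtain \<Psi> where \<Psi>: "epimorphism (dual S) (dual G) \<Psi>" "class_a (dual S) t (dual G) \<Psi>"
    using ex_class_a[of "dual S" t s "dual G"] S G weak_generalized_polygon_dual ordinary_polygon_dual
    by fastforce
  have "epimorphism S G (prod.swap \<Psi>)"
    using epimorphism_dual[OF \<Psi>(1)] by simp
  moreover have "class_b S t G (prod.swap \<Psi>)"
    using \<Psi>(2) by (simp add: class_b_def)
  ultimately show ?thesis
    by blast
qed

text \<open>\<open>has_order\<close> and \<open>thick\<close> are vacuous without points or lines,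
  so an incident pair is produced; finiteness excludes the infinite alternative in
  \<open>thick\<close>.\<close>

lemma order_of_thick:
  assumes "thick_generalized_polygon 8 S" "finite_geometry S" "has_order S s t"
  shows "2 \<le> s" "2 \<le> t"
proof -
  have weak: "weak_generalized_polygon 8 S" and thick: "thick S"
    using assms(1) by (simp_all add: thick_generalized_polygon_def)
  interpret octagon "elems S" "iadj S" "\<lambda>x. \<not> isl x"
    by (rule octagon_of_polygon[OF weak])
  have geo: "is_geometry S"
    using weak by (simp add: weak_generalized_polygon_def)
  obtain x where x: "x \<in> elems S"
    using weak unfolding weak_generalized_polygon_def by blast
  then obtain y where "iadj S x y"
    using another_nbr by blast
  then obtain p l where "p \<in> points S" "l \<in> lines S"
    using geo by (auto simp: iadj_def is_geometry_def)
  moreover have "finite (lines_through S p)" "finite (points_on S l)"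
    using assms(2) by (simp_all add: finite_geometry_def lines_through_def points_on_def)
  ultimately show "2 \<le> s" "2 \<le> t"
    using thick assms(3) by (auto simp: thick_def has_order_def)
qed

lemma epimorphism_onto_thin_octagon:
  assumes S: "finite_geometry S" "thick_generalized_polygon 8 S" "has_order S s t"
    and G: "thin_generalized_polygon 8 s' G" and epi: "epimorphism S G \<Phi>"
  shows "s' = 1 \<and> ordinary_polygon 8 G \<and> (class_a S s G \<Phi> \<or> class_b S t G \<Phi>)"
proof -
  have weakS: "weak_generalized_polygon 8 S"
    using S(2) by (simp add: thick_generalized_polygon_def)
  have weakG: "weak_generalized_polygon 8 G" and ordG: "has_order G s' 1" and "1 \<le> s'"
    using G by (simp_all add: thin_generalized_polygon_def)
  have st: "2 \<le> s" "2 \<le> t"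
    using order_of_thick[OF S(2,1,3)] by simp_all
  have geoG: "is_geometry G"
    using weakG by (simp add: weak_generalized_polygon_def)
  interpret octagon_epi "elems S" "iadj S" "\<lambda>x. \<not> isl x" "elems G" "iadj G" "\<lambda>x. \<not> isl x"
    "elem_map \<Phi>" "\<lambda>x. if \<not> isl x then s + 1 else t + 1"
    by (rule octagon_epi_of_epimorphism) fact+
  have "s' + 1 < 3"
  proof (rule no_thick_lines)
    show "card {y. iadj G x y} = 2" if "x \<in> elems G" "\<not> \<not> isl x" for x
      using that ordG card_nbrs_point[OF geoG] by (cases x) (auto simp: has_order_def)
    show "card {y. iadj G x y} = s' + 1" if "x \<in> elems G" "\<not> isl x" for x
      using that ordG card_nbrs_line[OF geoG] by (cases x) (auto simp: has_order_def)
    show "elems G \<noteq> {}"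
      using weakG unfolding weak_generalized_polygon_def by blast
  qed (use st in auto)
  then have s': "s' = 1"
    using \<open>1 \<le> s'\<close> by simp
  have ordinary: "ordinary_polygon 8 G"
    using thin_octagon_ordinary G s' by simp
  obtain c where cyc: "cycle_graph 16 (elems G) (iadj G) c"
    using ordinary_polygonD(3)[OF ordinary] by auto
  have nb: "T.nb_walk c n" for n
    unfolding T.nb_walk_def using cycle_adj[OF cyc] cycle_Suc_Suc_neq[OF cyc] by auto
  have "\<exists>z\<in>elems G. card {v \<in> elems S. elem_map \<Phi> v = z} = 1"
  proof (rule ex_singleton_fibre)
    show "c (i + 16) = c i" for i
      by (rule cycle_period[OF cyc])
    show "T.nb_walk c n" for n
      by (rule nb)
    show "{y. iadj G (c (Suc i)) y} = {c i, c (Suc (Suc i))}" for i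
      by (rule cycle_nbrs[OF cyc]) simp
    show "3 \<le> s + 1" "3 \<le> t + 1"
      using st by simp_all
  qed (rule refl)
  then obtain z where z: "z \<in> elems G" and card_1: "card {v \<in> elems S. elem_map \<Phi> v = z} = 1"
    by blast
  obtain L where L: "{v \<in> elems S. elem_map \<Phi> v = z} = {L}"
    using card_1 by (rule card_1_singletonE)
  have mem: "v \<in> elems S \<and> elem_map \<Phi> v = z \<longleftrightarrow> v = L" for v
    using L by blast
  \<comment> \<open>The singleton is a line or a point; a point becomes a line of the dual, which
    has order (t, s).\<close>
  have "class_a S s G \<Phi> \<or> class_b S t G \<Phi>"
  proof (cases z)
    case (Inr M)
    then obtain l where l: "L = Inr l"
      using mem[of L] by (cases L) auto
    have "l' \<in> lines S \<and> snd \<Phi> l' = M \<longleftrightarrow> l' = l" for l'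
      using mem[of "Inr l'"] Inr l by auto
    then have "line_fibre S \<Phi> M = {l}"
      unfolding line_fibre_def by blast
    then show ?thesis
      using class_a_of_singleton_fibre[OF S(1) weakS S(3) ordinary epi] z Inr by blast
  next
    case (Inl q)
    then obtain p where p: "L = Inl p"
      using mem[of L] by (cases L) auto
    have "p' \<in> points S \<and> fst \<Phi> p' = q \<longleftrightarrow> p' = p" for p'
      using mem[of "Inl p'"] Inl p by auto
    then have "line_fibre (dual S) (prod.swap \<Phi>) q = {p}"
      unfolding line_fibre_dual point_fibre_def by blast
    then have "class_a (dual S) t (dual G) (prod.swap \<Phi>)"
      using class_a_of_singleton_fibre[of "dual S" t s "dual G" "prod.swap \<Phi>" q p] S(1,3)
        weak_generalized_polygon_dual[OF weakS] ordinary_polygon_dual[OF ordinary] epimorphism_dual[OF epi] z Inl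
      by auto
    then show ?thesis
      by (simp add: class_b_def)
  qed
  then show ?thesis
    using s' ordinary by blast
qed

text \<open>The second conjunct could be vacuous for types \<open>'q\<close> and \<open>'m\<close>
  that carry no octagon; the third provides an octagon on \<open>nat\<close> on which both classes
  occur.\<close>

theorem theorem4p1:
  fixes S :: "('p, 'l) geometry" and s t :: nat
  assumes "finite_geometry S"
    and "thick_generalized_polygon 8 S"
    and "has_order S s t"
  shows "(\<forall>(G :: ('q, 'm) geometry) s' \<Phi>.
            thin_generalized_polygon 8 s' G \<and> epimorphism S G \<Phi> \<longrightarrow>
            s' = 1 \<and> ordinary_polygon 8 G \<and> (class_a S s G \<Phi> \<or> class_b S t G \<Phi>))
       \<and> (\<forall>G :: ('q, 'm) geometry. thin_generalized_polygon 8 1 G \<longrightarrow>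
            (\<exists>\<Phi>. epimorphism S G \<Phi> \<and> class_a S s G \<Phi>) \<and>
            (\<exists>\<Phi>. epimorphism S G \<Phi> \<and> class_b S t G \<Phi>))
       \<and> (\<exists>G :: (nat, nat) geometry. thin_generalized_polygon 8 1 G \<and>
            (\<exists>\<Phi>. epimorphism S G \<Phi> \<and> class_a S s G \<Phi>) \<and>
            (\<exists>\<Phi>. epimorphism S G \<Phi> \<and> class_b S t G \<Phi>))"
proof -
  have weak: "weak_generalized_polygon 8 S"
    using assms(2) by (simp add: thick_generalized_polygon_def)
  note ex = ex_class_a[OF assms(1) weak assms(3)] ex_class_b[OF assms(1) weak assms(3)]
  obtain G :: "(nat, nat) geometry" where "ordinary_polygon 8 G"
    using ex_ordinary_octagon by blast
  then have "\<exists>G :: (nat, nat) geometry. thin_generalized_polygon 8 1 G \<and>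
      (\<exists>\<Phi>. epimorphism S G \<Phi> \<and> class_a S s G \<Phi>) \<and> (\<exists>\<Phi>. epimorphism S G \<Phi> \<and> class_b S t G \<Phi>)"
    using ordinary_octagon_thin ex by blast
  then show ?thesis
    using epimorphism_onto_thin_octagon[OF assms] thin_octagon_ordinary ex by blast
qed

end
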